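(* Let $q\in W_2^1[0,1]$ be a complex-valued function with $q(1)\neq 0$ and $\int_0^1 q(x)\,dx=0$. Then the spectrum $\{\lambda_k\}_{k\ge 2}$ of the boundary value problem $R(1,q)$ has the form $$\lambda_k=\frac{(\pi k)^2}{4}+k\varkappa_k,\qquad k\ge 2,\qquad \{\varkappa_k\}_{k\ge 2}\in l_2 .$$
   Context: $W_2^1[0,1]$ is the Sobolev space of absolutely continuous complex-valued functions on $[0,1]$ whose derivative lies in $L_2(0,1)$. For complex-valued $q\in L_2(0,1)$, $R(1,q)$ denotes the boundary value problem $$-y''+q(x)y=\lambda y,\quad 0<x<1,\qquad y(0)=0,\qquad y(1)\cos\rho-y'(1)\frac{\sin\rho}{\rho}=0,$$ where $\lambda=\rho^2$ is the spectral parameter ($\rho^{-1}\sin\rho$ is understood as $1$ at $\rho=0$). Let $S(x,\lambda)$ be the solution of $-y''+q(x)y=\lambda y$ with $S(0,\lambda)=0$, $S'(0,\lambda)=1$ (prime denotes $d/dx$). The characteristic function of $R(1,q)$ is the entire function of $\lambda$ $$\Delta(\lambda)=S(1,\lambda)\cos\rho-S'(1,\lambda)\frac{\sin\rho}{\rho},\qquad \rho^2=\lambda .$$ The spectrum of $R(1,q)$ is the collection of zeros of $\Delta(\lambda)$ counted with multiplicity (multiplicity of an eigenvalue is its multiplicity as a zero of $\Delta$). The assertion means that the zeros, counted with multiplicity, can be enumerated by $k=2,3,\ldots$ so that the stated asymptotics holds. $l_2$ is the space of square-summable complex sequences. *)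

theory Defs
  imports "HOL-Complex_Analysis.Complex_Analysis"
begin

text \<open>Functions on \<open>[0,1]\<close> are total functions on the reals of which only the values on
  \<open>{0..1}\<close> matter; derivatives at the endpoints are one-sided.\<close>

abbreviation deriv01 :: "(real \<Rightarrow> complex) \<Rightarrow> real \<Rightarrow> complex" where
  "deriv01 f x \<equiv> vector_derivative f (at x within {0..1})"

text \<open>The usual \<open>\<epsilon>\<close>-\<open>\<delta>\<close> definition. The set \<open>d\<close> is an arbitrary finite family of
  non-overlapping closed intervals \<open>{Inf K..Sup K}\<close> contained in \<open>S\<close>. (The library constant
  \<open>absolutely_continuous\<close> is a relation between measures.)\<close>

definition abs_continuous_on :: "real set \<Rightarrow> (real \<Rightarrow> complex) \<Rightarrow> bool" where
  "abs_continuous_on S f \<longleftrightarrow>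
     (\<forall>\<epsilon>>0. \<exists>\<delta>>0. \<forall>d. d division_of \<Union>d \<and> \<Union>d \<subseteq> S \<and> (\<Sum>K\<in>d. Sup K - Inf K) < \<delta>
        \<longrightarrow> (\<Sum>K\<in>d. norm (f (Sup K) - f (Inf K))) < \<epsilon>)"

definition L2_01 :: "(real \<Rightarrow> complex) \<Rightarrow> bool" where
  "L2_01 g \<longleftrightarrow> g \<in> borel_measurable (lebesgue_on {0..1}) \<and>
     integrable (lebesgue_on {0..1}) (\<lambda>x. (norm (g x))\<^sup>2)"

definition W21_01 :: "(real \<Rightarrow> complex) \<Rightarrow> bool" where
  "W21_01 f \<longleftrightarrow> abs_continuous_on {0..1} f \<and>
     (\<exists>g. L2_01 g \<and>
        (AE x in lebesgue_on {0..1}. (f has_vector_derivative g x) (at x within {0..1})))"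

text \<open>Solutions of \<open>-y'' + q y = \<lambda> y\<close> in the sense appropriate for \<open>q\<close> in \<open>L\<^sub>2(0,1)\<close>: \<open>y\<close> and \<open>y'\<close>
  are absolutely continuous and the equation holds almost everywhere. (Absolute continuity
  of \<open>y\<close> is implied by differentiability with continuous derivative.)\<close>

definition sl_solution :: "(real \<Rightarrow> complex) \<Rightarrow> complex \<Rightarrow> (real \<Rightarrow> complex) \<Rightarrow> bool" where
  "sl_solution q lam y \<longleftrightarrow>
     (\<forall>x\<in>{0..1}. y differentiable (at x within {0..1})) \<and>
     abs_continuous_on {0..1} (deriv01 y) \<and>
     (AE x in lebesgue_on {0..1}.
        \<exists>y2. (deriv01 y has_vector_derivative y2) (at x within {0..1}) \<and>
             - y2 + q x * y x = lam * y x)"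

text \<open>The solution \<open>S(\<cdot>,\<lambda>)\<close> is unique on \<open>{0..1}\<close>; \<open>SOME\<close> only selects its irrelevant values
  outside that interval.\<close>

definition sl_S :: "(real \<Rightarrow> complex) \<Rightarrow> complex \<Rightarrow> real \<Rightarrow> complex" where
  "sl_S q lam = (SOME y. sl_solution q lam y \<and> y 0 = 0 \<and> deriv01 y 0 = 1)"

definition csinc :: "complex \<Rightarrow> complex" where
  "csinc \<rho> = (if \<rho> = 0 then 1 else sin \<rho> / \<rho>)"

text \<open>Both \<open>cos\<close> and \<open>csinc\<close> are even, so the choice of the square root \<open>\<rho>\<close> of \<open>\<lambda>\<close> is
  immaterial.\<close>

definition char_fun :: "(real \<Rightarrow> complex) \<Rightarrow> complex \<Rightarrow> complex" where
  "char_fun q lam =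
     sl_S q lam 1 * cos (csqrt lam) - deriv01 (sl_S q lam) 1 * csinc (csqrt lam)"

text \<open>The family \<open>(s k)\<close>, \<open>k \<in> I\<close>, lists the zeros of the entire function \<open>f\<close>, each one as
  often as its multiplicity. Since \<open>I\<close> is countable, this excludes \<open>f = 0\<close>, for which
  \<open>zorder\<close> would be meaningless.\<close>

definition enumerates_zeros :: "(complex \<Rightarrow> complex) \<Rightarrow> nat set \<Rightarrow> (nat \<Rightarrow> complex) \<Rightarrow> bool" where
  "enumerates_zeros f I s \<longleftrightarrow>
     {z. f z = 0} = s ` I \<and>
     (\<forall>z. f z = 0 \<longrightarrow> finite {k\<in>I. s k = z} \<and> int (card {k\<in>I. s k = z}) = zorder f z)"

end

theory Submission
  imports Defs
begin

text \<open>
  Write \<open>\<lambda> = \<rho>\<^sup>2\<close> and \<open>\<phi>(x) = sin \<rho>x / \<rho>\<close>. For \<open>q = 0\<close> the solution \<open>S\<close>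
  is \<open>\<phi>\<close> and \<open>\<Delta>\<close> vanishes identically, so the spectrum is a pure perturbation effect. Since
  \<open>(S\<phi>' - S'\<phi>)' = - q S \<phi>\<close>, one has \<open>\<Delta>(\<lambda>) = - \<integral> q S \<phi>\<close> over \<open>[0,1]\<close>. To leading order \<open>S\<close> is \<open>\<phi>\<close>,
  and \<open>\<phi>\<^sup>2 = (1 - cos 2\<rho>x) / (2\<rho>\<^sup>2)\<close>; the constant is annihilated by the zero mean of \<open>q\<close>, and an
  integration by parts turns the rest into
  \<open>4\<rho>\<^sup>3 \<Delta>(\<rho>\<^sup>2) = q(1) sin 2\<rho> - \<integral> q'(x) sin 2\<rho>x dx + O(exp (2 |Im \<rho>|) / |\<rho>|)\<close>
  (\<open>char_fun_asymptotics\<close>).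

  As \<open>q(1) \<noteq> 0\<close>, the first term dominates: the transform of \<open>q'\<close> is \<open>o(exp (2 |Im \<rho>|))\<close>
  (\<open>deriv_sin_transform_riemann_lebesgue\<close>). Moreover, its supremum over a disc of fixed radius around
  \<open>\<rho> = \<pi>k/2\<close> is square summable in \<open>k\<close> (\<open>deriv_sin_transform_local_bound\<close>, \<open>fourier_size_summable\<close>).
  Both facts rest on Bessel's inequality, and for large \<open>|Im \<rho>|\<close> on Cauchy-Schwarz.

  Rouche's theorem on the circles \<open>|\<lambda>| = (\<pi>(N/2 + 1/4))\<^sup>2\<close> compares \<open>4\<lambda>\<Delta>(\<lambda>) / q(1)\<close> with
  \<open>sin 2\<rho> / \<rho>\<close>, which has the \<open>N\<close> simple zeros \<open>(\<pi>m/2)\<^sup>2\<close>, \<open>1 \<le> m \<le> N\<close>, inside. The factor \<open>\<lambda>\<close> accounts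
  for one zero, so \<open>\<Delta>\<close> has \<open>N - 1\<close> zeros there (\<open>count_zeros\<close>); this is why the numbering starts at
  \<open>k = 2\<close>. Consequently the annulus between the circles \<open>k - 1\<close> and \<open>k\<close> contains exactly one zero
  \<open>\<rho>\<^sup>2\<close> when \<open>k\<close> is large (\<open>enumerate_zeros_by_annuli\<close>). At a zero \<open>|q(1) sin 2\<rho>|\<close> is bounded by the
  error terms, and the lower bound \<open>norm_sin_ge\<close> gives \<open>|2\<rho> - \<pi>k| \<le> C (a\<^sub>k + 1/k)\<close> with \<open>(a\<^sub>k)\<close> in
  \<open>l\<^sub>2\<close> (\<open>zero_localisation\<close>). The claim follows from \<open>\<rho>\<^sup>2 - (\<pi>k)\<^sup>2/4 = (2\<rho> - \<pi>k)(2\<rho> + \<pi>k)/4\<close>.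

  The derivative of \<open>q\<close> enters only through the functional \<open>u \<mapsto> \<integral> q'u\<close> on continuously differentiable
  \<open>u\<close>, written as \<open>qu\<close> at the end points minus \<open>\<integral> q u'\<close>; that it is bounded in the \<open>L\<^sub>2\<close> norm is the
  content of the locale \<open>weak_deriv_L2\<close>, so that from there on all integrands are continuous.
\<close>

section \<open>Absolutely continuous functions\<close>

lemma abs_continuous_on_subset:
  "abs_continuous_on S f \<Longrightarrow> T \<subseteq> S \<Longrightarrow> abs_continuous_on T f"
  unfolding abs_continuous_on_def by (meson subset_trans)

text \<open>The fundamental theorem of calculus for absolutely continuous functions, proved directly with the
  gauge integral. Where \<open>f\<close> is differentiable the gauge is chosen as in the classical straddle
  argument. At the exceptional points it is an open superset of small measure, so that the
  intervals tagged there have small total length and absolute continuity bounds the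
  increments of \<open>f\<close> over them.\<close>

theorem abs_continuous_on_has_integral_derivative:
  fixes f g :: "real \<Rightarrow> complex"
  assumes "a \<le> b" and ac: "abs_continuous_on {a..b} f" and E: "negligible E"
    and der: "\<And>x. x \<in> {a..b} - E \<Longrightarrow> (f has_vector_derivative g x) (at x within {a..b})"
  shows "(g has_integral (f b - f a)) {a..b}"
proof (cases "a = b")
  case True
  then show ?thesis using has_integral_refl(2)[of g a] by simp
next
  case False
  then have "a < b" using assms by simp
  define g0 where "g0 x = (if x \<in> E then 0 else g x)" for x
  have "(g0 has_integral (f b - f a)) (cbox a b)"
    unfolding has_integral_factor_content
  proof (intro allI impI)
    fix e :: real assume "e > 0"
    define e' where "e' = e / 2"
    have "e' > 0" using \<open>e > 0\<close> by (simp add: e'_def)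
    obtain \<delta> where "\<delta> > 0" and \<delta>: "\<And>d. d division_of \<Union>d \<Longrightarrow> \<Union>d \<subseteq> {a..b} \<Longrightarrow>
        (\<Sum>K\<in>d. Sup K - Inf K) < \<delta> \<Longrightarrow> (\<Sum>K\<in>d. norm (f (Sup K) - f (Inf K))) < e' * (b - a)"
      using ac[unfolded abs_continuous_on_def, rule_format, of "e' * (b - a)"] \<open>e' > 0\<close> \<open>a < b\<close> by auto
    have "E \<in> sets lebesgue" using E negligible_imp_sets by blast
    then obtain T where "open T" "E \<subseteq> T" and T: "T - E \<in> lmeasurable"
        "emeasure lebesgue (T - E) < ennreal \<delta>"
      using sets_lebesgue_outer_open \<open>\<delta> > 0\<close> by metis
    have Tm: "T \<in> lmeasurable" and "measure lebesgue T < \<delta>"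
    proof -
      have "T = (T - E) \<union> E" using \<open>E \<subseteq> T\<close> by auto
      moreover have "E \<in> lmeasurable" "measure lebesgue E = 0"
        using E by (auto simp: negligible_imp_measurable negligible_imp_measure0)
      ultimately show "T \<in> lmeasurable" using T by (metis fmeasurable.Un)
      have "measure lebesgue T \<le> measure lebesgue (T - E) + measure lebesgue E"
        using T \<open>E \<in> lmeasurable\<close> \<open>T = (T - E) \<union> E\<close> by (metis measure_Un_le fmeasurableD)
      moreover have "measure lebesgue (T - E) < \<delta>"
        using T(2) unfolding emeasure_eq_measure2[OF T(1)] by (simp add: ennreal_less_iff)
      ultimately show "measure lebesgue T < \<delta>" using \<open>measure lebesgue E = 0\<close> by simp
    qed
    have "\<exists>d>0. x \<in> {a..b} - E \<longrightarrow>
         (\<forall>y\<in>{a..b}. norm (y-x) < d \<longrightarrow> norm (f y - f x - (y-x) *\<^sub>R g x) \<le> e' * norm (y-x))" for x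
    proof (cases "x \<in> {a..b} - E")
      case True
      then show ?thesis
        using der[OF True, unfolded has_vector_derivative_def has_derivative_within_alt] \<open>e' > 0\<close> by blast
    next
      case False
      then show ?thesis using zero_less_one by blast
    qed
    then obtain d where d: "\<And>x. 0 < d x"
                 "\<And>x y. \<lbrakk>x \<in> {a..b} - E; y \<in> {a..b}; norm (y-x) < d x\<rbrakk>
                        \<Longrightarrow> norm (f y - f x - (y-x) *\<^sub>R g x) \<le> e' * norm (y-x)"
      by metis
    \<comment> \<open>near \<open>E\<close> a tagged interval must lie in \<open>T\<close>, elsewhere it must be short enough for the derivative\<close>
    define \<gamma> where "\<gamma> x = (if x \<in> E then T else ball x (d x))" for x
    show "\<exists>d. gauge d \<and> (\<forall>p. p tagged_division_of (cbox a b) \<and> d fine p \<longrightarrow>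
      norm ((\<Sum>(x, k)\<in>p. measure lborel k *\<^sub>R g0 x) - (f b - f a)) \<le> e * measure lborel (cbox a b))"
    proof (rule exI[of _ \<gamma>], safe)
      show "gauge \<gamma>"
        using d(1) \<open>open T\<close> \<open>E \<subseteq> T\<close> by (auto simp: gauge_def \<gamma>_def)
    next
      fix p
      assume ptag: "p tagged_division_of cbox a b" and finep: "\<gamma> fine p"
      have "finite p" using ptag by blast
      have ba: "b - a = (\<Sum>(x,K)\<in>p. Sup K - Inf K)" "f b - f a = (\<Sum>(x,K)\<in>p. f(Sup K) - f(Inf K))"
        using additive_tagged_division_1[OF \<open>a \<le> b\<close>, of p "\<lambda>x. x"]
          additive_tagged_division_1[OF \<open>a \<le> b\<close>, of p f] ptag by simp_all
      define pE where "pE = {xk \<in> p. fst xk \<in> E}"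
      define pG where "pG = {xk \<in> p. fst xk \<notin> E}"
      have psplit: "p = pE \<union> pG" "pE \<inter> pG = {}" "finite pE" "finite pG"
        using \<open>finite p\<close> by (auto simp: pE_def pG_def)
      define h where "h = (\<lambda>(x, K). measure lborel K *\<^sub>R g0 x - (f (Sup K) - f (Inf K)))"
      have memb: "\<exists>u v. K = {u..v} \<and> u \<le> v \<and> x \<in> {u..v} \<and> {u..v} \<subseteq> {a..b} \<and> {u..v} \<subseteq> \<gamma> x"
        if xK: "(x, K) \<in> p" for x K
      proof -
        have "x \<in> K" "K \<subseteq> cbox a b" using ptag xK by blast+
        moreover obtain u v where "K = cbox u v"
          using tagged_division_ofD(4)[OF ptag xK] by blast
        moreover have "K \<subseteq> \<gamma> x" using finep xK by blast
        ultimately show ?thesis by (intro exI[of _ u] exI[of _ v]) auto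
      qed
      have good: "norm (\<Sum>xk\<in>pG. h xk) \<le> e' * (b - a)"
      proof -
        have "norm (\<Sum>xk\<in>pG. h xk) \<le> (\<Sum>n\<in>pG. e' * (case n of (x, k) \<Rightarrow> Sup k - Inf k))"
        proof (rule sum_norm_le, safe)
          fix x K assume "(x, K) \<in> pG"
          then have "(x, K) \<in> p" "x \<notin> E" by (auto simp: pG_def)
          then obtain u v where K: "K = {u..v}" "u \<le> v" "x \<in> {u..v}" "{u..v} \<subseteq> {a..b}"
              "{u..v} \<subseteq> ball x (d x)"
            using memb[OF \<open>(x, K) \<in> p\<close>] by (auto simp: \<gamma>_def)
          have uv: "u \<in> {a..b}" "v \<in> {a..b}" "x \<in> {a..b}" "norm (u - x) < d x" "norm (v - x) < d x"
          proof -
            have "u \<in> {u..v}" "v \<in> {u..v}" using K(2) by auto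
            then have "u \<in> {a..b}" "v \<in> {a..b}" "u \<in> ball x (d x)" "v \<in> ball x (d x)"
              using K(4,5) by blast+
            then show "u \<in> {a..b}" "v \<in> {a..b}" "x \<in> {a..b}" "norm (u - x) < d x" "norm (v - x) < d x"
              using K(3,4) by (auto simp: dist_real_def)
          qed
          have "norm ((v - u) *\<^sub>R g x - (f v - f u)) = norm (f u - f x - (u - x) *\<^sub>R g x - (f v - f x - (v - x) *\<^sub>R g x))"
            by (auto simp: algebra_simps)
          also have "\<dots> \<le> norm (f u - f x - (u - x) *\<^sub>R g x) + norm (f v - f x - (v - x) *\<^sub>R g x)"
            by (rule norm_triangle_ineq4)
          also have "\<dots> \<le> e' * norm (u - x) + e' * norm (v - x)"
            using uv \<open>x \<notin> E\<close> by (intro add_mono d(2)) auto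
          also have "\<dots> = e' * (v - u)" using K by (auto simp: algebra_simps)
          finally show "norm (h (x, K)) \<le> e' * (Sup K - Inf K)"
            using K \<open>x \<notin> E\<close> by (simp add: h_def g0_def)
        qed
        also have "\<dots> \<le> (\<Sum>n\<in>p. e' * (case n of (x, k) \<Rightarrow> Sup k - Inf k))"
        proof (rule sum_mono2)
          fix n assume "n \<in> p - pG"
          then show "0 \<le> e' * (case n of (x, k) \<Rightarrow> Sup k - Inf k)"
            using memb[of "fst n" "snd n"] \<open>e' > 0\<close> by (auto simp: split_beta)
        qed (use \<open>finite p\<close> in \<open>auto simp: pG_def\<close>)
        also have "\<dots> = e' * (b - a)" by (simp add: ba sum_distrib_left)
        finally show ?thesis .
      qed
      have bad: "norm (\<Sum>xk\<in>pE. h xk) \<le> e' * (b - a)"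
      proof -
        have part: "pE tagged_partial_division_of cbox a b"
          using ptag unfolding pE_def
          by (metis (mono_tags, lifting) mem_Collect_eq subsetI tagged_division_of_def tagged_partial_division_subset)
        have tU: "pE tagged_division_of \<Union>(snd ` pE)"
          using tagged_partial_division_of_Union_self[OF part] .
        define D where "D = snd ` pE"
        have D: "D division_of \<Union>D"
          using division_of_tagged_division[OF tU] by (simp add: D_def)
        have memD: "\<exists>u v. K = {u..v} \<and> u \<le> v \<and> K \<subseteq> {a..b} \<and> K \<subseteq> T" if KD: "K \<in> D" for K
        proof -
          obtain x where "(x, K) \<in> p" "x \<in> E" using KD by (auto simp: D_def pE_def)
          then show ?thesis using memb[of x K] by (auto simp: \<gamma>_def)
        qed
        then have DU: "\<Union>D \<subseteq> {a..b}" "\<Union>D \<subseteq> T" by blast+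
        have "(\<Sum>K\<in>D. Sup K - Inf K) = (\<Sum>K\<in>D. measure lebesgue K)"
        proof (rule sum.cong[OF refl])
          fix K assume "K \<in> D"
          then obtain u v where "K = {u..v}" "u \<le> v" using memD by blast
          then show "Sup K - Inf K = measure lebesgue K" by simp
        qed
        also have "\<dots> = measure lebesgue (\<Union>D)" by (rule content_division[OF D])
        also have "\<dots> \<le> measure lebesgue T"
          using DU(2) Tm lmeasurable_division[OF D] by (simp add: measure_mono_fmeasurable fmeasurableD)
        also have "\<dots> < \<delta>" by fact
        finally have small: "(\<Sum>K\<in>D. norm (f (Sup K) - f (Inf K))) < e' * (b - a)"
          using \<delta>[OF D DU(1)] by blast
        \<comment> \<open>\<open>Sup\<close> and \<open>Inf\<close> of the empty set are unspecified, while the lemma below also asks about empty intervals\<close>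
        define w where "w K = (if K = {} then 0 else norm (f (Sup K) - f (Inf K)))" for K
        have ne: "K \<noteq> {}" if "(x, K) \<in> pE" for x K
          using memb[of x K] that by (auto simp: pE_def)
        have "norm (\<Sum>xk\<in>pE. h xk) \<le> (\<Sum>(x,K)\<in>pE. w K)"
          by (rule sum_norm_le) (use ne in \<open>auto simp: h_def pE_def g0_def w_def norm_minus_commute\<close>)
        also have "\<dots> = (\<Sum>K\<in>D. w K)"
          unfolding D_def
        proof (rule sum.over_tagged_division_lemma[OF tU])
          fix u v :: real assume "box u v = {}"
          then have "cbox u v = {} \<or> u = v" by auto
          then show "w (cbox u v) = 0" by (auto simp: w_def)
        qed
        also have "\<dots> = (\<Sum>K\<in>D. norm (f (Sup K) - f (Inf K)))"
          using ne by (intro sum.cong) (auto simp: w_def D_def)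
        finally show ?thesis using small by simp
      qed
      have "(\<Sum>(x, k)\<in>p. measure lborel k *\<^sub>R g0 x) - (f b - f a) = (\<Sum>xk\<in>p. h xk)"
        by (simp add: ba h_def split_def sum_subtractf)
      also have "\<dots> = (\<Sum>xk\<in>pE. h xk) + (\<Sum>xk\<in>pG. h xk)"
        using psplit by (metis sum.union_disjoint)
      also have "norm \<dots> \<le> e' * (b - a) + e' * (b - a)"
        using good bad by (intro norm_triangle_mono)
      finally show "norm ((\<Sum>(x, k)\<in>p. measure lborel k *\<^sub>R g0 x) - (f b - f a)) \<le> e * measure lborel (cbox a b)"
        using \<open>a < b\<close> by (simp add: e'_def algebra_simps)
    qed
  qed
  then show ?thesis
    using has_integral_spike[OF E, of "{a..b}" g g0] by (simp add: g0_def)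
qed

lemma abs_continuous_on_imp_continuous_on:
  assumes "abs_continuous_on {a..b} f"
  shows "continuous_on {a..b} f"
  unfolding continuous_on_iff
proof (intro ballI allI impI)
  fix x e :: real assume x: "x \<in> {a..b}" and "e > 0"
  obtain \<delta> where "\<delta> > 0" and \<delta>: "\<And>d. d division_of \<Union>d \<Longrightarrow> \<Union>d \<subseteq> {a..b} \<Longrightarrow>
      (\<Sum>K\<in>d. Sup K - Inf K) < \<delta> \<Longrightarrow> (\<Sum>K\<in>d. norm (f (Sup K) - f (Inf K))) < e"
    using assms[unfolded abs_continuous_on_def, rule_format, of e] \<open>e > 0\<close> by auto
  have *: "norm (f v - f u) < e" if "u \<in> {a..b}" "v \<in> {a..b}" "u \<le> v" "v - u < \<delta>" for u v
    using \<delta>[of "{{u..v}}"] division_of_self[of u v] that by auto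
  show "\<exists>d>0. \<forall>x'\<in>{a..b}. dist x' x < d \<longrightarrow> dist (f x') (f x) < e"
  proof (intro exI conjI ballI impI)
    fix y assume "y \<in> {a..b}" "dist y x < \<delta>"
    then show "dist (f y) (f x) < e"
      using *[of x y] *[of y x] x
      by (cases "x \<le> y") (auto simp: dist_norm norm_minus_commute)
  qed fact
qed

text \<open>This makes \<open>qu\<close> absolutely continuous for smooth \<open>u\<close>, which is what integration by parts needs.\<close>

lemma abs_continuous_on_mult_lipschitz:
  assumes ac: "abs_continuous_on {a..b} f"
    and bound: "\<And>x. x \<in> {a..b} \<Longrightarrow> norm (f x) \<le> M" "\<And>x. x \<in> {a..b} \<Longrightarrow> norm (u x) \<le> U"
    and lip: "\<And>x y. x \<in> {a..b} \<Longrightarrow> y \<in> {a..b} \<Longrightarrow> norm (u y - u x) \<le> L * \<bar>y - x\<bar>"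
  shows "abs_continuous_on {a..b} (\<lambda>x. f x * u x)"
  unfolding abs_continuous_on_def
proof (intro allI impI)
  fix e :: real assume "e > 0"
  define M' U' L' where "M' = max M 1" and "U' = max U 1" and "L' = max L 1"
  have pos: "M' > 0" "U' > 0" "L' > 0" by (auto simp: M'_def U'_def L'_def)
  obtain \<delta> where "\<delta> > 0" and \<delta>: "\<And>d. d division_of \<Union>d \<Longrightarrow> \<Union>d \<subseteq> {a..b} \<Longrightarrow>
      (\<Sum>K\<in>d. Sup K - Inf K) < \<delta> \<Longrightarrow> (\<Sum>K\<in>d. norm (f (Sup K) - f (Inf K))) < e / (2 * U')"
    using ac[unfolded abs_continuous_on_def, rule_format, of "e / (2 * U')"] \<open>e > 0\<close> pos by auto
  show "\<exists>\<delta>>0. \<forall>d. d division_of \<Union>d \<and> \<Union>d \<subseteq> {a..b} \<and> (\<Sum>K\<in>d. Sup K - Inf K) < \<delta> \<longrightarrow>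
      (\<Sum>K\<in>d. norm (f (Sup K) * u (Sup K) - f (Inf K) * u (Inf K))) < e"
  proof (intro exI[of _ "min \<delta> (e / (2 * M' * L'))"] conjI allI impI)
    fix d assume d: "d division_of \<Union>d \<and> \<Union>d \<subseteq> {a..b} \<and>
        (\<Sum>K\<in>d. Sup K - Inf K) < min \<delta> (e / (2 * M' * L'))"
    have "(\<Sum>K\<in>d. norm (f (Sup K) * u (Sup K) - f (Inf K) * u (Inf K)))
        \<le> (\<Sum>K\<in>d. U' * norm (f (Sup K) - f (Inf K)) + M' * L' * (Sup K - Inf K))"
    proof (rule sum_mono)
      fix K assume "K \<in> d"
      then obtain s t where "K = cbox s t" "K \<noteq> {}" "K \<subseteq> \<Union>d"
        using d division_ofD(2,3,4)[of d "\<Union>d" K] by metis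
      then have K: "K = {s..t}" "s \<le> t" and st: "s \<in> {a..b}" "t \<in> {a..b}"
        using d by (auto simp: subset_iff)
      have "norm (f t * u t - f s * u s) = norm ((f t - f s) * u t + f s * (u t - u s))"
        by (simp add: algebra_simps)
      also have "\<dots> \<le> norm (f t - f s) * norm (u t) + norm (f s) * norm (u t - u s)"
        by (metis norm_mult norm_triangle_ineq)
      also have "\<dots> \<le> norm (f t - f s) * U' + M' * (L' * (t - s))"
      proof (intro add_mono mult_mono)
        have "norm (u t - u s) \<le> L * (t - s)" using lip[OF st] \<open>s \<le> t\<close> by simp
        also have "\<dots> \<le> L' * (t - s)" using \<open>s \<le> t\<close> by (intro mult_right_mono) (auto simp: L'_def)
        finally show "norm (u t - u s) \<le> L' * (t - s)" .
        show "norm (u t) \<le> U'" using bound(2)[OF st(2)] by (simp add: U'_def)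
        show "norm (f s) \<le> M'" using bound(1)[OF st(1)] by (simp add: M'_def)
      qed (use pos in auto)
      finally show "norm (f (Sup K) * u (Sup K) - f (Inf K) * u (Inf K))
          \<le> U' * norm (f (Sup K) - f (Inf K)) + M' * L' * (Sup K - Inf K)"
        using K by (simp add: algebra_simps)
    qed
    also have "\<dots> = U' * (\<Sum>K\<in>d. norm (f (Sup K) - f (Inf K))) + M' * L' * (\<Sum>K\<in>d. Sup K - Inf K)"
      by (simp add: sum.distrib sum_distrib_left)
    also have "\<dots> < U' * (e / (2 * U')) + M' * L' * (e / (2 * M' * L'))"
      using d \<delta>[of d] pos by (intro add_strict_mono mult_strict_left_mono) auto
    also have "\<dots> = e" using pos by simp
    finally show "(\<Sum>K\<in>d. norm (f (Sup K) * u (Sup K) - f (Inf K) * u (Inf K))) < e" .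
  qed (use pos \<open>e > 0\<close> \<open>\<delta> > 0\<close> in auto)
qed

lemma continuous_on_Icc_bounded:
  fixes f :: "real \<Rightarrow> complex"
  assumes "continuous_on {a..b} f"
  obtains M where "\<And>x. x \<in> {a..b} \<Longrightarrow> norm (f x) \<le> M"
proof -
  have "bounded (f ` {a..b})" using assms by (intro compact_imp_bounded compact_continuous_image) auto
  then show ?thesis using that unfolding bounded_iff by blast
qed

lemma continuously_differentiable_imp_lipschitz:
  fixes u :: "real \<Rightarrow> complex"
  assumes "\<And>x. x \<in> {a..b} \<Longrightarrow> (u has_vector_derivative u' x) (at x within {a..b})"
    and "continuous_on {a..b} u'"
  obtains L where "\<And>x y. x \<in> {a..b} \<Longrightarrow> y \<in> {a..b} \<Longrightarrow> norm (u y - u x) \<le> L * \<bar>y - x\<bar>"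
proof -
  obtain L where L: "\<And>x. x \<in> {a..b} \<Longrightarrow> norm (u' x) \<le> L"
    using continuous_on_Icc_bounded[OF assms(2)] by blast
  show ?thesis
  proof (rule that[of L])
    fix x y assume "x \<in> {a..b}" "y \<in> {a..b}"
    have "norm (u y - u x) \<le> L * norm (y - x)"
    proof (rule differentiable_bound)
      show "(u has_derivative (\<lambda>h. h *\<^sub>R u' z)) (at z within {a..b})" if "z \<in> {a..b}" for z
        using assms(1)[OF that] by (simp add: has_vector_derivative_def)
      show "onorm (\<lambda>h. h *\<^sub>R u' z) \<le> L" if "z \<in> {a..b}" for z
        by (rule onorm_le) (use L[OF that] in \<open>auto simp: mult.commute[of _ L] mult.commute[of "\<bar>_\<bar>"] intro!: mult_right_mono\<close>)
    qed (use \<open>x \<in> {a..b}\<close> \<open>y \<in> {a..b}\<close> in auto)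
    then show "norm (u y - u x) \<le> L * \<bar>y - x\<bar>" by simp
  qed
qed

lemma continuously_differentiable_imp_abs_continuous_on:
  fixes u :: "real \<Rightarrow> complex"
  assumes "\<And>x. x \<in> {a..b} \<Longrightarrow> (u has_vector_derivative u' x) (at x within {a..b})"
    and "continuous_on {a..b} u'"
  shows "abs_continuous_on {a..b} u"
proof -
  have one: "abs_continuous_on {a..b} (\<lambda>x. 1)"
    unfolding abs_continuous_on_def by (auto intro: exI[of _ 1])
  obtain L where L: "\<And>x y. x \<in> {a..b} \<Longrightarrow> y \<in> {a..b} \<Longrightarrow> norm (u y - u x) \<le> L * \<bar>y - x\<bar>"
    using continuously_differentiable_imp_lipschitz[OF assms] by blast
  have "continuous_on {a..b} u"
    using assms(1) by (meson has_vector_derivative_continuous continuous_on_eq_continuous_within)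
  then obtain U where "\<And>x. x \<in> {a..b} \<Longrightarrow> norm (u x) \<le> U"
    using continuous_on_Icc_bounded by blast
  then have "abs_continuous_on {a..b} (\<lambda>x. 1 * u x)"
    by (intro abs_continuous_on_mult_lipschitz[OF one, of 1 _ U L] L) auto
  then show ?thesis by simp
qed

section \<open>The pairing of a test function with the derivative of \<open>q\<close>\<close>

lemma AE_lebesgue_on_negligible:
  assumes "AE x in lebesgue_on {a..b::real}. P x"
  obtains E where "negligible E" "\<And>x. x \<in> {a..b} - E \<Longrightarrow> P x"
proof -
  obtain N where N: "N \<in> null_sets (lebesgue_on {a..b})" "{x \<in> space (lebesgue_on {a..b}). \<not> P x} \<subseteq> N"
    using assms unfolding eventually_ae_filter by blast
  then have "negligible N"
    using null_sets_restrict_space[of "{a..b}" lebesgue] by (auto simp: negligible_iff_null_sets)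
  moreover have "P x" if "x \<in> {a..b} - N" for x using N(2) that by auto
  ultimately show ?thesis using that by blast
qed

text \<open>The integral of \<open>q'u\<close> over \<open>[0,x]\<close> after integration by parts, with \<open>u'\<close> the derivative of \<open>u\<close>.\<close>

definition deriv_pairing :: "(real \<Rightarrow> complex) \<Rightarrow> (real \<Rightarrow> complex) \<Rightarrow> (real \<Rightarrow> complex) \<Rightarrow> real \<Rightarrow> complex" where
  "deriv_pairing q u u' x = q x * u x - q 0 * u 0 - integral {0..x} (\<lambda>t. q t * u' t)"

definition C1_on01 :: "(real \<Rightarrow> complex) \<Rightarrow> (real \<Rightarrow> complex) \<Rightarrow> bool" where
  "C1_on01 u u' \<longleftrightarrow> (\<forall>t\<in>{0..1}. (u has_vector_derivative u' t) (at t within {0..1})) \<and>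
     continuous_on {0..1} u'"

lemma C1_on01_continuous: "C1_on01 u u' \<Longrightarrow> continuous_on {0..1} u"
  unfolding C1_on01_def by (meson has_vector_derivative_continuous continuous_on_eq_continuous_within)

text \<open>All that is used about a function with square integrable derivative \<open>q'\<close>: the Cauchy-Schwarz
  bound for \<open>u \<mapsto> \<integral> q'u\<close>, with \<open>B\<close> in the role of the integral of \<open>|q'|\<^sup>2\<close>.\<close>

locale weak_deriv_L2 =
  fixes q :: "real \<Rightarrow> complex" and B :: real
  assumes cont: "continuous_on {0..1} q"
    and B_nonneg: "0 \<le> B"
    and pairing_bound: "C1_on01 u u' \<Longrightarrow> x \<in> {0..1} \<Longrightarrow>
      (norm (deriv_pairing q u u' x))\<^sup>2 \<le> B * integral {0..1} (\<lambda>t. (norm (u t))\<^sup>2)"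

text \<open>Cauchy-Schwarz from the weighted arithmetic-geometric inequality; the weight
  \<open>s = I / G\<close> turns the mean into the product.\<close>

lemma square_le_if_le_weighted_mean:
  fixes I G U :: real
  assumes "\<And>s. s > 0 \<Longrightarrow> 2 * I \<le> s * G + U / s" "G > 0" "I \<ge> 0" "U \<ge> 0"
  shows "I\<^sup>2 \<le> G * U"
proof (cases "I = 0")
  case False
  then have "I > 0" using assms by simp
  then have "2 * I \<le> I / G * G + U / (I / G)" using assms by (intro assms(1)) auto
  then have "I \<le> U * G / I" using \<open>G > 0\<close> by simp
  then show ?thesis using \<open>I > 0\<close> by (simp add: field_simps power2_eq_square)
qed (use assms in auto)

theorem W21_01_imp_weak_deriv_L2:
  assumes "W21_01 q"
  shows "\<exists>B. weak_deriv_L2 q B"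
proof -
  from assms obtain g where ac: "abs_continuous_on {0..1} q" and L2: "L2_01 g"
    and AEg: "AE x in lebesgue_on {0..1}. (q has_vector_derivative g x) (at x within {0..1})"
    unfolding W21_01_def by blast
  obtain E where E: "negligible E"
    and derq: "\<And>x. x \<in> {0..1} - E \<Longrightarrow> (q has_vector_derivative g x) (at x within {0..1})"
    using AE_lebesgue_on_negligible[OF AEg] by blast
  have contq: "continuous_on {0..1} q" using abs_continuous_on_imp_continuous_on[OF ac] .
  obtain M where M: "\<And>x. x \<in> {0..1} \<Longrightarrow> norm (q x) \<le> M"
    using continuous_on_Icc_bounded[OF contq] by blast
  have g2: "(\<lambda>x. (norm (g x))\<^sup>2) integrable_on {0..1}"
    using L2 unfolding L2_01_def by (intro integrable_on_lebesgue_on) auto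
  \<comment> \<open>the summand \<open>1\<close> only keeps \<open>G\<close> positive\<close>
  define G where "G = integral {0..1} (\<lambda>x. (norm (g x))\<^sup>2) + 1"
  have "G > 0" unfolding G_def by (intro add_nonneg_pos integral_nonneg[OF g2]) auto
  have "(norm (deriv_pairing q u u' x))\<^sup>2 \<le> G * integral {0..1} (\<lambda>t. (norm (u t))\<^sup>2)"
    if u: "C1_on01 u u'" and x: "x \<in> {0..1}" for u u' x
  proof -
    have sub: "{0..x} \<subseteq> {0..1}" using x by auto
    have deru: "\<And>t. t \<in> {0..1} \<Longrightarrow> (u has_vector_derivative u' t) (at t within {0..1})"
      and contu': "continuous_on {0..1} u'" using u by (auto simp: C1_on01_def)
    have contu: "continuous_on {0..1} u" using C1_on01_continuous[OF u] .
    then obtain U where U: "\<And>t. t \<in> {0..1} \<Longrightarrow> norm (u t) \<le> U"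
      using continuous_on_Icc_bounded by blast
    obtain L where L: "\<And>s t. s \<in> {0..1} \<Longrightarrow> t \<in> {0..1} \<Longrightarrow> norm (u t - u s) \<le> L * \<bar>t - s\<bar>"
      using continuously_differentiable_imp_lipschitz[OF deru contu'] by blast
    have "abs_continuous_on {0..1} (\<lambda>t. q t * u t)"
      by (rule abs_continuous_on_mult_lipschitz[OF ac M U L])
    then have acx: "abs_continuous_on {0..x} (\<lambda>t. q t * u t)"
      by (rule abs_continuous_on_subset[OF _ sub])
    have f1: "((\<lambda>t. q t * u' t + g t * u t) has_integral q x * u x - q 0 * u 0) {0..x}"
    proof (rule abs_continuous_on_has_integral_derivative[OF _ acx E])
      fix t assume t: "t \<in> {0..x} - E"
      then have "t \<in> {0..1} - E" using sub by auto
      then show "((\<lambda>t. q t * u t) has_vector_derivative q t * u' t + g t * u t) (at t within {0..x})"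
        using has_vector_derivative_mult[OF derq deru] has_vector_derivative_within_subset[OF _ sub] by blast
    qed (use x in auto)
    have f2: "((\<lambda>t. q t * u' t) has_integral integral {0..x} (\<lambda>t. q t * u' t)) {0..x}"
      by (intro integrable_integral integrable_continuous_real continuous_intros
          continuous_on_subset[OF contq sub] continuous_on_subset[OF contu' sub])
    have gu: "((\<lambda>t. g t * u t) has_integral deriv_pairing q u u' x) {0..x}"
      using has_integral_diff[OF f1 f2] by (simp add: deriv_pairing_def)
    have u2: "(\<lambda>t. (norm (u t))\<^sup>2) integrable_on {0..1}"
      by (intro integrable_continuous_real continuous_intros contu)
    have "2 * norm (deriv_pairing q u u' x) \<le> s * G + integral {0..1} (\<lambda>t. (norm (u t))\<^sup>2) / s"
      if "s > 0" for s
    proof -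
      define h where "h t = s / 2 * (norm (g t))\<^sup>2 + 1 / (2 * s) * (norm (u t))\<^sup>2" for t
      have hI: "(h has_integral (s / 2 * integral {0..1} (\<lambda>t. (norm (g t))\<^sup>2)
          + 1 / (2 * s) * integral {0..1} (\<lambda>t. (norm (u t))\<^sup>2))) {0..1}" unfolding h_def
        by (intro has_integral_add has_integral_mult_right integrable_integral g2 u2)
      then have hi: "h integrable_on {0..1}" by blast
      then have hx: "h integrable_on {0..x}" using sub by (rule integrable_on_subinterval)
      have pt: "norm (g t * u t) \<le> h t" for t
      proof -
        have "0 \<le> (s * norm (g t) - norm (u t))\<^sup>2 / (2 * s)" using \<open>s > 0\<close> by simp
        also have "\<dots> = h t - norm (g t) * norm (u t)"
          using \<open>s > 0\<close> by (simp add: h_def field_simps power2_eq_square)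
        finally show ?thesis by (simp add: norm_mult)
      qed
      have "norm (integral {0..x} (\<lambda>t. g t * u t)) \<le> integral {0..x} h"
        by (intro integral_norm_bound_integral hx pt has_integral_integrable[OF gu])
      also have "\<dots> \<le> integral {0..1} h"
        using hx hi sub \<open>s > 0\<close> by (intro integral_subset_le) (auto simp: h_def)
      also have "\<dots> = s / 2 * integral {0..1} (\<lambda>t. (norm (g t))\<^sup>2) + 1 / (2 * s) * integral {0..1} (\<lambda>t. (norm (u t))\<^sup>2)"
        using integral_unique[OF hI] .
      also have "\<dots> \<le> (s * G + integral {0..1} (\<lambda>t. (norm (u t))\<^sup>2) / s) / 2"
        using \<open>s > 0\<close> by (simp add: G_def field_simps)
      finally show ?thesis using integral_unique[OF gu] by simp
    qed
    then show ?thesis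
      using \<open>G > 0\<close> integral_nonneg[OF u2] by (intro square_le_if_le_weighted_mean) auto
  qed
  then show ?thesis
    using contq \<open>G > 0\<close> by (intro exI[of _ G]) (auto simp: weak_deriv_L2_def)
qed

section \<open>Classical solutions of the differential equation\<close>

text \<open>For continuous \<open>q\<close>, a solution in the almost-everywhere sense satisfies the equation at every
  point; \<open>y'\<close> is carried along to avoid one-sided derivatives.\<close>

definition classical_solution ::
    "(real \<Rightarrow> complex) \<Rightarrow> complex \<Rightarrow> (real \<Rightarrow> complex) \<Rightarrow> (real \<Rightarrow> complex) \<Rightarrow> bool" where
  "classical_solution q lam y y' \<longleftrightarrow>
     (\<forall>x\<in>{0..1}. (y has_vector_derivative y' x) (at x within {0..1}) \<and>
       (y' has_vector_derivative (q x - lam) * y x) (at x within {0..1}))"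

lemma has_vector_derivative_imp_continuous_on:
  "(\<And>x. x \<in> S \<Longrightarrow> (f has_vector_derivative f' x) (at x within S)) \<Longrightarrow> continuous_on S f"
  by (meson has_vector_derivative_continuous continuous_on_eq_continuous_within)

lemma has_integral_of_derivative01:
  fixes f :: "real \<Rightarrow> complex"
  assumes "\<And>t. t \<in> {0..1} \<Longrightarrow> (f has_vector_derivative f' t) (at t within {0..1})" "x \<in> {0..1}"
  shows "(f' has_integral (f x - f 0)) {0..x}"
proof (rule fundamental_theorem_of_calculus)
  fix t assume "t \<in> {0..x}"
  then have "(f has_vector_derivative f' t) (at t within {0..1})" using assms by auto
  then show "(f has_vector_derivative f' t) (at t within {0..x})"
    by (rule has_vector_derivative_within_subset) (use assms in auto)
qed (use assms in auto)

lemma deriv01_eq: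
  "(f has_vector_derivative f') (at x within {0..1}) \<Longrightarrow> x \<in> {0..1} \<Longrightarrow> deriv01 f x = f'"
  by (rule vector_derivative_within_closed_interval) auto

lemma classical_solution_continuous:
  assumes "classical_solution q lam y y'"
  shows "continuous_on {0..1} y" "continuous_on {0..1} y'"
  using assms unfolding classical_solution_def
  by (auto intro!: has_vector_derivative_imp_continuous_on)

text \<open>By the fundamental theorem, \<open>y'\<close> is the integral of the continuous function \<open>(q - \<lambda>) y\<close>.\<close>

lemma sl_solution_imp_classical_solution:
  assumes contq: "continuous_on {0..1} q" and sol: "sl_solution q lam y"
  shows "classical_solution q lam y (deriv01 y)"
proof -
  define y' where "y' = (\<lambda>x. deriv01 y x)"
  have dery: "(y has_vector_derivative y' x) (at x within {0..1})" if "x \<in> {0..1}" for x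
    using sol that unfolding sl_solution_def y'_def vector_derivative_works by blast
  have conty: "continuous_on {0..1} y"
    using dery by (rule has_vector_derivative_imp_continuous_on)
  have ac: "abs_continuous_on {0..1} y'" using sol unfolding sl_solution_def y'_def by blast
  have "AE x in lebesgue_on {0..1}. \<exists>y2. (y' has_vector_derivative y2) (at x within {0..1}) \<and>
      - y2 + q x * y x = lam * y x"
    using sol unfolding sl_solution_def y'_def by blast
  then obtain E where E: "negligible E" and
    derE: "\<And>x. x \<in> {0..1} - E \<Longrightarrow> \<exists>y2. (y' has_vector_derivative y2) (at x within {0..1}) \<and>
      - y2 + q x * y x = lam * y x"
    using AE_lebesgue_on_negligible by blast
  define h where "h x = (q x - lam) * y x" for x
  have conth: "continuous_on {0..1} h" unfolding h_def by (intro continuous_intros contq conty)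
  have dery': "(y' has_vector_derivative h x) (at x within {0..1})" if xE: "x \<in> {0..1} - E" for x
  proof -
    obtain y2 where y2: "(y' has_vector_derivative y2) (at x within {0..1})" "- y2 + q x * y x = lam * y x"
      using derE[OF xE] by blast
    have "y2 = h x" using y2(2) unfolding h_def by (simp add: algebra_simps)
    then show ?thesis using y2(1) by simp
  qed
  have eq: "y' x = y' 0 + integral {0..x} h" if x: "x \<in> {0..1}" for x
  proof -
    have sub: "{0..x} \<subseteq> {0..1}" using x by auto
    have "(h has_integral (y' x - y' 0)) {0..x}"
    proof (rule abs_continuous_on_has_integral_derivative[OF _ abs_continuous_on_subset[OF ac sub] E])
      fix t assume "t \<in> {0..x} - E"
      then show "(y' has_vector_derivative h t) (at t within {0..x})"
        using dery'[of t] sub has_vector_derivative_within_subset[OF _ sub] by blast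
    qed (use x in auto)
    then show ?thesis by (simp add: integral_unique)
  qed
  have "(y' has_vector_derivative h x) (at x within {0..1})" if x: "x \<in> {0..1}" for x
  proof (rule has_vector_derivative_transform[OF x])
    show "((\<lambda>x. y' 0 + integral {0..x} h) has_vector_derivative h x) (at x within {0..1})"
      using integral_has_vector_derivative[OF conth x] has_vector_derivative_add[OF has_vector_derivative_const] by fastforce
  qed (rule eq)
  then show ?thesis using dery unfolding classical_solution_def h_def y'_def by blast
qed

lemma classical_solution_imp_sl_solution:
  assumes contq: "continuous_on {0..1} q" and sol: "classical_solution q lam y y'"
  shows "sl_solution q lam y" "\<And>x. x \<in> {0..1} \<Longrightarrow> deriv01 y x = y' x"
proof -
  have dery: "(y has_vector_derivative y' x) (at x within {0..1})" if "x \<in> {0..1}" for x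
    using sol that unfolding classical_solution_def by blast
  show d: "deriv01 y x = y' x" if "x \<in> {0..1}" for x
    using deriv01_eq[OF dery] that by blast
  have derd: "((\<lambda>x. deriv01 y x) has_vector_derivative (q x - lam) * y x) (at x within {0..1})"
    if "x \<in> {0..1}" for x
  proof (rule has_vector_derivative_transform[OF that])
    show "(y' has_vector_derivative (q x - lam) * y x) (at x within {0..1})"
      using sol that unfolding classical_solution_def by blast
  qed (use d in auto)
  have "continuous_on {0..1} (\<lambda>x. (q x - lam) * y x)"
    by (intro continuous_intros contq classical_solution_continuous[OF sol])
  then have "abs_continuous_on {0..1} (\<lambda>x. deriv01 y x)"
    using derd by (intro continuously_differentiable_imp_abs_continuous_on)
  moreover have "AE x in lebesgue_on {0..1}. \<exists>y2. ((\<lambda>x. deriv01 y x) has_vector_derivative y2) (at x within {0..1}) \<and>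
             - y2 + q x * y x = lam * y x"
  proof (rule AE_I2)
    fix x assume "x \<in> space (lebesgue_on {0..1::real})"
    then have "x \<in> {0..1}" by simp
    then show "\<exists>y2. ((\<lambda>x. deriv01 y x) has_vector_derivative y2) (at x within {0..1}) \<and>
             - y2 + q x * y x = lam * y x"
      using derd by (intro exI[of _ "(q x - lam) * y x"]) (auto simp: algebra_simps)
  qed
  moreover have "y differentiable (at x within {0..1})" if "x \<in> {0..1}" for x
    using dery[OF that] by (rule differentiableI_vector)
  ultimately show "sl_solution q lam y" unfolding sl_solution_def by blast
qed

text \<open>In the norm \<open>sup (|y| + |y'|) exp (-2Kx)\<close> the integral operator of the system has norm at most
  \<open>1/2\<close>, so the homogeneous problem has only the zero solution.\<close>

lemma classical_solution_zero_initial: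
  assumes contq: "continuous_on {0..1} q" and sol: "classical_solution q lam y y'"
    and "y 0 = 0" "y' 0 = 0" and x: "x \<in> {0..1}"
  shows "y x = 0" "y' x = 0"
proof -
  note cont = classical_solution_continuous[OF sol]
  have "continuous_on {0..1} (\<lambda>t. q t - lam)" by (intro continuous_intros contq)
  then obtain K0 where K0: "\<And>t. t \<in> {0..1} \<Longrightarrow> norm (q t - lam) \<le> K0"
    using continuous_on_Icc_bounded by blast
  define K where "K = max K0 1"
  have K: "K \<ge> 1" "\<And>t. t \<in> {0..1} \<Longrightarrow> norm (q t - lam) \<le> K" using K0 by (auto simp: K_def le_max_iff_disj)
  define w where "w t = norm (y t) + norm (y' t)" for t
  have contw: "continuous_on {0..1} w" unfolding w_def by (intro continuous_intros cont)
  have "\<exists>x\<in>{0..1}. \<forall>t\<in>{0..1}. w t * exp (- 2 * K * t) \<le> w x * exp (- 2 * K * x)"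
    by (intro continuous_attains_sup continuous_intros contw) auto
  then obtain x0 where x0: "x0 \<in> {0..1}"
    and max: "\<And>t. t \<in> {0..1} \<Longrightarrow> w t * exp (- 2 * K * t) \<le> w x0 * exp (- 2 * K * x0)" by blast
  define m where "m = w x0 * exp (- 2 * K * x0)"
  have "m \<ge> 0" by (simp add: m_def w_def)
  have wm: "w t \<le> m * exp (2 * K * t)" if "t \<in> {0..1}" for t
    using max[OF that] by (simp add: m_def exp_minus field_simps)
  have sub: "{0..x0} \<subseteq> {0..1}" using x0 by auto
  have 1: "(y' has_integral y x0) {0..x0}"
    using has_integral_of_derivative01[of y y' x0] sol x0 assms(3) by (simp add: classical_solution_def)
  have 2: "((\<lambda>t. (q t - lam) * y t) has_integral y' x0) {0..x0}"
    using has_integral_of_derivative01[of y' "\<lambda>t. (q t - lam) * y t" x0] sol x0 assms(4)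
    by (simp add: classical_solution_def)
  have iy: "(\<lambda>t. norm (y t)) integrable_on {0..x0}" "(\<lambda>t. norm (y' t)) integrable_on {0..x0}"
    by (intro integrable_continuous_real continuous_intros continuous_on_subset[OF cont(1) sub]
      continuous_on_subset[OF cont(2) sub])+
  have "norm (y x0) \<le> integral {0..x0} (\<lambda>t. norm (y' t))"
    using integral_norm_bound_integral[OF has_integral_integrable[OF 1] iy(2)] integral_unique[OF 1] by simp
  moreover have "norm (y' x0) \<le> integral {0..x0} (\<lambda>t. K * norm (y t))"
  proof -
    have "norm ((q t - lam) * y t) \<le> K * norm (y t)" if "t \<in> {0..x0}" for t
      using K(2)[of t] that sub by (auto simp: norm_mult intro!: mult_right_mono)
    then show ?thesis
      using integral_norm_bound_integral[OF has_integral_integrable[OF 2] integrable_on_mult_right[OF iy(1), of K]]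
        integral_unique[OF 2] by auto
  qed
  ultimately have "w x0 \<le> integral {0..x0} (\<lambda>t. norm (y' t) + K * norm (y t))"
    unfolding w_def using iy integrable_on_mult_right[OF iy(1), of K] by (subst integral_add) auto
  also have "\<dots> \<le> integral {0..x0} (\<lambda>t. K * m * exp (2 * K * t))"
  proof (rule integral_le)
    fix t assume "t \<in> {0..x0}"
    then have "w t \<le> m * exp (2 * K * t)" using sub wm by blast
    then have "K * w t \<le> K * (m * exp (2 * K * t))" using K by (intro mult_left_mono) auto
    moreover have "norm (y' t) \<le> K * norm (y' t)" using K by (simp add: mult_le_cancel_right1)
    ultimately show "norm (y' t) + K * norm (y t) \<le> K * m * exp (2 * K * t)"
      by (simp add: w_def algebra_simps)
  next
    show "(\<lambda>t. norm (y' t) + K * norm (y t)) integrable_on {0..x0}"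
      by (intro integrable_add integrable_on_mult_right iy)
    show "(\<lambda>t. K * m * exp (2 * K * t)) integrable_on {0..x0}"
      by (intro integrable_continuous_real continuous_intros)
  qed
  also have "\<dots> = m / 2 * exp (2 * K * x0) - m / 2 * exp (2 * K * 0)"
  proof (rule integral_unique, rule fundamental_theorem_of_calculus)
    show "((\<lambda>t. m / 2 * exp (2 * K * t)) has_vector_derivative K * m * exp (2 * K * t)) (at t within {0..x0})" for t
      unfolding has_real_derivative_iff_has_vector_derivative[symmetric]
      by (auto intro!: derivative_eq_intros)
  qed (use x0 in auto)
  finally have "w x0 \<le> m / 2 * exp (2 * K * x0)" using \<open>m \<ge> 0\<close> by simp
  then have "m \<le> m / 2 * exp (2 * K * x0) * exp (- 2 * K * x0)"
    unfolding m_def by (intro mult_right_mono) auto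
  also have "\<dots> = m / 2" by (simp add: exp_minus)
  finally have "m = 0" using \<open>m \<ge> 0\<close> by simp
  then have "w x \<le> 0" using wm[OF x] by simp
  then show "y x = 0" "y' x = 0" unfolding w_def
    by (smt (verit) norm_ge_zero norm_le_zero_iff)+
qed

lemma classical_solution_unique:
  assumes "continuous_on {0..1} q" and y: "classical_solution q lam y y'" and z: "classical_solution q lam z z'"
    and "y 0 = z 0" "y' 0 = z' 0" "x \<in> {0..1}"
  shows "y x = z x" "y' x = z' x"
proof -
  have "classical_solution q lam (\<lambda>x. y x - z x) (\<lambda>x. y' x - z' x)"
    using y z unfolding classical_solution_def
    by (auto simp: right_diff_distrib intro!: has_vector_derivative_diff)
  from classical_solution_zero_initial[OF assms(1) this] assms(4-6)
  show "y x = z x" "y' x = z' x" by auto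
qed

section \<open>Existence and entire dependence on the spectral parameter\<close>

lemma has_vector_derivative_series_M:
  fixes f f' :: "nat \<Rightarrow> real \<Rightarrow> complex"
  assumes "convex S" "x \<in> S"
    and der: "\<And>n x. x \<in> S \<Longrightarrow> (f n has_vector_derivative f' n x) (at x within S)"
    and M: "summable M" "\<And>n x. x \<in> S \<Longrightarrow> norm (f n x) \<le> M n" "\<And>n x. x \<in> S \<Longrightarrow> norm (f' n x) \<le> M n"
  shows "((\<lambda>x. \<Sum>n. f n x) has_vector_derivative (\<Sum>n. f' n x)) (at x within S)"
proof -
  have ul: "uniform_limit S (\<lambda>n x. \<Sum>i<n. f' i x) (\<lambda>x. \<Sum>n. f' n x) sequentially"
    by (rule Weierstrass_m_test[OF M(3) M(1)])
  have sums: "(\<lambda>n. f n x) sums (\<Sum>n. f n x)" if "x \<in> S" for x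
    using M(2)[OF that] by (intro summable_sums summable_comparison_test'[OF M(1), of 0])
  have "\<exists>g. \<forall>x\<in>S. (\<lambda>n. f n x) sums g x \<and> (g has_derivative (\<lambda>h. h *\<^sub>R (\<Sum>n. f' n x))) (at x within S)"
  proof (rule has_derivative_series[where f' = "\<lambda>n x h. h *\<^sub>R f' n x"])
    show "(f n has_derivative (\<lambda>h. h *\<^sub>R f' n x)) (at x within S)" if "x \<in> S" for n x
      using der[OF that] by (simp add: has_vector_derivative_def)
    show "\<forall>\<^sub>F n in sequentially. \<forall>x\<in>S. \<forall>h. norm ((\<Sum>i<n. h *\<^sub>R f' i x) - h *\<^sub>R (\<Sum>n. f' n x)) \<le> e * norm h"
      if "e > 0" for e
      using uniform_limitD[OF ul \<open>e > 0\<close>]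
    proof eventually_elim
      case (elim n)
      show ?case
      proof (intro ballI allI)
        fix x and h :: real assume "x \<in> S"
        have "norm ((\<Sum>i<n. h *\<^sub>R f' i x) - h *\<^sub>R (\<Sum>n. f' n x)) = \<bar>h\<bar> * norm ((\<Sum>i<n. f' i x) - (\<Sum>n. f' n x))"
          by (simp add: scaleR_sum_right[symmetric] scaleR_diff_right[symmetric])
        also have "\<dots> \<le> \<bar>h\<bar> * e"
          using elim \<open>x \<in> S\<close> by (intro mult_left_mono) (auto simp: dist_norm less_imp_le)
        finally show "norm ((\<Sum>i<n. h *\<^sub>R f' i x) - h *\<^sub>R (\<Sum>n. f' n x)) \<le> e * norm h"
          by (simp add: mult.commute)
      qed
    qed
  qed (use assms(1,2) sums in auto)
  then obtain g where g: "\<And>x. x \<in> S \<Longrightarrow> (\<lambda>n. f n x) sums g x"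
    "\<And>x. x \<in> S \<Longrightarrow> (g has_derivative (\<lambda>h. h *\<^sub>R (\<Sum>n. f' n x))) (at x within S)" by blast
  show ?thesis
  proof (rule has_vector_derivative_transform[OF \<open>x \<in> S\<close>])
    show "(g has_vector_derivative (\<Sum>n. f' n x)) (at x within S)"
      using g(2)[OF \<open>x \<in> S\<close>] by (simp add: has_vector_derivative_def)
    show "(\<Sum>n. f n y) = g y" if "y \<in> S" for y using g(1)[OF that] by (simp add: sums_iff)
  qed
qed

text \<open>Functions of \<open>(\<lambda>, x)\<close> that are polynomials in \<open>\<lambda>\<close> with coefficients continuous in \<open>x\<close>. The successive
  approximations stay in this class, so they are entire in \<open>\<lambda>\<close> without differentiation under
  the integral sign.\<close>

definition poly_param :: "(complex \<Rightarrow> real \<Rightarrow> complex) \<Rightarrow> bool" where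
  "poly_param F \<longleftrightarrow> (\<exists>N (c :: nat \<Rightarrow> real \<Rightarrow> complex). (\<forall>j<N. continuous_on {0..1} (c j)) \<and>
     (\<forall>lam. \<forall>x\<in>{0..1}. F lam x = (\<Sum>j<N. lam ^ j * c j x)))"

lemma poly_param_const: "continuous_on {0..1} c \<Longrightarrow> poly_param (\<lambda>lam. c)"
  unfolding poly_param_def by (intro exI[of _ 1] exI[of _ "\<lambda>j. c"]) simp

lemma poly_param_continuous: "poly_param F \<Longrightarrow> continuous_on {0..1} (F lam)"
  unfolding poly_param_def
proof clarify
  fix N and c :: "nat \<Rightarrow> real \<Rightarrow> complex"
  assume "\<forall>j<N. continuous_on {0..1} (c j)" "\<forall>lam. \<forall>x\<in>{0..1}. F lam x = (\<Sum>j<N. lam ^ j * c j x)"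
  moreover from this have "continuous_on {0..1} (\<lambda>x. \<Sum>j<N. lam ^ j * c j x)"
    by (intro continuous_intros) auto
  ultimately show ?thesis by (subst continuous_on_cong[OF refl]) auto
qed

lemma poly_param_holomorphic: "poly_param F \<Longrightarrow> x \<in> {0..1} \<Longrightarrow> (\<lambda>lam. F lam x) holomorphic_on S"
  unfolding poly_param_def by (auto intro!: holomorphic_intros)

lemma poly_param_integral:
  assumes "poly_param F"
  shows "poly_param (\<lambda>lam x. integral {0..x} (F lam))"
proof -
  obtain N and c :: "nat \<Rightarrow> real \<Rightarrow> complex" where c: "\<And>j. j < N \<Longrightarrow> continuous_on {0..1} (c j)"
    and F: "\<And>lam x. x \<in> {0..1} \<Longrightarrow> F lam x = (\<Sum>j<N. lam ^ j * c j x)"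
    using assms unfolding poly_param_def by blast
  have "integral {0..x} (F lam) = (\<Sum>j<N. lam ^ j * integral {0..x} (c j))" if x: "x \<in> {0..1}" for lam x
  proof -
    have "integral {0..x} (F lam) = integral {0..x} (\<lambda>t. \<Sum>j<N. lam ^ j * c j t)"
      using x by (intro integral_cong F) auto
    also have "\<dots> = (\<Sum>j<N. integral {0..x} (\<lambda>t. lam ^ j * c j t))"
      using x by (intro integral_sum integrable_continuous_real continuous_intros)
        (auto intro: continuous_on_subset[OF c])
    finally show ?thesis by simp
  qed
  moreover have "continuous_on {0..1} (\<lambda>x. integral {0..x} (c j))" if "j < N" for j
    using c[OF that] by (intro indefinite_integral_continuous_1 integrable_continuous_real)
  ultimately show ?thesis unfolding poly_param_def by (intro exI[of _ N] exI[of _ "\<lambda>j x. integral {0..x} (c j)"]) auto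
qed

lemma poly_param_mult_affine:
  assumes "poly_param F" and contq: "continuous_on {0..1} q"
  shows "poly_param (\<lambda>lam x. (q x - lam) * F lam x)"
proof -
  obtain N and c :: "nat \<Rightarrow> real \<Rightarrow> complex" where c: "\<And>j. j < N \<Longrightarrow> continuous_on {0..1} (c j)"
    and F: "\<And>lam x. x \<in> {0..1} \<Longrightarrow> F lam x = (\<Sum>j<N. lam ^ j * c j x)"
    using assms(1) unfolding poly_param_def by blast
  define d where "d j x = (if j < N then q x * c j x else 0) - (if j > 0 then c (j - 1) x else 0)" for j x
  have "continuous_on {0..1} (d j)" if "j < Suc N" for j
  proof -
    have "continuous_on {0..1} (\<lambda>x. if j < N then q x * c j x else 0)"
      using c contq by (cases "j < N") (auto intro!: continuous_intros)
    moreover have "continuous_on {0..1} (\<lambda>x. if j > 0 then c (j - 1) x else 0)"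
      using c[of "j - 1"] that by (cases "j > 0") auto
    ultimately show ?thesis unfolding d_def by (intro continuous_intros)
  qed
  moreover have "(q x - lam) * F lam x = (\<Sum>j<Suc N. lam ^ j * d j x)" if x: "x \<in> {0..1}" for lam x
  proof -
    have "(\<Sum>j<Suc N. lam ^ j * d j x) = (\<Sum>j<Suc N. lam ^ j * (if j < N then q x * c j x else 0))
        - (\<Sum>j<Suc N. lam ^ j * (if j > 0 then c (j - 1) x else 0))"
      unfolding d_def by (simp only: right_diff_distrib sum_subtractf)
    also have "(\<Sum>j<Suc N. lam ^ j * (if j < N then q x * c j x else 0)) = (\<Sum>j<N. lam ^ j * (q x * c j x))"
      by simp
    also have "(\<Sum>j<Suc N. lam ^ j * (if j > 0 then c (j - 1) x else 0)) = (\<Sum>j<N. lam ^ Suc j * c j x)"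
      by (subst sum.lessThan_Suc_shift) simp
    finally have "(\<Sum>j<Suc N. lam ^ j * d j x)
        = (\<Sum>j<N. lam ^ j * (q x * c j x)) - (\<Sum>j<N. lam ^ Suc j * c j x)" .
    also have "\<dots> = (q x - lam) * F lam x" unfolding F[OF x] sum_subtractf[symmetric] sum_distrib_left
      by (intro sum.cong) (auto simp: algebra_simps)
    finally show ?thesis by simp
  qed
  ultimately show ?thesis unfolding poly_param_def by blast
qed

text \<open>The terms of the Picard series for the pair \<open>(S, S')\<close>; the partial sums are the usual successive
  approximations started at \<open>(0, 1)\<close>.\<close>

primrec picard :: "(real \<Rightarrow> complex) \<Rightarrow> nat \<Rightarrow> (complex \<Rightarrow> real \<Rightarrow> complex) \<times> (complex \<Rightarrow> real \<Rightarrow> complex)" where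
  "picard q 0 = (\<lambda>lam x. 0, \<lambda>lam x. 1)"
| "picard q (Suc n) = (\<lambda>lam x. integral {0..x} (snd (picard q n) lam),
     \<lambda>lam x. integral {0..x} (\<lambda>t. (q t - lam) * fst (picard q n) lam t))"

lemma picard_poly_param:
  assumes "continuous_on {0..1} q"
  shows "poly_param (fst (picard q n)) \<and> poly_param (snd (picard q n))"
proof (induction n)
  case 0
  show ?case by (auto intro!: poly_param_const)
next
  case (Suc n)
  then show ?case by (auto intro!: poly_param_integral poly_param_mult_affine assms)
qed

lemma norm_integral_power_bound:
  fixes f :: "real \<Rightarrow> complex"
  assumes cont: "continuous_on {0..1} f" and x: "x \<in> {0..1}"
    and le: "\<And>t. t \<in> {0..1} \<Longrightarrow> norm (f t) \<le> K * ((K * t) ^ n / fact n)"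
  shows "norm (integral {0..x} f) \<le> (K * x) ^ Suc n / fact (Suc n)"
proof -
  have "((\<lambda>t. K * ((K * t) ^ n / fact n)) has_integral ((K * x) ^ Suc n / fact (Suc n) - (K * 0) ^ Suc n / fact (Suc n))) {0..x}"
  proof (rule fundamental_theorem_of_calculus)
    fix t assume "t \<in> {0..x}"
    have "((\<lambda>t. K * t) has_real_derivative K) (at t within {0..x})"
      by (auto intro!: derivative_eq_intros)
    from DERIV_cdivide[OF DERIV_power_Suc[OF this, of n], of "fact (Suc n)"]
    have "((\<lambda>t. (K * t) ^ Suc n / fact (Suc n)) has_real_derivative
        (1 + real n) * (K * (K * t) ^ n) / fact (Suc n)) (at t within {0..x})" by simp
    also have "(1 + real n) * (K * (K * t) ^ n) / fact (Suc n) = K * ((K * t) ^ n / fact n)"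
    proof -
      have f: "(fact (Suc n) :: real) = (1 + real n) * fact n" and "1 + real n \<noteq> 0" by simp_all
      then show ?thesis unfolding f by (subst mult_divide_mult_cancel_left) simp_all
    qed
    finally have "((\<lambda>t. (K * t) ^ Suc n / fact (Suc n)) has_real_derivative K * ((K * t) ^ n / fact n)) (at t within {0..x})" .
    then show "((\<lambda>t. (K * t) ^ Suc n / fact (Suc n)) has_vector_derivative K * ((K * t) ^ n / fact n)) (at t within {0..x})"
      unfolding has_real_derivative_iff_has_vector_derivative .
  qed (use x in auto)
  then have hi: "((\<lambda>t. K * ((K * t) ^ n / fact n)) has_integral ((K * x) ^ Suc n / fact (Suc n))) {0..x}" by simp
  have "norm (integral {0..x} f) \<le> integral {0..x} (\<lambda>t. K * ((K * t) ^ n / fact n))"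
    using x le by (intro integral_norm_bound_integral has_integral_integrable[OF hi] integrable_continuous_real
      continuous_on_subset[OF cont]) auto
  then show ?thesis using integral_unique[OF hi] by simp
qed

lemma picard_bound:
  assumes contq: "continuous_on {0..1} q" and K: "K \<ge> 1" "\<And>t. t \<in> {0..1} \<Longrightarrow> norm (q t - lam) \<le> K"
  shows "x \<in> {0..1} \<Longrightarrow> norm (fst (picard q n) lam x) \<le> (K * x) ^ n / fact n \<and>
    norm (snd (picard q n) lam x) \<le> (K * x) ^ n / fact n"
proof (induction n arbitrary: x)
  case 0
  then show ?case by simp
next
  case (Suc n)
  note pp = picard_poly_param[OF contq, of n]
  note cont = poly_param_continuous[OF conjunct1[OF pp], of lam] poly_param_continuous[OF conjunct2[OF pp], of lam]
  have "norm (integral {0..x} (snd (picard q n) lam)) \<le> (K * x) ^ Suc n / fact (Suc n)"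
  proof (rule norm_integral_power_bound[OF cont(2) Suc.prems])
    fix t :: real assume "t \<in> {0..1}"
    then have "norm (snd (picard q n) lam t) \<le> 1 * ((K * t) ^ n / fact n)" using Suc.IH by simp
    also have "\<dots> \<le> K * ((K * t) ^ n / fact n)" using K \<open>t \<in> {0..1}\<close> by (intro mult_right_mono) auto
    finally show "norm (snd (picard q n) lam t) \<le> K * ((K * t) ^ n / fact n)" .
  qed
  moreover have "norm (integral {0..x} (\<lambda>t. (q t - lam) * fst (picard q n) lam t)) \<le> (K * x) ^ Suc n / fact (Suc n)"
  proof (rule norm_integral_power_bound[OF _ Suc.prems])
    show "continuous_on {0..1} (\<lambda>t. (q t - lam) * fst (picard q n) lam t)"
      by (intro continuous_intros contq cont)
    fix t :: real assume "t \<in> {0..1}"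
    then show "norm ((q t - lam) * fst (picard q n) lam t) \<le> K * ((K * t) ^ n / fact n)"
      unfolding norm_mult using Suc.IH K by (intro mult_mono) auto
  qed
  ultimately show ?case by simp
qed

text \<open>The Picard series converges uniformly in \<open>x\<close> and locally uniformly in \<open>\<lambda>\<close> because its terms are
  dominated by \<open>K\<^sup>n / n!\<close>; a locally uniform limit of polynomials in \<open>\<lambda>\<close> is entire.\<close>

theorem classical_solution_exists:
  assumes contq: "continuous_on {0..1} q"
  obtains Y Y' :: "complex \<Rightarrow> real \<Rightarrow> complex" where
    "\<And>lam. classical_solution q lam (Y lam) (Y' lam)" "\<And>lam. Y lam 0 = 0" "\<And>lam. Y' lam 0 = 1"
    "(\<lambda>lam. Y lam 1) holomorphic_on UNIV" "(\<lambda>lam. Y' lam 1) holomorphic_on UNIV"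
proof -
  define a b where "a n = fst (picard q n)" and "b n = snd (picard q n)" for n
  have a0: "a 0 lam x = 0" and b0: "b 0 lam x = 1"
    and aS: "a (Suc n) lam x = integral {0..x} (b n lam)"
    and bS: "b (Suc n) lam x = integral {0..x} (\<lambda>t. (q t - lam) * a n lam t)" for n lam x
    by (simp_all add: a_def b_def)
  have pp: "poly_param (a n)" "poly_param (b n)" for n
    using picard_poly_param[OF contq, of n] by (simp_all add: a_def b_def)
  have conta: "continuous_on {0..1} (a n lam)" and contb: "continuous_on {0..1} (b n lam)" for n lam
    by (intro poly_param_continuous pp)+
  obtain Q where Q: "\<And>t. t \<in> {0..1} \<Longrightarrow> norm (q t) \<le> Q"
    using continuous_on_Icc_bounded[OF contq] by blast
  define M where "M R n = max 1 (Q + R) ^ n / fact n" for R :: real and n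
  have bnd: "norm (a n lam x) \<le> M R n" "norm (b n lam x) \<le> M R n"
    if x: "x \<in> {0..1}" and R: "norm lam \<le> R" for n lam x R
  proof -
    have "norm (q t - lam) \<le> max 1 (Q + R)" if "t \<in> {0..1}" for t
      using norm_triangle_ineq4[of "q t" lam] Q[OF that] R by linarith
    then have "norm (a n lam x) \<le> (max 1 (Q + R) * x) ^ n / fact n \<and> norm (b n lam x) \<le> (max 1 (Q + R) * x) ^ n / fact n"
      unfolding a_def b_def by (intro picard_bound[OF contq _ _ x]) auto
    moreover have "(max 1 (Q + R) * x) ^ n / fact n \<le> M R n"
    proof -
      have "max 1 (Q + R) * x \<le> max 1 (Q + R)" using x by (intro mult_left_le) auto
      then show ?thesis unfolding M_def using x by (intro divide_right_mono power_mono) auto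
    qed
    ultimately show "norm (a n lam x) \<le> M R n" "norm (b n lam x) \<le> M R n" by linarith+
  qed
  have Msum: "summable (M R)" for R
    using summable_exp[of "max 1 (Q + R)"] by (simp add: M_def[abs_def] field_simps)
  have suma: "summable (\<lambda>n. a n lam x)" and sumb: "summable (\<lambda>n. b n lam x)" if x: "x \<in> {0..1}" for lam x
    using bnd[OF x order_refl] by (auto intro!: summable_comparison_test'[OF Msum, of 0])
  define Y where "Y lam x = (\<Sum>n. a n lam x)" for lam x
  define Y' where "Y' lam x = (\<Sum>n. b n lam x)" for lam x
  have Y0: "Y lam 0 = 0" for lam
  proof -
    have "a n lam 0 = 0" for n by (cases n) (auto simp: a0 aS)
    then show ?thesis by (simp add: Y_def)
  qed
  have Y'0: "Y' lam 0 = 1" for lam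
  proof -
    have "b (Suc n) lam 0 = 0" for n by (simp add: bS)
    then show ?thesis using suminf_split_head[OF sumb[of 0 lam]] by (simp add: Y'_def b0)
  qed
  have "classical_solution q lam (Y lam) (Y' lam)" for lam
    unfolding classical_solution_def
  proof (intro ballI conjI)
    fix x :: real assume x: "x \<in> {0..1}"
    define K where "K = max 1 (Q + norm lam)"
    have K: "norm (q t - lam) \<le> K" if "t \<in> {0..1}" for t
      using norm_triangle_ineq4[of "q t" lam] Q[OF that] unfolding K_def by linarith
    have "K \<ge> 1" by (simp add: K_def)
    \<comment> \<open>the term-by-term derivative is the series shifted by one index, so the majorant must dominate both\<close>
    define M' where "M' n = K * M (norm lam) n + (case n of 0 \<Rightarrow> 0 | Suc m \<Rightarrow> K * M (norm lam) m)" for n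
    have Mpos: "0 \<le> M (norm lam) n" for n unfolding M_def by simp
    have "summable (\<lambda>n. case n of 0 \<Rightarrow> 0 | Suc m \<Rightarrow> K * M (norm lam) m)"
      using summable_mult[OF Msum, of K] by (subst summable_Suc_iff[symmetric]) simp
    then have M': "summable M'" unfolding M'_def by (intro summable_add summable_mult Msum)
    have M1: "norm (a n lam t) \<le> M' n" "norm (b n lam t) \<le> M' n" if t: "t \<in> {0..1}" for n t
    proof -
      have "M (norm lam) n \<le> K * M (norm lam) n" using mult_right_mono[OF \<open>K \<ge> 1\<close> Mpos[of n]] by simp
      also have "\<dots> \<le> M' n" using \<open>K \<ge> 1\<close> Mpos by (auto simp: M'_def split: nat.splits)
      finally show "norm (a n lam t) \<le> M' n" "norm (b n lam t) \<le> M' n"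
        using bnd[OF t order_refl, of n lam] by linarith+
    qed
    have M2: "norm (b n lam t) \<le> M' (Suc n)" "norm ((q t - lam) * a n lam t) \<le> M' (Suc n)"
      if t: "t \<in> {0..1}" for n t
    proof -
      have le: "K * M (norm lam) n \<le> M' (Suc n)" using \<open>K \<ge> 1\<close> Mpos by (simp add: M'_def)
      have "M (norm lam) n \<le> K * M (norm lam) n" using mult_right_mono[OF \<open>K \<ge> 1\<close> Mpos[of n]] by simp
      then show "norm (b n lam t) \<le> M' (Suc n)" using bnd(2)[OF t order_refl, of n lam] le by linarith
      have "norm ((q t - lam) * a n lam t) \<le> K * M (norm lam) n"
        unfolding norm_mult using K[OF t] bnd(1)[OF t order_refl, of n lam] \<open>K \<ge> 1\<close> by (intro mult_mono) auto
      then show "norm ((q t - lam) * a n lam t) \<le> M' (Suc n)" using le by linarith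
    qed
    have "((\<lambda>x. \<Sum>n. a n lam x) has_vector_derivative (\<Sum>n. case n of 0 \<Rightarrow> 0 | Suc m \<Rightarrow> b m lam x)) (at x within {0..1})"
    proof (rule has_vector_derivative_series_M[where M = M'])
      show "(a n lam has_vector_derivative (case n of 0 \<Rightarrow> 0 | Suc m \<Rightarrow> b m lam t)) (at t within {0..1})"
        if "t \<in> {0..1}" for n t
      proof (cases n)
        case 0
        have "a 0 lam = (\<lambda>x. 0)" by (simp add: a0 fun_eq_iff)
        then show ?thesis by (simp add: 0)
      next
        case (Suc m)
        have "a n lam = (\<lambda>x. integral {0..x} (b m lam))" by (simp add: aS fun_eq_iff Suc)
        then show ?thesis using integral_has_vector_derivative[OF contb that] by (simp add: Suc)
      qed
      show "norm (case n of 0 \<Rightarrow> 0 | Suc m \<Rightarrow> b m lam t) \<le> M' n" if "t \<in> {0..1}" for n t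
        using M2(1)[OF that] M1(1)[OF that, of 0] by (auto split: nat.splits simp: a0)
    qed (use x M' M1 in auto)
    moreover have "(\<Sum>n. case n of 0 \<Rightarrow> 0 | Suc m \<Rightarrow> b m lam x) = Y' lam x"
    proof -
      have "summable (\<lambda>n. case n of 0 \<Rightarrow> 0 | Suc m \<Rightarrow> b m lam x)"
        using sumb[OF x] by (subst summable_Suc_iff[symmetric]) simp
      from suminf_split_head[OF this] show ?thesis by (simp add: Y'_def)
    qed
    ultimately show "(Y lam has_vector_derivative Y' lam x) (at x within {0..1})"
      by (simp add: Y_def[abs_def])
    have "((\<lambda>x. \<Sum>n. b n lam x) has_vector_derivative (\<Sum>n. case n of 0 \<Rightarrow> 0 | Suc m \<Rightarrow> (q x - lam) * a m lam x)) (at x within {0..1})"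
    proof (rule has_vector_derivative_series_M[where M = M'])
      show "(b n lam has_vector_derivative (case n of 0 \<Rightarrow> 0 | Suc m \<Rightarrow> (q t - lam) * a m lam t)) (at t within {0..1})"
        if "t \<in> {0..1}" for n t
      proof (cases n)
        case 0
        have "b 0 lam = (\<lambda>x. 1)" by (simp add: b0 fun_eq_iff)
        then show ?thesis by (simp add: 0)
      next
        case (Suc m)
        have "b n lam = (\<lambda>x. integral {0..x} (\<lambda>t. (q t - lam) * a m lam t))" by (simp add: bS fun_eq_iff Suc)
        moreover have "continuous_on {0..1} (\<lambda>t. (q t - lam) * a m lam t)"
          by (intro continuous_intros contq conta)
        ultimately show ?thesis using integral_has_vector_derivative that by (simp add: Suc)
      qed
      show "norm (case n of 0 \<Rightarrow> 0 | Suc m \<Rightarrow> (q t - lam) * a m lam t) \<le> M' n" if "t \<in> {0..1}" for n t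
        using M2(2)[OF that] M1(1)[OF that, of 0] by (auto split: nat.splits simp: a0)
    qed (use x M' M1 in auto)
    moreover have "(\<Sum>n. case n of 0 \<Rightarrow> 0 | Suc m \<Rightarrow> (q x - lam) * a m lam x) = (q x - lam) * Y lam x"
    proof -
      have "summable (\<lambda>n. case n of 0 \<Rightarrow> 0 | Suc m \<Rightarrow> (q x - lam) * a m lam x)"
        using summable_mult[OF suma[OF x], of "q x - lam"] by (subst summable_Suc_iff[symmetric]) simp
      from suminf_split_head[OF this] show ?thesis by (simp add: Y_def suminf_mult[OF suma[OF x]])
    qed
    ultimately show "(Y' lam has_vector_derivative (q x - lam) * Y lam x) (at x within {0..1})"
      by (simp add: Y'_def[abs_def])
  qed
  moreover have "(\<lambda>lam. Y lam 1) holomorphic_on UNIV" "(\<lambda>lam. Y' lam 1) holomorphic_on UNIV"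
  proof -
    have ul: "uniform_limit (cball z 1) (\<lambda>n lam. \<Sum>i<n. f i lam) (\<lambda>lam. \<Sum>i. f i lam) sequentially"
      if "\<And>n lam. norm lam \<le> norm z + 1 \<Longrightarrow> norm (f n lam) \<le> M (norm z + 1) n" for f :: "nat \<Rightarrow> complex \<Rightarrow> complex" and z
    proof (rule Weierstrass_m_test)
      fix n lam assume "lam \<in> cball z 1"
      then have "norm lam \<le> norm z + 1" using norm_triangle_ineq2[of lam z] by (simp add: dist_norm norm_minus_commute)
      then show "norm (f n lam) \<le> M (norm z + 1) n" by (rule that)
    qed (rule Msum)
    show "(\<lambda>lam. Y lam 1) holomorphic_on UNIV"
    proof (rule holomorphic_uniform_sequence)
      show "(\<lambda>lam. \<Sum>i<n. a i lam 1) holomorphic_on UNIV" for n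
        by (intro holomorphic_intros poly_param_holomorphic pp) auto
      show "\<exists>d>0. cball z d \<subseteq> UNIV \<and> uniform_limit (cball z d) (\<lambda>n lam. \<Sum>i<n. a i lam 1) (\<lambda>lam. Y lam 1) sequentially" for z
        unfolding Y_def using ul[of z "\<lambda>n lam. a n lam 1"] bnd(1)[of 1] by (intro exI[of _ 1]) auto
    qed auto
    show "(\<lambda>lam. Y' lam 1) holomorphic_on UNIV"
    proof (rule holomorphic_uniform_sequence)
      show "(\<lambda>lam. \<Sum>i<n. b i lam 1) holomorphic_on UNIV" for n
        by (intro holomorphic_intros poly_param_holomorphic pp) auto
      show "\<exists>d>0. cball z d \<subseteq> UNIV \<and> uniform_limit (cball z d) (\<lambda>n lam. \<Sum>i<n. b i lam 1) (\<lambda>lam. Y' lam 1) sequentially" for z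
        unfolding Y'_def using ul[of z "\<lambda>n lam. b n lam 1"] bnd(2)[of 1] by (intro exI[of _ 1]) auto
    qed auto
  qed
  ultimately show ?thesis using that Y0 Y'0 by blast
qed

lemma sl_S_classical_solution:
  assumes contq: "continuous_on {0..1} q"
  shows "classical_solution q lam (sl_S q lam) (deriv01 (sl_S q lam))"
    and "sl_S q lam 0 = 0" and "deriv01 (sl_S q lam) 0 = 1"
proof -
  obtain Y Y' where Y: "classical_solution q lam (Y lam) (Y' lam)" "Y lam 0 = 0" "Y' lam 0 = 1"
    using classical_solution_exists[OF contq] by metis
  have "\<exists>y. sl_solution q lam y \<and> y 0 = 0 \<and> deriv01 y 0 = 1"
    using classical_solution_imp_sl_solution[OF contq Y(1)] Y by (intro exI[of _ "Y lam"]) auto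
  then have *: "sl_solution q lam (sl_S q lam) \<and> sl_S q lam 0 = 0 \<and> deriv01 (sl_S q lam) 0 = 1"
    unfolding sl_S_def by (rule someI_ex)
  then show "classical_solution q lam (sl_S q lam) (deriv01 (sl_S q lam))"
    using sl_solution_imp_classical_solution[OF contq] by blast
  show "sl_S q lam 0 = 0" "deriv01 (sl_S q lam) 0 = 1" using * by auto
qed

lemma sl_S_holomorphic:
  assumes contq: "continuous_on {0..1} q"
  shows "(\<lambda>lam. sl_S q lam 1) holomorphic_on UNIV" "(\<lambda>lam. deriv01 (sl_S q lam) 1) holomorphic_on UNIV"
proof -
  obtain Y Y' where Y: "\<And>lam. classical_solution q lam (Y lam) (Y' lam)" "\<And>lam. Y lam 0 = 0" "\<And>lam. Y' lam 0 = 1"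
    "(\<lambda>lam. Y lam 1) holomorphic_on UNIV" "(\<lambda>lam. Y' lam 1) holomorphic_on UNIV"
    using classical_solution_exists[OF contq] by metis
  have "Y lam 1 = sl_S q lam 1" "Y' lam 1 = deriv01 (sl_S q lam) 1" for lam
    using classical_solution_unique[OF contq Y(1) sl_S_classical_solution(1)[OF contq], of lam 1]
      sl_S_classical_solution(2,3)[OF contq] Y(2,3) by auto
  then show "(\<lambda>lam. sl_S q lam 1) holomorphic_on UNIV" "(\<lambda>lam. deriv01 (sl_S q lam) 1) holomorphic_on UNIV"
    using Y(4,5) by simp_all
qed

section \<open>Solutions for large spectral parameter\<close>

lemma cmod_sin_mult_of_real_le: "0 \<le> x \<Longrightarrow> norm (sin (z * of_real x)) \<le> exp (\<bar>Im z\<bar> * x)"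
  using cmod_sin_le_exp[of 1 "z * of_real x"] by (simp add: abs_mult)

lemma cmod_cos_mult_of_real_le: "0 \<le> x \<Longrightarrow> norm (cos (z * of_real x)) \<le> exp (\<bar>Im z\<bar> * x)"
  using cmod_cos_le_exp[of 1 "z * of_real x"] by (simp add: abs_mult)

lemma has_vector_derivative_sin_mult:
  fixes z :: complex
  shows "((\<lambda>t. sin (z * of_real t)) has_vector_derivative z * cos (z * of_real t)) (at t within S)"
proof -
  have "((\<lambda>t. sin (z * t)) has_field_derivative z * cos (z * of_real t)) (at (of_real t))"
    by (auto intro!: derivative_eq_intros)
  from has_vector_derivative_real_field[OF this] show ?thesis .
qed

lemma has_vector_derivative_cos_mult:
  fixes z :: complex
  shows "((\<lambda>t. cos (z * of_real t)) has_vector_derivative - (z * sin (z * of_real t))) (at t within S)"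
proof -
  have "((\<lambda>t. cos (z * t)) has_field_derivative - (z * sin (z * of_real t))) (at (of_real t))"
    by (auto intro!: derivative_eq_intros)
  from has_vector_derivative_real_field[OF this] show ?thesis .
qed

lemma has_vector_derivative_sin_reflected:
  fixes z :: complex
  shows "((\<lambda>t. sin (z * of_real (x - t))) has_vector_derivative - (z * cos (z * of_real (x - t)))) (at t within S)"
proof -
  have "((\<lambda>t. sin (z * (of_real x - t))) has_field_derivative - (z * cos (z * (of_real x - of_real t)))) (at (of_real t))"
    by (auto intro!: derivative_eq_intros)
  from has_vector_derivative_real_field[OF this] show ?thesis by simp
qed

lemma has_vector_derivative_cos_reflected:
  fixes z :: complex
  shows "((\<lambda>t. cos (z * of_real (x - t))) has_vector_derivative z * sin (z * of_real (x - t))) (at t within S)"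
proof -
  have "((\<lambda>t. cos (z * (of_real x - t))) has_field_derivative z * sin (z * (of_real x - of_real t))) (at (of_real t))"
    by (auto intro!: derivative_eq_intros)
  from has_vector_derivative_real_field[OF this] show ?thesis by simp
qed

lemma norm_has_integral_le_const:
  fixes f :: "real \<Rightarrow> complex"
  assumes "(f has_integral I) {0..x}" "x \<in> {0..1}" "\<And>t. t \<in> {0..x} \<Longrightarrow> norm (f t) \<le> C" "0 \<le> C"
  shows "norm I \<le> C"
proof -
  have "norm I \<le> C * measure lborel (cbox 0 x)"
    using assms by (intro has_integral_bound[of C f]) auto
  also have "\<dots> \<le> C * 1" using assms by (intro mult_left_mono) auto
  finally show ?thesis by simp
qed

text \<open>Variation of constants, obtained by differentiating the Wronskian of the solution with
  \<open>t \<mapsto> sin \<rho>(x-t)\<close> and with \<open>t \<mapsto> cos \<rho>(x-t)\<close>.\<close>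

lemma classical_solution_volterra:
  assumes sol: "classical_solution q (\<rho>\<^sup>2) y y'" and init: "y 0 = 0" "y' 0 = 1" and x: "x \<in> {0..1}"
  shows "((\<lambda>t. q t * y t * sin (\<rho> * of_real (x - t))) has_integral (\<rho> * y x - sin (\<rho> * of_real x))) {0..x}"
    and "((\<lambda>t. q t * y t * cos (\<rho> * of_real (x - t))) has_integral (y' x - cos (\<rho> * of_real x))) {0..x}"
proof -
  have d: "(y has_vector_derivative y' t) (at t within {0..1})"
      "(y' has_vector_derivative (q t - \<rho>\<^sup>2) * y t) (at t within {0..1})" if "t \<in> {0..1}" for t
    using sol that by (auto simp: classical_solution_def)
  define F where "F t = \<rho> * (y t * cos (\<rho> * of_real (x - t))) + y' t * sin (\<rho> * of_real (x - t))" for t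
  have "(F has_vector_derivative q t * y t * sin (\<rho> * of_real (x - t))) (at t within {0..1})"
    if t: "t \<in> {0..1}" for t
  proof -
    have "(F has_vector_derivative
        \<rho> * (y t * (\<rho> * sin (\<rho> * of_real (x - t))) + y' t * cos (\<rho> * of_real (x - t)))
        + (y' t * - (\<rho> * cos (\<rho> * of_real (x - t))) + (q t - \<rho>\<^sup>2) * y t * sin (\<rho> * of_real (x - t))))
        (at t within {0..1})"
      unfolding F_def by (intro has_vector_derivative_add has_vector_derivative_mult
        has_vector_derivative_mult_right d[OF t] has_vector_derivative_sin_reflected has_vector_derivative_cos_reflected)
    then show ?thesis by (simp add: algebra_simps power2_eq_square)
  qed
  from has_integral_of_derivative01[OF this x]
  show "((\<lambda>t. q t * y t * sin (\<rho> * of_real (x - t))) has_integral (\<rho> * y x - sin (\<rho> * of_real x))) {0..x}"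
    by (simp add: F_def init)
  define G where "G t = y' t * cos (\<rho> * of_real (x - t)) - \<rho> * (y t * sin (\<rho> * of_real (x - t)))" for t
  have "(G has_vector_derivative q t * y t * cos (\<rho> * of_real (x - t))) (at t within {0..1})"
    if t: "t \<in> {0..1}" for t
  proof -
    have "(G has_vector_derivative
        (y' t * (\<rho> * sin (\<rho> * of_real (x - t))) + (q t - \<rho>\<^sup>2) * y t * cos (\<rho> * of_real (x - t)))
        - \<rho> * (y t * - (\<rho> * cos (\<rho> * of_real (x - t))) + y' t * sin (\<rho> * of_real (x - t))))
        (at t within {0..1})"
      unfolding G_def by (intro has_vector_derivative_diff has_vector_derivative_mult
        has_vector_derivative_mult_right d[OF t] has_vector_derivative_sin_reflected has_vector_derivative_cos_reflected)
    then show ?thesis by (simp add: algebra_simps power2_eq_square)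
  qed
  from has_integral_of_derivative01[OF this x]
  show "((\<lambda>t. q t * y t * cos (\<rho> * of_real (x - t))) has_integral (y' x - cos (\<rho> * of_real x))) {0..x}"
    by (simp add: G_def init)
qed

text \<open>For \<open>|\<rho>| \<ge> 2 Q\<close> the Volterra operator has norm at most \<open>1/2\<close> in the weighted supremum norm
  \<open>sup |y(x)| exp (- |Im \<rho>| x)\<close>. This bounds \<open>y\<close>, and reinserting the bound in the Volterra
  equations gives the first order errors.\<close>

lemma classical_solution_asymptotics:
  fixes \<rho> :: complex
  defines "\<tau> \<equiv> \<bar>Im \<rho>\<bar>"
  assumes contq: "continuous_on {0..1} q"
    and Q: "\<And>t. t \<in> {0..1} \<Longrightarrow> norm (q t) \<le> Q"
    and sol: "classical_solution q (\<rho>\<^sup>2) y y'" and init: "y 0 = 0" "y' 0 = 1"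
    and large: "norm \<rho> \<ge> 2 * Q" "norm \<rho> > 0" and x: "x \<in> {0..1}"
  shows "norm (y x) \<le> 2 / norm \<rho> * exp (\<tau> * x)"
    and "norm (\<rho> * y x - sin (\<rho> * of_real x)) \<le> 2 * Q / norm \<rho> * exp (\<tau> * x)"
    and "norm (y' x - cos (\<rho> * of_real x)) \<le> 2 * Q / norm \<rho> * exp (\<tau> * x)"
proof -
  define r where "r = norm \<rho>"
  have r: "r \<ge> 2 * Q" "r > 0" using large by (auto simp: r_def)
  have "Q \<ge> 0" using Q[of 0] norm_ge_zero[of "q 0"] by (simp del: norm_ge_zero)
  note volterra = classical_solution_volterra[OF sol init]
  have conty: "continuous_on {0..1} y" using classical_solution_continuous[OF sol] by simp
  have "\<exists>x\<in>{0..1}. \<forall>t\<in>{0..1}. norm (y t) * exp (- \<tau> * t) \<le> norm (y x) * exp (- \<tau> * x)"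
    by (intro continuous_attains_sup continuous_intros conty) auto
  then obtain x0 where x0: "x0 \<in> {0..1}"
    and max: "\<And>t. t \<in> {0..1} \<Longrightarrow> norm (y t) * exp (- \<tau> * t) \<le> norm (y x0) * exp (- \<tau> * x0)" by blast
  define m where "m = norm (y x0) * exp (- \<tau> * x0)"
  have "m \<ge> 0" by (simp add: m_def)
  have ym: "norm (y t) \<le> m * exp (\<tau> * t)" if "t \<in> {0..1}" for t
    using max[OF that] by (simp add: m_def exp_minus field_simps)
  have kern: "norm (q t * y t * k) \<le> Q * m * exp (\<tau> * x)"
    if "x \<in> {0..1}" "t \<in> {0..x}" "norm k \<le> exp (\<tau> * (x - t))" for x t k
  proof -
    have t: "t \<in> {0..1}" using that by auto
    have "norm (q t * y t * k) \<le> Q * (m * exp (\<tau> * t)) * exp (\<tau> * (x - t))"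
      unfolding norm_mult using Q[OF t] ym[OF t] that \<open>Q \<ge> 0\<close> \<open>m \<ge> 0\<close> by (intro mult_mono) auto
    also have "\<dots> = Q * m * (exp (\<tau> * t) * exp (\<tau> * (x - t)))" by (simp only: mult.assoc)
    also have "exp (\<tau> * t) * exp (\<tau> * (x - t)) = exp (\<tau> * x)"
      by (simp only: exp_add[symmetric]) (simp add: algebra_simps)
    finally show ?thesis .
  qed
  have err1: "norm (\<rho> * y x - sin (\<rho> * of_real x)) \<le> Q * m * exp (\<tau> * x)" if x: "x \<in> {0..1}" for x
  proof (rule norm_has_integral_le_const[OF volterra(1)[OF x] x])
    fix t assume t: "t \<in> {0..x}"
    have "norm (sin (\<rho> * of_real (x - t))) \<le> exp (\<tau> * (x - t))"
      unfolding \<tau>_def using t by (intro cmod_sin_mult_of_real_le) auto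
    then show "norm (q t * y t * sin (\<rho> * of_real (x - t))) \<le> Q * m * exp (\<tau> * x)"
      by (rule kern[OF x t])
  qed (use \<open>Q \<ge> 0\<close> \<open>m \<ge> 0\<close> in auto)
  have err2: "norm (y' x - cos (\<rho> * of_real x)) \<le> Q * m * exp (\<tau> * x)"
  proof (rule norm_has_integral_le_const[OF volterra(2)[OF x] x])
    fix t assume t: "t \<in> {0..x}"
    have "norm (cos (\<rho> * of_real (x - t))) \<le> exp (\<tau> * (x - t))"
      unfolding \<tau>_def using t by (intro cmod_cos_mult_of_real_le) auto
    then show "norm (q t * y t * cos (\<rho> * of_real (x - t))) \<le> Q * m * exp (\<tau> * x)"
      by (rule kern[OF x t])
  qed (use \<open>Q \<ge> 0\<close> \<open>m \<ge> 0\<close> in auto)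
  have "r * norm (y x0) \<le> norm (sin (\<rho> * of_real x0)) + norm (\<rho> * y x0 - sin (\<rho> * of_real x0))"
    using norm_triangle_ineq[of "sin (\<rho> * of_real x0)" "\<rho> * y x0 - sin (\<rho> * of_real x0)"]
    by (simp add: r_def norm_mult)
  also have "\<dots> \<le> exp (\<tau> * x0) + Q * m * exp (\<tau> * x0)"
    unfolding \<tau>_def using err1[OF x0] x0 by (intro add_mono cmod_sin_mult_of_real_le) (auto simp: \<tau>_def)
  finally have "r * norm (y x0) * exp (- \<tau> * x0) \<le> (1 + Q * m) * exp (\<tau> * x0) * exp (- \<tau> * x0)"
    by (intro mult_right_mono) (auto simp: algebra_simps)
  then have "r * m \<le> 1 + Q * m" by (simp add: m_def exp_minus mult.assoc)
  also have "\<dots> \<le> 1 + r / 2 * m" using r \<open>m \<ge> 0\<close> by (intro add_mono mult_right_mono) auto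
  finally have "m \<le> 2 / r" using r by (simp add: field_simps)
  then have Qm: "Q * m \<le> 2 * Q / r" using mult_left_mono[OF \<open>m \<le> 2 / r\<close> \<open>Q \<ge> 0\<close>] by (simp add: mult.commute)
  show "norm (y x) \<le> 2 / norm \<rho> * exp (\<tau> * x)"
    using ym[OF x] mult_right_mono[OF \<open>m \<le> 2 / r\<close>, of "exp (\<tau> * x)"] by (simp add: r_def)
  have "Q * m * exp (\<tau> * x) \<le> 2 * Q / norm \<rho> * exp (\<tau> * x)"
    using mult_right_mono[OF Qm, of "exp (\<tau> * x)"] by (simp add: r_def)
  then show "norm (\<rho> * y x - sin (\<rho> * of_real x)) \<le> 2 * Q / norm \<rho> * exp (\<tau> * x)"
    "norm (y' x - cos (\<rho> * of_real x)) \<le> 2 * Q / norm \<rho> * exp (\<tau> * x)"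
    using err1[OF x] err2 by linarith+
qed

section \<open>Asymptotics of the characteristic function\<close>

lemma C1_on01_diff:
  "C1_on01 u u' \<Longrightarrow> C1_on01 v v' \<Longrightarrow> C1_on01 (\<lambda>t. u t - v t) (\<lambda>t. u' t - v' t)"
  unfolding C1_on01_def by (auto intro!: has_vector_derivative_diff continuous_intros)

lemma C1_on01_cmult: "C1_on01 u u' \<Longrightarrow> C1_on01 (\<lambda>t. k * u t) (\<lambda>t. k * u' t)"
  unfolding C1_on01_def by (auto intro!: has_vector_derivative_mult_right continuous_intros)

lemma deriv_pairing_add:
  assumes contq: "continuous_on {0..1} q" and u: "C1_on01 u u'" and v: "C1_on01 v v'" and x: "x \<in> {0..1}"
  shows "deriv_pairing q (\<lambda>t. u t + v t) (\<lambda>t. u' t + v' t) x = deriv_pairing q u u' x + deriv_pairing q v v' x"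
proof -
  have sub: "{0..x} \<subseteq> {0..1}" using x by auto
  have int: "(\<lambda>t. q t * f t) integrable_on {0..x}" if "continuous_on {0..1} f" for f
    by (intro integrable_continuous_real continuous_on_subset[OF _ sub] continuous_intros contq that)
  have "integral {0..x} (\<lambda>t. q t * (u' t + v' t)) = integral {0..x} (\<lambda>t. q t * u' t) + integral {0..x} (\<lambda>t. q t * v' t)"
    unfolding distrib_left using u v by (intro integral_add int) (auto simp: C1_on01_def)
  then show ?thesis by (simp add: deriv_pairing_def algebra_simps)
qed

lemma deriv_pairing_cmult:
  "deriv_pairing q (\<lambda>t. k * u t) (\<lambda>t. k * u' t) x = k * deriv_pairing q u u' x"
proof -
  have "integral {0..x} (\<lambda>t. q t * (k * u' t)) = integral {0..x} (\<lambda>t. k * (q t * u' t))"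
    by (simp add: mult.left_commute)
  then show ?thesis by (simp add: deriv_pairing_def algebra_simps)
qed

lemma deriv_pairing_diff:
  assumes "continuous_on {0..1} q" "C1_on01 u u'" "C1_on01 v v'" "x \<in> {0..1}"
  shows "deriv_pairing q (\<lambda>t. u t - v t) (\<lambda>t. u' t - v' t) x = deriv_pairing q u u' x - deriv_pairing q v v' x"
  using deriv_pairing_add[OF assms(1,2) C1_on01_cmult[OF assms(3), of "- 1"] assms(4)]
    deriv_pairing_cmult[of q "- 1" v v' x] by simp

lemma C1_on01_sin: "C1_on01 (\<lambda>t. sin (z * of_real t)) (\<lambda>t. z * cos (z * of_real t))"
  unfolding C1_on01_def by (auto intro!: has_vector_derivative_sin_mult continuous_intros)

lemma C1_on01_cos: "C1_on01 (\<lambda>t. cos (z * of_real t)) (\<lambda>t. - (z * sin (z * of_real t)))"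
  unfolding C1_on01_def by (auto intro!: has_vector_derivative_cos_mult continuous_intros)

definition deriv_sin_transform :: "(real \<Rightarrow> complex) \<Rightarrow> complex \<Rightarrow> complex" where
  "deriv_sin_transform q z = deriv_pairing q (\<lambda>t. sin (z * of_real t)) (\<lambda>t. z * cos (z * of_real t)) 1"

lemma exp_mult_exp_le_exp_2:
  fixes \<tau> x :: real
  assumes "x \<in> {0..1}" "\<tau> \<ge> 0" "0 \<le> a" "a \<le> A * exp (\<tau> * x)" "0 \<le> b" "b \<le> B * exp (\<tau> * x)"
  shows "a * b \<le> A * B * exp (2 * \<tau>)"
proof -
  have "0 \<le> A * exp (\<tau> * x)" "0 \<le> B * exp (\<tau> * x)" using assms by linarith+
  then have AB: "0 \<le> A" "0 \<le> B" by (simp_all add: zero_le_mult_iff)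
  have "a * b \<le> (A * exp (\<tau> * x)) * (B * exp (\<tau> * x))"
    using assms AB by (intro mult_mono) auto
  also have "\<dots> = A * B * (exp (\<tau> * x) * exp (\<tau> * x))" by (simp add: mult_ac)
  also have "exp (\<tau> * x) * exp (\<tau> * x) = exp (2 * \<tau> * x)"
    by (simp add: exp_add[symmetric])
  also have "A * B * exp (2 * \<tau> * x) \<le> A * B * exp (2 * \<tau>)"
    using AB assms by (intro mult_left_mono) (auto simp: mult_left_le)
  finally show ?thesis .
qed

context weak_deriv_L2
begin

lemma pairing_sup_bound:
  assumes u: "C1_on01 u u'" and x: "x \<in> {0..1}" and M: "\<And>t. t \<in> {0..1} \<Longrightarrow> norm (u t) \<le> M"
  shows "norm (deriv_pairing q u u' x) \<le> sqrt B * M"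
proof -
  have "M \<ge> 0" using M[of 0] norm_ge_zero[of "u 0"] by (simp del: norm_ge_zero)
  have "(norm (deriv_pairing q u u' x))\<^sup>2 \<le> B * integral {0..1} (\<lambda>t. (norm (u t))\<^sup>2)"
    by (rule pairing_bound[OF u x])
  also have "\<dots> \<le> B * integral {0..1} (\<lambda>t::real. M\<^sup>2)"
    using M C1_on01_continuous[OF u]
    by (intro mult_left_mono B_nonneg integral_le power_mono integrable_continuous_real continuous_intros) auto
  also have "\<dots> = (sqrt B * M)\<^sup>2" using B_nonneg by (simp add: power_mult_distrib)
  finally show ?thesis by (rule power2_le_imp_le) (use \<open>M \<ge> 0\<close> B_nonneg in simp)
qed

text \<open>The leading term is isolated without expanding a double integral. Put \<open>P = \<rho> (\<phi>S)'\<close>. Using the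
  equation twice, \<open>P' = - 4\<rho>\<^sup>3 \<phi>S + 2\<rho>(1 + J) + \<rho> q \<phi>S\<close> with \<open>J(x)\<close> the integral of \<open>q \<phi>' S\<close> over
  \<open>[0,x]\<close>. Integrating \<open>q P'\<close> over \<open>[0,1]\<close>, the first term yields \<open>4\<rho>\<^sup>3 \<Delta>\<close>, the constant
  \<open>2\<rho>\<close> drops out because \<open>q\<close> has mean zero, and \<open>J\<close> is small because an integration by parts gains a
  factor \<open>1/\<rho>\<close>. Integrated by parts, the same integral is \<open>q(1) P(1) - \<integral> q' P\<close>, and \<open>P\<close> is close to
  \<open>2 \<rho> \<phi> \<phi>' = sin 2\<rho>x\<close>.\<close>

theorem char_fun_asymptotics:
  assumes mean0: "integral {0..1} q = 0"
  obtains C R where "C \<ge> 0" "R \<ge> 1"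
    "\<And>\<rho>. norm \<rho> \<ge> R \<Longrightarrow> norm (4 * \<rho> ^ 3 * char_fun q (\<rho>\<^sup>2) - q 1 * sin (2 * \<rho>))
        \<le> norm (deriv_sin_transform q (2 * \<rho>)) + C * exp (2 * \<bar>Im \<rho>\<bar>) / norm \<rho>"
proof -
  obtain Q where Q: "\<And>t. t \<in> {0..1} \<Longrightarrow> norm (q t) \<le> Q"
    using continuous_on_Icc_bounded[OF cont] by blast
  have "Q \<ge> 0" using Q[of 0] norm_ge_zero[of "q 0"] by (simp del: norm_ge_zero)
  define CJ where "CJ = (2 * Q + sqrt B) / 4 + 2 * Q\<^sup>2"
  define C where "C = 4 * Q\<^sup>2 + 4 * Q * sqrt B + 2 * Q * CJ + 2 * Q\<^sup>2"
  have "CJ \<ge> 0" unfolding CJ_def using \<open>Q \<ge> 0\<close> B_nonneg by auto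
  then have "C \<ge> 0" unfolding C_def using \<open>Q \<ge> 0\<close> B_nonneg by auto
  have main: "norm (4 * \<rho> ^ 3 * char_fun q (\<rho>\<^sup>2) - q 1 * sin (2 * \<rho>))
        \<le> norm (deriv_sin_transform q (2 * \<rho>)) + C * exp (2 * \<bar>Im \<rho>\<bar>) / norm \<rho>"
    if large: "norm \<rho> \<ge> max 1 (2 * Q)" for \<rho>
  proof -
    define \<tau> where "\<tau> = \<bar>Im \<rho>\<bar>"
    define r where "r = norm \<rho>"
    define E where "E = exp (2 * \<tau>)"
    have r: "r \<ge> 1" "r \<ge> 2 * Q" and "\<rho> \<noteq> 0" using large by (auto simp: r_def)
    have "\<tau> \<ge> 0" "E > 0" by (auto simp: \<tau>_def E_def)
    define y where "y = sl_S q (\<rho>\<^sup>2)"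
    define y' where "y' = (\<lambda>x. deriv01 (sl_S q (\<rho>\<^sup>2)) x)"
    have sol: "classical_solution q (\<rho>\<^sup>2) y y'" and init: "y 0 = 0" "y' 0 = 1"
      using sl_S_classical_solution[OF cont, of "\<rho>\<^sup>2"] by (simp_all add: y_def y'_def)
    have dy: "(y has_vector_derivative y' t) (at t within {0..1})"
      "(y' has_vector_derivative (q t - \<rho>\<^sup>2) * y t) (at t within {0..1})" if "t \<in> {0..1}" for t
      using sol that by (auto simp: classical_solution_def)
    note conty = classical_solution_continuous[OF sol]
    define s where "s t = sin (\<rho> * of_real t)" for t
    define c where "c t = cos (\<rho> * of_real t)" for t
    have ds: "(s has_vector_derivative \<rho> * c t) (at t within {0..1})"
      and dc: "(c has_vector_derivative - (\<rho> * s t)) (at t within {0..1})" for t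
      unfolding s_def c_def by (rule has_vector_derivative_sin_mult has_vector_derivative_cos_mult)+
    have conts: "continuous_on {0..1} s" and contc: "continuous_on {0..1} c"
      unfolding s_def c_def by (intro continuous_intros)+
    have s: "norm (s t) \<le> 1 * exp (\<tau> * t)" and c: "norm (c t) \<le> 1 * exp (\<tau> * t)" if "t \<in> {0..1}" for t
      using that cmod_sin_mult_of_real_le[of t \<rho>] cmod_cos_mult_of_real_le[of t \<rho>]
      by (auto simp: s_def c_def \<tau>_def)
    have y: "norm (y t) \<le> 2 / r * exp (\<tau> * t)"
      and ys: "norm (\<rho> * y t - s t) \<le> 2 * Q / r * exp (\<tau> * t)"
      and yc: "norm (y' t - c t) \<le> 2 * Q / r * exp (\<tau> * t)" if "t \<in> {0..1}" for t
      using classical_solution_asymptotics[OF cont Q sol init _ _ that] large \<open>\<rho> \<noteq> 0\<close>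
      by (auto simp: r_def \<tau>_def s_def c_def)

    \<comment> \<open>the Wronskian with \<open>\<phi>\<close>, multiplied by \<open>\<rho>\<close>; its value at \<open>1\<close> is \<open>\<rho> \<Delta>\<close>\<close>
    have dW: "((\<lambda>t. \<rho> * (y t * c t) - y' t * s t) has_vector_derivative - (q t * y t * s t)) (at t within {0..1})"
      if t: "t \<in> {0..1}" for t
    proof -
      have "((\<lambda>t. \<rho> * (y t * c t) - y' t * s t) has_vector_derivative
          \<rho> * (y t * - (\<rho> * s t) + y' t * c t) - (y' t * (\<rho> * c t) + (q t - \<rho>\<^sup>2) * y t * s t)) (at t within {0..1})"
        by (intro has_vector_derivative_diff has_vector_derivative_mult has_vector_derivative_mult_right dy[OF t] ds dc)
      then show ?thesis by (simp add: algebra_simps power2_eq_square)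
    qed
    have W: "((\<lambda>t. - (q t * y t * s t)) has_integral \<rho> * char_fun q (\<rho>\<^sup>2)) {0..1}"
    proof -
      have "\<rho> * char_fun q (\<rho>\<^sup>2) = \<rho> * (y 1 * c 1) - y' 1 * s 1"
      proof -
        have "csqrt (\<rho>\<^sup>2) = \<rho> \<or> csqrt (\<rho>\<^sup>2) = - \<rho>"
          using power2_csqrt[of "\<rho>\<^sup>2"] by (simp only: power2_eq_iff)
        then have "cos (csqrt (\<rho>\<^sup>2)) = c 1" "csinc (csqrt (\<rho>\<^sup>2)) = s 1 / \<rho>"
          using \<open>\<rho> \<noteq> 0\<close> by (auto simp: c_def s_def csinc_def)
        then show ?thesis
          using \<open>\<rho> \<noteq> 0\<close> by (simp add: char_fun_def y_def y'_def field_simps)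
      qed
      then show ?thesis using has_integral_of_derivative01[OF dW, of 1]
        by (simp add: init s_def)
    qed

    define J where "J x = integral {0..x} (\<lambda>t. q t * c t * y t)" for x
    \<comment> \<open>the energy-like quantity \<open>\<phi>'S' + \<rho>\<^sup>2 \<phi>S\<close> changes only through \<open>q\<close>\<close>
    have Z: "c x * y' x + \<rho> * (s x * y x) = 1 + J x" if x: "x \<in> {0..1}" for x
    proof -
      have "((\<lambda>t. c t * y' t + \<rho> * (s t * y t)) has_vector_derivative q t * c t * y t) (at t within {0..1})"
        if t: "t \<in> {0..1}" for t
      proof -
        have "((\<lambda>t. c t * y' t + \<rho> * (s t * y t)) has_vector_derivative
            (c t * ((q t - \<rho>\<^sup>2) * y t) + - (\<rho> * s t) * y' t) + \<rho> * (s t * y' t + \<rho> * c t * y t)) (at t within {0..1})"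
          by (intro has_vector_derivative_add has_vector_derivative_mult has_vector_derivative_mult_right dy[OF t] ds dc)
        then show ?thesis by (simp add: algebra_simps power2_eq_square)
      qed
      from has_integral_of_derivative01[OF this x] show ?thesis
        by (simp add: J_def integral_unique init s_def c_def)
    qed
    have contJ: "continuous_on {0..1} J"
      unfolding J_def by (intro indefinite_integral_continuous_1 integrable_continuous_real continuous_intros cont contc conty)

    define P where "P t = \<rho> * (c t * y t) + s t * y' t" for t
    define P' where "P' t = - 4 * \<rho>\<^sup>2 * (s t * y t) + 2 * \<rho> * (1 + J t) + q t * (s t * y t)" for t
    have P: "C1_on01 P P'"
      unfolding C1_on01_def
    proof (intro conjI ballI)
      fix t :: real assume t: "t \<in> {0..1}"
      have "(P has_vector_derivative
          \<rho> * (c t * y' t + - (\<rho> * s t) * y t) + (s t * ((q t - \<rho>\<^sup>2) * y t) + \<rho> * c t * y' t)) (at t within {0..1})"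
        unfolding P_def by (intro has_vector_derivative_add has_vector_derivative_mult has_vector_derivative_mult_right dy[OF t] ds dc)
      moreover have "\<rho> * (c t * y' t + - (\<rho> * s t) * y t) + (s t * ((q t - \<rho>\<^sup>2) * y t) + \<rho> * c t * y' t) = P' t"
        unfolding P'_def Z[OF t, symmetric] by (simp add: algebra_simps power2_eq_square)
      ultimately show "(P has_vector_derivative P' t) (at t within {0..1})" by simp
    next
      show "continuous_on {0..1} P'" unfolding P'_def
        by (intro continuous_intros cont conts conty contJ)
    qed
    define P0 where "P0 t = sin (2 * \<rho> * of_real t)" for t
    define P0' where "P0' t = 2 * \<rho> * cos (2 * \<rho> * of_real t)" for t
    have P0: "C1_on01 P0 P0'" unfolding P0_def P0'_def by (rule C1_on01_sin)
    have P0sc: "P0 t = s t * c t + c t * s t" for t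
      unfolding P0_def s_def c_def sin_add[symmetric] by (simp add: algebra_simps)
    have PP0: "norm (P t - P0 t) \<le> 4 * Q / r * E" if t: "t \<in> {0..1}" for t
    proof -
      have "P t - P0 t = c t * (\<rho> * y t - s t) + s t * (y' t - c t)"
        unfolding P0sc P_def by (simp add: algebra_simps)
      also have "norm \<dots> \<le> norm (c t) * norm (\<rho> * y t - s t) + norm (s t) * norm (y' t - c t)"
        unfolding norm_mult[symmetric] by (rule norm_triangle_ineq)
      also have "\<dots> \<le> 1 * (2 * Q / r) * E + 1 * (2 * Q / r) * E"
        unfolding E_def by (intro add_mono exp_mult_exp_le_exp_2[OF t \<open>\<tau> \<ge> 0\<close>] s[OF t] c[OF t] ys[OF t] yc[OF t] norm_ge_zero)
      finally show ?thesis by (simp add: add_divide_distrib[symmetric] algebra_simps)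
    qed

    have J: "norm (\<rho> * J x) \<le> CJ / r * E" if x: "x \<in> {0..1}" for x
    proof -
      have sub: "{0..x} \<subseteq> {0..1}" using x by auto
      \<comment> \<open>a primitive of \<open>sin \<rho>t cos \<rho>t\<close>, with the gain \<open>1/\<rho>\<close>\<close>
      define u where "u t = (- 1 / (4 * \<rho>)) * cos (2 * \<rho> * of_real t)" for t
      define u' where "u' t = (- 1 / (4 * \<rho>)) * - (2 * \<rho> * sin (2 * \<rho> * of_real t))" for t
      have u: "C1_on01 u u'" unfolding u_def u'_def by (intro C1_on01_cmult C1_on01_cos)
      have u'sc: "u' t = c t * s t" for t
        using P0sc[of t] \<open>\<rho> \<noteq> 0\<close> by (simp add: u'_def P0_def field_simps)
      have ub: "norm (u t) \<le> E / (4 * r)" if "t \<in> {0..1}" for t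
      proof -
        have "norm (cos (2 * \<rho> * of_real t)) \<le> exp (\<bar>Im (2 * \<rho>)\<bar> * t)"
          using that by (intro cmod_cos_mult_of_real_le) auto
        also have "\<dots> \<le> E" using that by (auto simp: E_def \<tau>_def abs_mult mult_left_le)
        finally have "norm (cos (2 * \<rho> * of_real t)) / (4 * r) \<le> E / (4 * r)"
          using r by (intro divide_right_mono) auto
        then show ?thesis by (simp add: u_def norm_mult norm_divide r_def)
      qed
      have Iu: "integral {0..x} (\<lambda>t. q t * u' t) = q x * u x - q 0 * u 0 - deriv_pairing q u u' x"
        by (simp add: deriv_pairing_def)
      have "norm (integral {0..x} (\<lambda>t. q t * u' t)) \<le> Q * (E / (4 * r)) + Q * (E / (4 * r)) + sqrt B * (E / (4 * r))"
        unfolding Iu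
      proof (intro order_trans[OF norm_triangle_ineq4] add_mono)
        show "norm (q x * u x) \<le> Q * (E / (4 * r))"
          unfolding norm_mult using Q[OF x] ub[OF x] \<open>Q \<ge> 0\<close> by (intro mult_mono) auto
        show "norm (q 0 * u 0) \<le> Q * (E / (4 * r))"
          unfolding norm_mult using Q[of 0] ub[of 0] \<open>Q \<ge> 0\<close> by (intro mult_mono) auto
        show "norm (deriv_pairing q u u' x) \<le> sqrt B * (E / (4 * r))"
          by (rule pairing_sup_bound[OF u x ub])
      qed
      also have "Q * (E / (4 * r)) + Q * (E / (4 * r)) + sqrt B * (E / (4 * r)) = (2 * Q + sqrt B) / 4 / r * E"
        using r by (simp add: field_simps)
      finally have b1: "norm (integral {0..x} (\<lambda>t. q t * (c t * s t))) \<le> (2 * Q + sqrt B) / 4 / r * E"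
        by (simp only: u'sc)
      define k where "k t = q t * (c t * (\<rho> * y t - s t))" for t
      have ki: "(k has_integral integral {0..x} k) {0..x}"
        unfolding k_def by (intro integrable_integral integrable_continuous_real continuous_on_subset[OF _ sub]
          continuous_intros cont contc conts conty)
      have b2: "norm (integral {0..x} k) \<le> Q * (1 * (2 * Q / r) * E)"
      proof (rule norm_has_integral_le_const[OF ki x])
        fix t assume "t \<in> {0..x}"
        then have t: "t \<in> {0..1}" using sub by auto
        show "norm (k t) \<le> Q * (1 * (2 * Q / r) * E)"
          unfolding k_def norm_mult[of "q t"]
        proof (intro mult_mono Q[OF t] \<open>Q \<ge> 0\<close> norm_ge_zero)
          show "norm (c t * (\<rho> * y t - s t)) \<le> 1 * (2 * Q / r) * E"
            unfolding norm_mult[of "c t"] E_def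
            by (intro exp_mult_exp_le_exp_2[OF t \<open>\<tau> \<ge> 0\<close>] c[OF t] ys[OF t] norm_ge_zero)
        qed
      qed (use \<open>Q \<ge> 0\<close> r \<open>E > 0\<close> in auto)
      have "\<rho> * J x = integral {0..x} (\<lambda>t. \<rho> * (q t * c t * y t))" by (simp add: J_def)
      also have "\<dots> = integral {0..x} (\<lambda>t. q t * (c t * s t) + k t)"
        by (simp add: k_def algebra_simps)
      also have "\<dots> = integral {0..x} (\<lambda>t. q t * (c t * s t)) + integral {0..x} k"
        by (intro integral_add has_integral_integrable[OF ki]) (intro integrable_continuous_real
          continuous_on_subset[OF _ sub] continuous_intros cont contc conts)
      also have "norm \<dots> \<le> (2 * Q + sqrt B) / 4 / r * E + Q * (1 * (2 * Q / r) * E)"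
        by (intro order_trans[OF norm_triangle_ineq] add_mono b1 b2)
      also have "\<dots> = CJ / r * E" using r by (simp add: CJ_def field_simps power2_eq_square)
      finally show ?thesis .
    qed

    \<comment> \<open>the lower order part of the integral of \<open>q P'\<close>\<close>
    define T where "T = integral {0..1} (\<lambda>t. 2 * (q t * (\<rho> * J t)) + q t * (q t * (s t * y t)))"
    have T: "norm T \<le> 2 * (Q * (CJ / r * E)) + Q * (Q * (1 * (2 / r) * E))"
    proof (rule norm_has_integral_le_const)
      show "((\<lambda>t. 2 * (q t * (\<rho> * J t)) + q t * (q t * (s t * y t))) has_integral T) {0..1}"
        unfolding T_def by (intro integrable_integral integrable_continuous_real continuous_intros cont contJ conts conty)
      fix t :: real assume t: "t \<in> {0..1}"
      show "norm (2 * (q t * (\<rho> * J t)) + q t * (q t * (s t * y t))) \<le> 2 * (Q * (CJ / r * E)) + Q * (Q * (1 * (2 / r) * E))"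
      proof (intro order_trans[OF norm_triangle_ineq] add_mono)
        show "norm (2 * (q t * (\<rho> * J t))) \<le> 2 * (Q * (CJ / r * E))"
          unfolding norm_mult[of 2] norm_mult[of "q t"] using Q[OF t] J[OF t] \<open>Q \<ge> 0\<close>
          by (intro mult_mono) auto
        have "norm (s t * y t) \<le> 1 * (2 / r) * E"
          unfolding norm_mult E_def
          by (intro exp_mult_exp_le_exp_2[OF t \<open>\<tau> \<ge> 0\<close>] s[OF t] y[OF t] norm_ge_zero)
        then show "norm (q t * (q t * (s t * y t))) \<le> Q * (Q * (1 * (2 / r) * E))"
          unfolding norm_mult[of "q t"] using Q[OF t] \<open>Q \<ge> 0\<close> by (intro mult_mono) auto
      qed
    qed (use \<open>Q \<ge> 0\<close> \<open>CJ \<ge> 0\<close> r \<open>E > 0\<close> in auto)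
    have IP: "integral {0..1} (\<lambda>t. q t * P' t) = 4 * \<rho> ^ 3 * char_fun q (\<rho>\<^sup>2) + T"
    proof -
      have "((\<lambda>t. 4 * \<rho>\<^sup>2 * - (q t * y t * s t) + (2 * \<rho> * q t + (2 * (q t * (\<rho> * J t)) + q t * (q t * (s t * y t)))))
          has_integral 4 * \<rho>\<^sup>2 * (\<rho> * char_fun q (\<rho>\<^sup>2)) + (2 * \<rho> * 0 + T)) {0..1}"
      proof (intro has_integral_add has_integral_mult_right W)
        show "(q has_integral 0) {0..1}"
          using integrable_integral[OF integrable_continuous_real[OF cont]] mean0 by simp
        show "((\<lambda>t. 2 * (q t * (\<rho> * J t)) + q t * (q t * (s t * y t))) has_integral T) {0..1}"
          unfolding T_def by (intro integrable_integral integrable_continuous_real continuous_intros cont contJ conts conty)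
      qed
      from integral_unique[OF this] show ?thesis
        by (simp add: P'_def algebra_simps power2_eq_square power3_eq_cube)
    qed
    have PN: "deriv_pairing q P P' 1 = q 1 * P 1 - (4 * \<rho> ^ 3 * char_fun q (\<rho>\<^sup>2) + T)"
      by (simp add: deriv_pairing_def IP) (simp add: P_def init s_def)
    define D where "D = deriv_pairing q (\<lambda>t. P t - P0 t) (\<lambda>t. P' t - P0' t) 1"
    have D: "norm D \<le> sqrt B * (4 * Q / r * E)"
      unfolding D_def by (rule pairing_sup_bound[OF C1_on01_diff[OF P P0] _ PP0]) auto
    have "deriv_sin_transform q (2 * \<rho>) = deriv_pairing q P0 P0' 1"
      by (simp add: deriv_sin_transform_def P0_def[abs_def] P0'_def[abs_def])
    then have ND: "deriv_pairing q P P' 1 = D + deriv_sin_transform q (2 * \<rho>)"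
      unfolding D_def using deriv_pairing_diff[OF cont P P0, of 1] by simp
    have "4 * \<rho> ^ 3 * char_fun q (\<rho>\<^sup>2) - q 1 * sin (2 * \<rho>)
        = q 1 * (P 1 - P0 1) - D - T - deriv_sin_transform q (2 * \<rho>)"
      using PN ND by (simp add: P0_def algebra_simps)
    also have "norm \<dots> \<le> Q * (4 * Q / r * E) + sqrt B * (4 * Q / r * E)
        + (2 * (Q * (CJ / r * E)) + Q * (Q * (1 * (2 / r) * E))) + norm (deriv_sin_transform q (2 * \<rho>))"
    proof (intro order_trans[OF norm_triangle_ineq4] add_mono D T order_refl)
      show "norm (q 1 * (P 1 - P0 1)) \<le> Q * (4 * Q / r * E)"
        unfolding norm_mult using Q[of 1] PP0[of 1] \<open>Q \<ge> 0\<close> by (intro mult_mono) auto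
    qed
    also have "\<dots> = norm (deriv_sin_transform q (2 * \<rho>)) + C * E / r"
      using r by (simp add: C_def field_simps power2_eq_square)
    finally show ?thesis by (simp add: E_def r_def \<tau>_def)
  qed
  show ?thesis by (rule that[OF \<open>C \<ge> 0\<close> _ main, of "max 1 (2 * Q)"]) auto
qed

end

section \<open>The sine transform of the derivative of \<open>q\<close>\<close>

lemma C1_on01_sum:
  assumes "finite K" "\<And>k. k \<in> K \<Longrightarrow> C1_on01 (u k) (u' k)"
  shows "C1_on01 (\<lambda>t. \<Sum>k\<in>K. u k t) (\<lambda>t. \<Sum>k\<in>K. u' k t)"
  using assms unfolding C1_on01_def by (auto intro!: has_vector_derivative_sum continuous_on_sum)

lemma deriv_pairing_sum:
  assumes contq: "continuous_on {0..1} q" and x: "x \<in> {0..1}" and "finite K" "\<And>k. k \<in> K \<Longrightarrow> C1_on01 (u k) (u' k)"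
  shows "deriv_pairing q (\<lambda>t. \<Sum>k\<in>K. u k t) (\<lambda>t. \<Sum>k\<in>K. u' k t) x = (\<Sum>k\<in>K. deriv_pairing q (u k) (u' k) x)"
  using assms(3,4)
proof (induction K)
  case empty
  then show ?case by (simp add: deriv_pairing_def)
next
  case (insert a K)
  have "C1_on01 (\<lambda>t. \<Sum>k\<in>K. u k t) (\<lambda>t. \<Sum>k\<in>K. u' k t)"
    using insert by (intro C1_on01_sum) auto
  then show ?case
    using insert deriv_pairing_add[OF contq _ _ x, of "u a" "u' a" "\<lambda>t. \<Sum>k\<in>K. u k t" "\<lambda>t. \<Sum>k\<in>K. u' k t"] by simp
qed

lemma C1_on01_mult:
  "C1_on01 u u' \<Longrightarrow> C1_on01 v v' \<Longrightarrow> C1_on01 (\<lambda>t. u t * v t) (\<lambda>t. u t * v' t + u' t * v t)"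
  using C1_on01_continuous[of u u'] C1_on01_continuous[of v v']
  unfolding C1_on01_def by (auto intro!: has_vector_derivative_mult continuous_intros)

lemma deriv_pairing_continuous:
  assumes contq: "continuous_on {0..1} q" and u: "C1_on01 u u'"
  shows "continuous_on {0..1} (deriv_pairing q u u')"
proof -
  have "continuous_on {0..1} u'" using u by (simp add: C1_on01_def)
  then show ?thesis unfolding deriv_pairing_def
    by (intro continuous_intros contq C1_on01_continuous[OF u] indefinite_integral_continuous_1
      integrable_continuous_real)
qed

text \<open>A second integration by parts: the primitive of \<open>q'u\<close> is integrated against \<open>v'\<close>. Expressing
  everything through \<open>q\<close> makes it an identity between continuous integrands.\<close>

lemma deriv_pairing_mult:
  assumes contq: "continuous_on {0..1} q" and u: "C1_on01 u u'" and v: "C1_on01 v v'"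
  shows "deriv_pairing q (\<lambda>t. u t * v t) (\<lambda>t. u t * v' t + u' t * v t) 1
    = deriv_pairing q u u' 1 * v 1 - integral {0..1} (\<lambda>x. deriv_pairing q u u' x * v' x)"
proof -
  have dv: "(v has_vector_derivative v' t) (at t within {0..1})" if "t \<in> {0..1}" for t
    using v that by (simp add: C1_on01_def)
  have cont: "continuous_on {0..1} u" "continuous_on {0..1} u'" "continuous_on {0..1} v" "continuous_on {0..1} v'"
    using u v C1_on01_continuous[OF u] C1_on01_continuous[OF v] by (auto simp: C1_on01_def)
  define F where "F x = integral {0..x} (\<lambda>t. q t * u' t)" for x
  have contqu: "continuous_on {0..1} (\<lambda>t. q t * u' t)" by (intro continuous_intros contq cont)
  have dF: "(F has_vector_derivative q t * u' t) (at t within {0..1})" if "t \<in> {0..1}" for t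
    unfolding F_def by (rule integral_has_vector_derivative[OF contqu that])
  have contF: "continuous_on {0..1} F" using dF by (rule has_vector_derivative_imp_continuous_on)
  have Fv: "((\<lambda>t. F t * v' t + q t * u' t * v t) has_integral F 1 * v 1 - F 0 * v 0) {0..1}"
    using has_integral_of_derivative01[OF has_vector_derivative_mult[OF dF dv], of 1] by simp
  have I1: "((\<lambda>t. q t * (u t * v' t + u' t * v t)) has_integral integral {0..1} (\<lambda>t. q t * (u t * v' t + u' t * v t))) {0..1}"
    by (intro integrable_integral integrable_continuous_real continuous_intros contq cont)
  have I2: "((\<lambda>t. q 0 * u 0 * v' t) has_integral q 0 * u 0 * (v 1 - v 0)) {0..1}"
    by (intro has_integral_mult_right has_integral_of_derivative01 dv) auto
  from has_integral_diff[OF has_integral_diff[OF I1 Fv] I2]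
  have "((\<lambda>x. deriv_pairing q u u' x * v' x) has_integral
     (integral {0..1} (\<lambda>t. q t * (u t * v' t + u' t * v t)) - (F 1 * v 1 - F 0 * v 0) - q 0 * u 0 * (v 1 - v 0))) {0..1}"
    by (simp add: deriv_pairing_def F_def algebra_simps)
  then have "integral {0..1} (\<lambda>x. deriv_pairing q u u' x * v' x) =
     integral {0..1} (\<lambda>t. q t * (u t * v' t + u' t * v t)) - F 1 * v 1 - q 0 * u 0 * (v 1 - v 0)"
    by (simp add: integral_unique F_def)
  then show ?thesis by (simp add: deriv_pairing_def F_def algebra_simps)
qed

lemma integral_cos_pi_int:
  "integral {0..1} (\<lambda>t. cos (of_real (pi * of_int n) * of_real t)) = (if n = 0 then 1 else (0 :: complex))"
proof (cases "n = 0")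
  case False
  define z :: complex where "z = of_real (pi * of_int n)"
  have "z \<noteq> 0" using False by (simp add: z_def)
  have "((\<lambda>t. 1 / z * sin (z * of_real t)) has_vector_derivative 1 / z * (z * cos (z * of_real t))) (at t within {0..1})" for t
    by (intro has_vector_derivative_mult_right has_vector_derivative_sin_mult)
  from has_integral_of_derivative01[OF this, of 1]
  have "((\<lambda>t. cos (z * of_real t)) has_integral 1 / z * sin z) {0..1}" using \<open>z \<noteq> 0\<close> by simp
  moreover have "sin z = of_real (sin (pi * of_int n))" unfolding z_def by (rule sin_of_real)
  ultimately show ?thesis using False by (simp add: integral_unique z_def)
qed simp

lemma integral_trig_orthogonal:
  fixes j k :: nat
  assumes "j \<ge> 1" "k \<ge> 1"
  shows "integral {0..1} (\<lambda>t. sin (of_real (pi * real j) * of_real t) * sin (of_real (pi * real k) * of_real t))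
      = (if j = k then 1 / 2 else (0 :: complex))"
    and "integral {0..1} (\<lambda>t. cos (of_real (pi * real j) * of_real t) * cos (of_real (pi * real k) * of_real t))
      = (if j = k then 1 / 2 else (0 :: complex))"
proof -
  define C where "C n t = cos (of_real (pi * of_int n) * of_real t :: complex)" for n :: int and t :: real
  have int: "C n integrable_on {0..1}" for n
    unfolding C_def by (intro integrable_continuous_real continuous_intros)
  have IC: "integral {0..1} (C n) = (if n = 0 then 1 else 0)" for n
    unfolding C_def[abs_def] by (rule integral_cos_pi_int)
  have "(\<lambda>t. sin (of_real (pi * real j) * of_real t) * sin (of_real (pi * real k) * of_real t))
      = (\<lambda>t. (C (int j - int k) t - C (int j + int k) t) / (2 :: complex))"
    by (simp add: sin_times_sin C_def algebra_simps)
  then show "integral {0..1} (\<lambda>t. sin (of_real (pi * real j) * of_real t) * sin (of_real (pi * real k) * of_real t))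
      = (if j = k then 1 / 2 else (0 :: complex))"
    using assms int by (simp add: integral_diff IC)
  have "(\<lambda>t. cos (of_real (pi * real j) * of_real t) * cos (of_real (pi * real k) * of_real t))
      = (\<lambda>t. (C (int j - int k) t + C (int j + int k) t) / (2 :: complex))"
    by (simp add: cos_times_cos C_def algebra_simps)
  then show "integral {0..1} (\<lambda>t. cos (of_real (pi * real j) * of_real t) * cos (of_real (pi * real k) * of_real t))
      = (if j = k then 1 / 2 else (0 :: complex))"
    using assms int by (simp add: integral_add IC)
qed

lemma square_integral_le_integral_square:
  fixes f :: "real \<Rightarrow> real"
  assumes "continuous_on {0..1} f"
  shows "(integral {0..1} f)\<^sup>2 \<le> integral {0..1} (\<lambda>t. (f t)\<^sup>2)"
proof -
  define m where "m = integral {0..1} f"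
  have f: "(f has_integral m) {0..1}"
    unfolding m_def by (intro integrable_integral integrable_continuous_real assms)
  have f2: "((\<lambda>t. (f t)\<^sup>2) has_integral integral {0..1} (\<lambda>t. (f t)\<^sup>2)) {0..1}"
    by (intro integrable_integral integrable_continuous_real continuous_intros assms)
  have "((\<lambda>t. (f t)\<^sup>2 - 2 * m * f t + m\<^sup>2) has_integral
      (integral {0..1} (\<lambda>t. (f t)\<^sup>2) - 2 * m * m + m\<^sup>2)) {0..1}"
    using has_integral_const_real[of "m\<^sup>2" 0 1]
    by (intro has_integral_add has_integral_diff f2 has_integral_mult_right f) simp
  then have "0 \<le> integral {0..1} (\<lambda>t. (f t)\<^sup>2) - 2 * m * m + m\<^sup>2"
  proof (rule has_integral_nonneg)
    show "0 \<le> (f t)\<^sup>2 - 2 * m * f t + m\<^sup>2" for t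
      using zero_le_power2[of "f t - m"] by (simp add: power2_diff mult_ac)
  qed
  then show ?thesis by (simp add: m_def power2_eq_square)
qed

definition sin_pi :: "nat \<Rightarrow> real \<Rightarrow> complex" where "sin_pi k t = sin (of_real (pi * real k) * of_real t)"
definition cos_pi :: "nat \<Rightarrow> real \<Rightarrow> complex" where "cos_pi k t = cos (of_real (pi * real k) * of_real t)"

context weak_deriv_L2
begin

text \<open>Bessel's inequality in dual form: apply the bound of the functional to the combination of the \<open>e\<^sub>k\<close>
  whose coefficients are the conjugates of the values to be estimated.\<close>

lemma pairing_bessel:
  assumes "finite K" and e: "\<And>k. k \<in> K \<Longrightarrow> C1_on01 (e k) (e' k)"
    and real: "\<And>k t. cnj (e k t) = e k t"
    and orth: "\<And>j k. j \<in> K \<Longrightarrow> k \<in> K \<Longrightarrow> integral {0..1} (\<lambda>t. e j t * e k t) = (if j = k then 1 / 2 else 0)"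
    and x: "x \<in> {0..1}"
  shows "(\<Sum>k\<in>K. (norm (deriv_pairing q (e k) (e' k) x))\<^sup>2) \<le> B / 2"
proof -
  define a where "a k = deriv_pairing q (e k) (e' k) x" for k
  define A where "A = (\<Sum>k\<in>K. (norm (a k))\<^sup>2)"
  define u where "u t = (\<Sum>k\<in>K. cnj (a k) * e k t)" for t
  define u' where "u' t = (\<Sum>k\<in>K. cnj (a k) * e' k t)" for t
  have u: "C1_on01 u u'" unfolding u_def u'_def by (intro C1_on01_sum C1_on01_cmult e \<open>finite K\<close>)
  have "deriv_pairing q u u' x = (\<Sum>k\<in>K. cnj (a k) * a k)"
    unfolding u_def u'_def a_def
    by (subst deriv_pairing_sum[OF cont x \<open>finite K\<close>]) (auto intro!: C1_on01_cmult e simp: deriv_pairing_cmult)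
  also have "\<dots> = of_real A" unfolding A_def of_real_sum
    unfolding complex_norm_square by (intro sum.cong refl mult.commute)
  finally have Nu: "deriv_pairing q u u' x = of_real A" .
  have conte: "continuous_on {0..1} (e k)" if "k \<in> K" for k by (rule C1_on01_continuous[OF e[OF that]])
  have "of_real (integral {0..1} (\<lambda>t. (norm (u t))\<^sup>2)) = integral {0..1} (\<lambda>t. complex_of_real ((norm (u t))\<^sup>2))"
  proof -
    have "(\<lambda>t. (norm (u t))\<^sup>2) integrable_on {0..1}"
      by (intro integrable_continuous_real continuous_intros C1_on01_continuous[OF u])
    from has_integral_linear[OF integrable_integral[OF this] bounded_linear_of_real[where 'a = complex]]
    show ?thesis by (simp add: o_def integral_unique)
  qed
  also have "\<dots> = integral {0..1} (\<lambda>t. \<Sum>j\<in>K. \<Sum>k\<in>K. (a j * cnj (a k)) * (e j t * e k t))"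
  proof (intro integral_cong)
    fix t
    have "complex_of_real ((norm (u t))\<^sup>2) = cnj (u t) * u t"
      unfolding complex_norm_square by (rule mult.commute)
    also have "cnj (u t) = (\<Sum>k\<in>K. a k * e k t)" by (simp add: u_def real)
    finally show "complex_of_real ((norm (u t))\<^sup>2) = (\<Sum>j\<in>K. \<Sum>k\<in>K. (a j * cnj (a k)) * (e j t * e k t))"
      by (simp add: u_def sum_product mult_ac)
  qed
  also have "\<dots> = (\<Sum>j\<in>K. \<Sum>k\<in>K. (a j * cnj (a k)) * integral {0..1} (\<lambda>t. e j t * e k t))"
  proof -
    have int: "(\<lambda>t. (a j * cnj (a k)) * (e j t * e k t)) integrable_on {0..1}" if "j \<in> K" "k \<in> K" for j k
      by (intro integrable_continuous_real continuous_intros conte that)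
    have "integral {0..1} (\<lambda>t. \<Sum>j\<in>K. \<Sum>k\<in>K. (a j * cnj (a k)) * (e j t * e k t))
        = (\<Sum>j\<in>K. integral {0..1} (\<lambda>t. \<Sum>k\<in>K. (a j * cnj (a k)) * (e j t * e k t)))"
      by (intro integral_sum integrable_sum int \<open>finite K\<close>)
    also have "\<dots> = (\<Sum>j\<in>K. \<Sum>k\<in>K. integral {0..1} (\<lambda>t. (a j * cnj (a k)) * (e j t * e k t)))"
      by (intro sum.cong refl integral_sum int \<open>finite K\<close>)
    finally show ?thesis by simp
  qed
  also have "\<dots> = (\<Sum>j\<in>K. \<Sum>k\<in>K. if j = k then (a j * cnj (a k)) / 2 else 0)"
    by (intro sum.cong refl) (simp add: orth)
  also have "\<dots> = (\<Sum>j\<in>K. a j * cnj (a j) / 2)" using \<open>finite K\<close> by simp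
  also have "\<dots> = of_real (A / 2)" 
    by (simp only: A_def of_real_divide of_real_sum complex_norm_square sum_divide_distrib of_real_numeral)
  finally have Iu: "integral {0..1} (\<lambda>t. (norm (u t))\<^sup>2) = A / 2" by (simp only: of_real_eq_iff)
  have "A\<^sup>2 \<le> B * (A / 2)"
    using pairing_bound[OF u x] unfolding Nu Iu by simp
  moreover have "A \<ge> 0" by (simp add: A_def sum_nonneg)
  ultimately have "A \<le> B / 2" using B_nonneg
    by (cases "A = 0") (auto simp: power2_eq_square field_simps)
  then show ?thesis by (simp add: A_def a_def)
qed

definition sin_coeff_q :: "nat \<Rightarrow> real \<Rightarrow> complex" where
  "sin_coeff_q k = deriv_pairing q (sin_pi k) (\<lambda>t. of_real (pi * real k) * cos_pi k t)"

definition cos_coeff_q :: "nat \<Rightarrow> real \<Rightarrow> complex" where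
  "cos_coeff_q k = deriv_pairing q (cos_pi k) (\<lambda>t. - (of_real (pi * real k) * sin_pi k t))"

text \<open>A majorant for the transform of \<open>q'\<close> near \<open>\<pi>k\<close>. The coefficients over all intervals \<open>[0,x]\<close>
  enter, averaged over \<open>x\<close>, because the correction factors \<open>cos wx\<close> and \<open>sin wx\<close> are removed by an
  integration by parts in \<open>x\<close>.\<close>

definition fourier_size :: "nat \<Rightarrow> real" where
  "fourier_size k = norm (sin_coeff_q k 1) + norm (cos_coeff_q k 1)
     + integral {0..1} (\<lambda>x. norm (sin_coeff_q k x)) + integral {0..1} (\<lambda>x. norm (cos_coeff_q k x))"

lemma C1_sin_pi: "C1_on01 (sin_pi k) (\<lambda>t. of_real (pi * real k) * cos_pi k t)"
  unfolding sin_pi_def[abs_def] cos_pi_def by (rule C1_on01_sin)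

lemma C1_cos_pi: "C1_on01 (cos_pi k) (\<lambda>t. - (of_real (pi * real k) * sin_pi k t))"
  unfolding cos_pi_def[abs_def] sin_pi_def by (rule C1_on01_cos)

lemma continuous_fourier_coeffs:
  "continuous_on {0..1} (sin_coeff_q k)" "continuous_on {0..1} (cos_coeff_q k)"
  unfolding sin_coeff_q_def cos_coeff_q_def by (intro deriv_pairing_continuous cont C1_sin_pi C1_cos_pi)+

lemma fourier_size_nonneg: "fourier_size k \<ge> 0"
  unfolding fourier_size_def
  by (intro add_nonneg_nonneg integral_nonneg integrable_continuous_real continuous_intros continuous_fourier_coeffs) auto

lemma bessel_fourier_coeffs:
  assumes x: "x \<in> {0..1}"
  shows "(\<Sum>k\<in>{1..n}. (norm (sin_coeff_q k x))\<^sup>2) \<le> B / 2"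
    and "(\<Sum>k\<in>{1..n}. (norm (cos_coeff_q k x))\<^sup>2) \<le> B / 2"
proof -
  have real: "cnj (sin_pi k t) = sin_pi k t" "cnj (cos_pi k t) = cos_pi k t" for k t
    unfolding sin_pi_def cos_pi_def by (simp_all only: of_real_mult[symmetric] sin_of_real cos_of_real complex_cnj_complex_of_real)
  show "(\<Sum>k\<in>{1..n}. (norm (sin_coeff_q k x))\<^sup>2) \<le> B / 2"
    unfolding sin_coeff_q_def
  proof (rule pairing_bessel[OF _ C1_sin_pi real(1) _ x])
    show "integral {0..1} (\<lambda>t. sin_pi j t * sin_pi k t) = (if j = k then 1 / 2 else 0)"
      if "j \<in> {1..n}" "k \<in> {1..n}" for j k
      unfolding sin_pi_def using that by (intro integral_trig_orthogonal) auto
  qed auto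
  show "(\<Sum>k\<in>{1..n}. (norm (cos_coeff_q k x))\<^sup>2) \<le> B / 2"
    unfolding cos_coeff_q_def
  proof (rule pairing_bessel[OF _ C1_cos_pi real(2) _ x])
    show "integral {0..1} (\<lambda>t. cos_pi j t * cos_pi k t) = (if j = k then 1 / 2 else 0)"
      if "j \<in> {1..n}" "k \<in> {1..n}" for j k
      unfolding cos_pi_def using that by (intro integral_trig_orthogonal) auto
  qed auto
qed

text \<open>The constant in Bessel's inequality for \<open>[0,x]\<close> does not depend on \<open>x\<close>, so the inequality
  survives averaging over \<open>x\<close>.\<close>

lemma bessel_integrated:
  fixes f :: "nat \<Rightarrow> real \<Rightarrow> complex"
  assumes f: "\<And>k. continuous_on {0..1} (f k)" 
    and b: "\<And>x. x \<in> {0..1} \<Longrightarrow> (\<Sum>k\<in>{1..n}. (norm (f k x))\<^sup>2) \<le> c"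
  shows "(\<Sum>k\<in>{1..n}. (integral {0..1} (\<lambda>x. norm (f k x)))\<^sup>2) \<le> c"
proof -
  have int: "(\<lambda>x. (norm (f k x))\<^sup>2) integrable_on {0..1}" for k
    by (intro integrable_continuous_real continuous_intros f)
  have "(\<Sum>k\<in>{1..n}. (integral {0..1} (\<lambda>x. norm (f k x)))\<^sup>2) \<le> (\<Sum>k\<in>{1..n}. integral {0..1} (\<lambda>x. (norm (f k x))\<^sup>2))"
    by (intro sum_mono square_integral_le_integral_square continuous_intros f)
  also have "\<dots> = integral {0..1} (\<lambda>x. \<Sum>k\<in>{1..n}. (norm (f k x))\<^sup>2)"
    by (intro integral_sum[symmetric] int) auto
  also have "\<dots> \<le> integral {0..1} (\<lambda>x::real. c)"
    using b by (intro integral_le integrable_sum int) auto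
  finally show ?thesis by simp
qed

theorem fourier_size_summable: "summable (\<lambda>k. (fourier_size k)\<^sup>2)"
proof -
  have "summable (\<lambda>k. (fourier_size (Suc k))\<^sup>2)"
  proof (rule summableI_nonneg_bounded)
    fix n
    define a1 where "a1 k = norm (sin_coeff_q k 1)" for k
    define a2 where "a2 k = norm (cos_coeff_q k 1)" for k
    define a3 where "a3 k = integral {0..1} (\<lambda>x. norm (sin_coeff_q k x))" for k
    define a4 where "a4 k = integral {0..1} (\<lambda>x. norm (cos_coeff_q k x))" for k
    have "(\<Sum>k<n. (fourier_size (Suc k))\<^sup>2) = (\<Sum>k\<in>{1..n}. (fourier_size k)\<^sup>2)"
      by (rule sum.reindex_bij_witness[of _ "\<lambda>k. k - 1" Suc]) auto
    also have "\<dots> \<le> (\<Sum>k\<in>{1..n}. 4 * ((a1 k)\<^sup>2 + (a2 k)\<^sup>2 + (a3 k)\<^sup>2 + (a4 k)\<^sup>2))"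
    proof (rule sum_mono)
      fix k
      have "(a + b + c + d)\<^sup>2 \<le> 4 * (a\<^sup>2 + b\<^sup>2 + c\<^sup>2 + d\<^sup>2)" for a b c d :: real
      proof -
        have "0 \<le> (a - b)\<^sup>2 + (a - c)\<^sup>2 + (a - d)\<^sup>2 + (b - c)\<^sup>2 + (b - d)\<^sup>2 + (c - d)\<^sup>2" by simp
        then show ?thesis by (simp add: power2_eq_square algebra_simps)
      qed
      then show "(fourier_size k)\<^sup>2 \<le> 4 * ((a1 k)\<^sup>2 + (a2 k)\<^sup>2 + (a3 k)\<^sup>2 + (a4 k)\<^sup>2)"
        unfolding fourier_size_def a1_def a2_def a3_def a4_def .
    qed
    also have "\<dots> = 4 * ((\<Sum>k\<in>{1..n}. (a1 k)\<^sup>2) + (\<Sum>k\<in>{1..n}. (a2 k)\<^sup>2) + (\<Sum>k\<in>{1..n}. (a3 k)\<^sup>2) + (\<Sum>k\<in>{1..n}. (a4 k)\<^sup>2))"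
      by (simp add: sum.distrib sum_distrib_left)
    also have "\<dots> \<le> 4 * (B / 2 + B / 2 + B / 2 + B / 2)"
      unfolding a1_def a2_def a3_def a4_def
      by (intro mult_left_mono add_mono bessel_fourier_coeffs bessel_integrated continuous_fourier_coeffs) auto
    finally show "(\<Sum>k<n. (fourier_size (Suc k))\<^sup>2) \<le> 4 * (B / 2 + B / 2 + B / 2 + B / 2)" .
  qed auto
  then show ?thesis using summable_Suc_iff[of "\<lambda>k. (fourier_size k)\<^sup>2"] by simp
qed

lemma fourier_size_tendsto_0: "fourier_size \<longlonglongrightarrow> 0"
proof -
  have "(\<lambda>k. (fourier_size k)\<^sup>2) \<longlonglongrightarrow> 0" using fourier_size_summable by (rule summable_LIMSEQ_zero)
  from tendsto_real_sqrt[OF this] show ?thesis by (simp add: fourier_size_nonneg)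
qed

lemma pairing_mult_bound:
  assumes u: "C1_on01 u u'" and v: "C1_on01 v v'"
    and b: "norm (v 1) \<le> M" "\<And>t. t \<in> {0..1} \<Longrightarrow> norm (v' t) \<le> M'"
  shows "norm (deriv_pairing q (\<lambda>t. u t * v t) (\<lambda>t. u t * v' t + u' t * v t) 1)
     \<le> M * norm (deriv_pairing q u u' 1) + M' * integral {0..1} (\<lambda>x. norm (deriv_pairing q u u' x))"
proof -
  note contp = deriv_pairing_continuous[OF cont u]
  have contv': "continuous_on {0..1} v'" using v by (simp add: C1_on01_def)
  have "norm (integral {0..1} (\<lambda>x. deriv_pairing q u u' x * v' x))
      \<le> integral {0..1} (\<lambda>x. M' * norm (deriv_pairing q u u' x))"
  proof (intro integral_norm_bound_integral integrable_continuous_real continuous_intros contp contv')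
    fix x :: real assume "x \<in> {0..1}"
    then show "norm (deriv_pairing q u u' x * v' x) \<le> M' * norm (deriv_pairing q u u' x)"
      unfolding norm_mult using b(2) by (subst mult.commute) (intro mult_right_mono, auto)
  qed
  moreover have "norm (deriv_pairing q u u' 1 * v 1) \<le> M * norm (deriv_pairing q u u' 1)"
    unfolding norm_mult using b(1) by (subst mult.commute) (intro mult_right_mono, auto)
  ultimately show ?thesis unfolding deriv_pairing_mult[OF cont u v]
    using norm_triangle_ineq4[of "deriv_pairing q u u' 1 * v 1" "integral {0..1} (\<lambda>x. deriv_pairing q u u' x * v' x)"]
    by simp
qed

text \<open>Write \<open>z = \<pi>k + w\<close> and split \<open>sin zx = sin \<pi>kx cos wx + cos \<pi>kx sin wx\<close>; the factors with \<open>w\<close> are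
  smooth and uniformly bounded for \<open>|w| \<le> d\<close>, so \<open>pairing_mult_bound\<close> applies.\<close>

theorem deriv_sin_transform_local_bound:
  assumes "norm (z - of_real (pi * real k)) \<le> d"
  shows "norm (deriv_sin_transform q z) \<le> (1 + d) * exp d * fourier_size k"
proof -
  define w where "w = z - of_real (pi * real k)"
  have w: "norm w \<le> d" "\<bar>Im w\<bar> \<le> d" using assms abs_Im_le_cmod[of w] by (auto simp: w_def)
  have "d \<ge> 0" using w norm_ge_zero[of w] by linarith
  define sw where "sw t = sin (w * of_real t)" for t :: real
  define cw where "cw t = cos (w * of_real t)" for t :: real
  have sw: "C1_on01 sw (\<lambda>t. w * cw t)" unfolding sw_def cw_def by (rule C1_on01_sin)
  have cw: "C1_on01 cw (\<lambda>t. - (w * sw t))" unfolding sw_def cw_def by (rule C1_on01_cos)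
  have b: "norm (sw t) \<le> exp d" "norm (cw t) \<le> exp d" if "t \<in> {0..1}" for t
  proof -
    have "\<bar>Im w\<bar> * t \<le> d * 1" using w that \<open>d \<ge> 0\<close> by (intro mult_mono) auto
    then have e: "exp (\<bar>Im w\<bar> * t) \<le> exp d" by simp
    show "norm (sw t) \<le> exp d" "norm (cw t) \<le> exp d"
      using order_trans[OF cmod_sin_mult_of_real_le e] order_trans[OF cmod_cos_mult_of_real_le e] that
      unfolding sw_def cw_def by auto
  qed
  have b': "norm (w * cw t) \<le> d * exp d" "norm (- (w * sw t)) \<le> d * exp d" if "t \<in> {0..1}" for t
    unfolding norm_minus_cancel norm_mult using b[OF that] w by (auto intro!: mult_mono)
  define U where "U = (\<lambda>t. sin_pi k t * - (w * sw t) + of_real (pi * real k) * cos_pi k t * cw t)"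
  define V where "V = (\<lambda>t. cos_pi k t * (w * cw t) + - (of_real (pi * real k) * sin_pi k t) * sw t)"
  have z: "z * of_real t = of_real (pi * real k) * of_real t + w * of_real t" for t
    by (simp add: w_def algebra_simps)
  have "deriv_sin_transform q z = deriv_pairing q (\<lambda>t. sin_pi k t * cw t + cos_pi k t * sw t) (\<lambda>t. U t + V t) 1"
  proof -
    have 1: "sin (z * of_real t) = sin_pi k t * cw t + cos_pi k t * sw t" for t
      unfolding z sin_add by (simp add: sin_pi_def cos_pi_def sw_def cw_def)
    have 2: "z * cos (z * of_real t) = U t + V t" for t
      unfolding z cos_add by (simp add: w_def U_def V_def sin_pi_def cos_pi_def sw_def cw_def algebra_simps)
    show ?thesis unfolding deriv_sin_transform_def by (simp only: 1 2)
  qed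
  also have "\<dots> = deriv_pairing q (\<lambda>t. sin_pi k t * cw t) U 1 + deriv_pairing q (\<lambda>t. cos_pi k t * sw t) V 1"
    unfolding U_def V_def
    by (rule deriv_pairing_add[OF cont C1_on01_mult[OF C1_sin_pi cw] C1_on01_mult[OF C1_cos_pi sw]]) auto
  also have "norm \<dots> \<le> norm (deriv_pairing q (\<lambda>t. sin_pi k t * cw t) U 1) + norm (deriv_pairing q (\<lambda>t. cos_pi k t * sw t) V 1)"
    by (rule norm_triangle_ineq)
  also have "\<dots> \<le> (exp d * norm (sin_coeff_q k 1) + d * exp d * integral {0..1} (\<lambda>x. norm (sin_coeff_q k x)))
      + (exp d * norm (cos_coeff_q k 1) + d * exp d * integral {0..1} (\<lambda>x. norm (cos_coeff_q k x)))"
    unfolding U_def V_def sin_coeff_q_def cos_coeff_q_def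
    by (intro add_mono pairing_mult_bound C1_sin_pi C1_cos_pi sw cw b b') auto
  also have "\<dots> \<le> (1 + d) * exp d * norm (sin_coeff_q k 1) + (1 + d) * exp d * integral {0..1} (\<lambda>x. norm (sin_coeff_q k x))
      + ((1 + d) * exp d * norm (cos_coeff_q k 1) + (1 + d) * exp d * integral {0..1} (\<lambda>x. norm (cos_coeff_q k x)))"
    using \<open>d \<ge> 0\<close> by (intro add_mono mult_right_mono integral_nonneg integrable_continuous_real continuous_intros continuous_fourier_coeffs) auto
  also have "\<dots> = (1 + d) * exp d * fourier_size k" by (simp add: fourier_size_def algebra_simps)
  finally show ?thesis .
qed

text \<open>Far from the real axis Cauchy-Schwarz alone suffices: the \<open>L\<^sub>2\<close> norm of \<open>sin zx\<close> gains a factor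
  \<open>|Im z|\<close> to the power \<open>-1/2\<close> over its supremum.\<close>

lemma deriv_sin_transform_strip_bound:
  assumes "Im z \<noteq> 0"
  shows "(norm (deriv_sin_transform q z))\<^sup>2 \<le> B / (2 * \<bar>Im z\<bar>) * (exp \<bar>Im z\<bar>)\<^sup>2"
proof -
  define t where "t = \<bar>Im z\<bar>"
  have "t > 0" using assms by (simp add: t_def)
  have "((\<lambda>x. 1 / (2 * t) * exp (2 * t * x)) has_real_derivative exp (2 * t * x)) (at x within {0..1})" for x
    using \<open>t > 0\<close> by (auto intro!: derivative_eq_intros)
  then have "((\<lambda>x. exp (2 * t * x)) has_integral (1 / (2 * t) * exp (2 * t * 1) - 1 / (2 * t) * exp (2 * t * 0))) {0..1}"
    by (intro fundamental_theorem_of_calculus) (auto simp: has_real_derivative_iff_has_vector_derivative)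
  then have I: "((\<lambda>x. exp (2 * t * x)) has_integral (1 / (2 * t) * exp (2 * t) - 1 / (2 * t))) {0..1}" by simp
  have "(norm (deriv_sin_transform q z))\<^sup>2 \<le> B * integral {0..1} (\<lambda>x. (norm (sin (z * of_real x)))\<^sup>2)"
    unfolding deriv_sin_transform_def by (rule pairing_bound[OF C1_on01_sin]) auto
  also have "integral {0..1} (\<lambda>x. (norm (sin (z * of_real x)))\<^sup>2) \<le> integral {0..1} (\<lambda>x. exp (2 * t * x))"
  proof (intro integral_le has_integral_integrable[OF I] integrable_continuous_real continuous_intros)
    fix x :: real assume "x \<in> {0..1}"
    then have "(norm (sin (z * of_real x)))\<^sup>2 \<le> (exp (t * x))\<^sup>2"
      unfolding t_def by (intro power_mono cmod_sin_mult_of_real_le) auto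
    also have "\<dots> = exp (2 * t * x)" by (simp add: exp_double[symmetric] mult.assoc)
    finally show "(norm (sin (z * of_real x)))\<^sup>2 \<le> exp (2 * t * x)" .
  qed
  also have "integral {0..1} (\<lambda>x. exp (2 * t * x)) \<le> 1 / (2 * t) * exp (2 * t)"
    using integral_unique[OF I] \<open>t > 0\<close> by simp
  finally have "(norm (deriv_sin_transform q z))\<^sup>2 \<le> B * (1 / (2 * t) * exp (2 * t))"
    using B_nonneg by (simp add: mult_left_mono)
  then show ?thesis by (simp add: t_def exp_double)
qed

text \<open>Outside a horizontal strip the previous bound gives the factor \<open>\<eta>\<close>; inside it every \<open>z\<close> lies within
  bounded distance of some \<open>\<pi>k\<close>, and the local bound tends to zero with \<open>k\<close>.\<close>

theorem deriv_sin_transform_riemann_lebesgue: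
  assumes "\<eta> > 0"
  obtains R where "\<And>z. Re z \<ge> 0 \<Longrightarrow> norm z \<ge> R \<Longrightarrow> norm (deriv_sin_transform q z) \<le> \<eta> * exp \<bar>Im z\<bar>"
proof -
  \<comment> \<open>outside the strip \<open>|Im z| < T\<close> the strip bound is already below \<open>\<eta>\<close>\<close>
  define T where "T = B / (2 * \<eta>\<^sup>2) + 1"
  have "T > 0" unfolding T_def using B_nonneg assms by (intro add_nonneg_pos) auto
  define d where "d = T + pi"
  have "(\<lambda>k. (1 + d) * exp d * fourier_size k) \<longlonglongrightarrow> (1 + d) * exp d * 0"
    by (intro tendsto_intros fourier_size_tendsto_0)
  then have "eventually (\<lambda>k. (1 + d) * exp d * fourier_size k < \<eta>) sequentially"
    using \<open>\<eta> > 0\<close> by (intro order_tendstoD) auto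
  then obtain K where K: "\<And>k. k \<ge> K \<Longrightarrow> (1 + d) * exp d * fourier_size k < \<eta>"
    unfolding eventually_sequentially by blast
  show ?thesis
  proof (rule that[of "T + pi * (real K + 1)"])
    fix z :: complex assume z: "Re z \<ge> 0" "norm z \<ge> T + pi * (real K + 1)"
    show "norm (deriv_sin_transform q z) \<le> \<eta> * exp \<bar>Im z\<bar>"
    proof (cases "\<bar>Im z\<bar> \<ge> T")
      case True
      then have "Im z \<noteq> 0" using \<open>T > 0\<close> by auto
      have "B / (2 * \<bar>Im z\<bar>) \<le> \<eta>\<^sup>2"
      proof -
        have "B / (2 * \<eta>\<^sup>2) \<le> \<bar>Im z\<bar>" using True by (simp add: T_def)
        then show ?thesis using \<open>\<eta> > 0\<close> \<open>Im z \<noteq> 0\<close> by (simp add: field_simps)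
      qed
      then have "(norm (deriv_sin_transform q z))\<^sup>2 \<le> \<eta>\<^sup>2 * (exp \<bar>Im z\<bar>)\<^sup>2"
        using deriv_sin_transform_strip_bound[OF \<open>Im z \<noteq> 0\<close>] by (meson mult_right_mono order_trans zero_le_power2)
      then have "(norm (deriv_sin_transform q z))\<^sup>2 \<le> (\<eta> * exp \<bar>Im z\<bar>)\<^sup>2"
        by (simp only: power_mult_distrib)
      then show ?thesis by (rule power2_le_imp_le) (use \<open>\<eta> > 0\<close> in simp)
    next
      case False
      define k where "k = nat \<lfloor>Re z / pi\<rfloor>"
      have k: "real k \<le> Re z / pi" "Re z / pi < real k + 1"
      proof -
        have "real k = of_int \<lfloor>Re z / pi\<rfloor>" using z(1) by (simp add: k_def)
        then show "real k \<le> Re z / pi" "Re z / pi < real k + 1"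
          using of_int_floor_le[of "Re z / pi"] real_of_int_floor_add_one_gt[of "Re z / pi"] by simp_all
      qed
      then have k': "pi * real k \<le> Re z" "Re z < pi * (real k + 1)" by (auto simp: field_simps)
      have "norm z \<le> \<bar>Re z\<bar> + \<bar>Im z\<bar>" by (rule cmod_le)
      then have "pi * (real K + 1) < pi * (real k + 1)" using z False k'(2) by linarith
      then have "k \<ge> K" by simp
      have "norm (z - of_real (pi * real k)) \<le> \<bar>Re (z - of_real (pi * real k))\<bar> + \<bar>Im (z - of_real (pi * real k))\<bar>"
        by (rule cmod_le)
      also have "\<dots> \<le> d" using k' False by (simp add: d_def algebra_simps)
      finally have "norm (deriv_sin_transform q z) \<le> (1 + d) * exp d * fourier_size k"
        by (rule deriv_sin_transform_local_bound)
      also have "\<dots> \<le> \<eta> * 1" using K[OF \<open>k \<ge> K\<close>] by simp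
      also have "\<dots> \<le> \<eta> * exp \<bar>Im z\<bar>" using \<open>\<eta> > 0\<close> by (intro mult_left_mono) auto
      finally show ?thesis .
    qed
  qed
qed

end

section \<open>A lower bound for the sine\<close>

lemma sin_ge_half:
  fixes x :: real
  assumes "0 \<le> x" "x \<le> pi / 2"
  shows "x / 2 \<le> sin x"
proof -
  have "\<bar>sin x - (\<Sum>m<3. sin_coeff m * x ^ m)\<bar> \<le> inverse (fact 3) * \<bar>x\<bar> ^ 3"
    by (rule Maclaurin_sin_bound)
  then have "\<bar>sin x - x\<bar> \<le> x ^ 3 / 6"
    using assms by (simp add: numeral_3_eq_3 sin_coeff_def fact_numeral)
  then have "x - x ^ 3 / 6 \<le> sin x" by linarith
  moreover have "x ^ 3 / 6 \<le> x / 2"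
  proof -
    have "x \<le> 1.6" using assms pi_less_4 pi_approx by simp
    then have "x * x \<le> 1.6 * 1.6" using assms by (intro mult_mono) auto
    then have "x * (x * x) \<le> x * 3" using assms by (intro mult_left_mono) auto
    then show ?thesis by (simp add: power3_eq_cube)
  qed
  ultimately show ?thesis by linarith
qed

text \<open>For \<open>|Im z| \<ge> 1\<close> the exponential is dominant; closer to the real axis
  \<open>|sin z|\<^sup>2 = sin\<^sup>2 x + sinh\<^sup>2 y\<close> with \<open>x\<close>, \<open>y\<close> the coordinates of \<open>z - \<pi>m\<close> is compared with
  \<open>(x\<^sup>2 + y\<^sup>2) / 4\<close>.\<close>

theorem norm_sin_ge:
  fixes z :: complex
  assumes "\<bar>Re z - pi * real m\<bar> \<le> pi / 2"
  shows "norm (sin z) \<ge> 1 / 8 * exp \<bar>Im z\<bar> * min 1 (norm (z - of_real (pi * real m)))"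
proof -
  define x where "x = Re z - pi * real m"
  define y where "y = \<bar>Im z\<bar>"
  define D where "D = norm (z - of_real (pi * real m))"
  have D2: "D\<^sup>2 = x\<^sup>2 + y\<^sup>2" by (simp add: D_def x_def y_def cmod_power2)
  have "D \<ge> 0" "y \<ge> 0" by (auto simp: D_def y_def)
  have "cos (2 * Re z) = cos (2 * x)"
  proof -
    have "2 * x = 2 * Re z - 2 * pi * real m" by (simp add: x_def)
    then have "cos (2 * x) = cos (2 * Re z - 2 * pi * real m)" by simp
    also have "\<dots> = cos (2 * Re z)" 
      using cos_2npi[of m] sin_2npi[of m] by (simp add: cos_diff mult_ac)
    finally show ?thesis by simp
  qed
  moreover have "exp (2 * Im z) + inverse (exp (2 * Im z)) = exp (2 * y) + exp (- 2 * y)"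
    unfolding y_def by (cases "Im z \<ge> 0") (auto simp: exp_minus)
  ultimately have sin2: "(norm (sin z))\<^sup>2 = (exp (2 * y) + exp (- 2 * y) - 2 * cos (2 * x)) / 4"
    using norm_sin_squared[of z] by simp
  show ?thesis
  proof (cases "y \<ge> 1")
    case True
    have "exp (2 * y) \<ge> 1 + 2 * y" by (rule exp_ge_add_one_self)
    then have "exp (2 * y) \<ge> 3" using True by linarith
    have "E / 64 * 1 \<le> (E + e - 2 * c) / 4" if "3 \<le> E" "c \<le> 1" "0 < e" for E c e :: real
      using that by (simp add: field_simps)
    from this[OF \<open>exp (2 * y) \<ge> 3\<close> cos_le_one exp_gt_zero]
    have "(norm (sin z))\<^sup>2 \<ge> exp (2 * y) / 64 * 1" unfolding sin2 .
    also have "exp (2 * y) / 64 * 1 = (1 / 8 * exp y)\<^sup>2" by (simp add: power_mult_distrib power_divide exp_double)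
    finally have "1 / 8 * exp y \<le> norm (sin z)" by (rule power2_le_imp_le) simp
    moreover have "1 / 8 * exp y * min 1 D \<le> 1 / 8 * exp y * 1" by (intro mult_left_mono) auto
    ultimately have "1 / 8 * exp y * min 1 D \<le> norm (sin z)" by linarith
    then show ?thesis unfolding y_def D_def .
  next
    case False
    have "\<bar>x\<bar> / 2 \<le> sin \<bar>x\<bar>" using assms by (intro sin_ge_half) (auto simp: x_def)
    then have "(\<bar>x\<bar> / 2)\<^sup>2 \<le> (sin \<bar>x\<bar>)\<^sup>2" by (intro power_mono) auto
    then have sx: "x\<^sup>2 / 4 \<le> (sin x)\<^sup>2" by (auto simp: power_divide abs_if split: if_splits)
    have "\<bar>y\<bar> \<le> \<bar>(exp y - inverse (exp y)) / 2\<bar>" by (rule real_le_abs_sinh)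
    then have "y\<^sup>2 \<le> ((exp y - inverse (exp y)) / 2)\<^sup>2" by (rule abs_le_square_iff[THEN iffD1])
    also have "\<dots> = (exp (2 * y) + exp (- 2 * y) - 2) / 4"
    proof -
      have "exp (2 * y) = exp y * exp y" "exp (- 2 * y) = inverse (exp y * exp y)"
        by (simp_all add: exp_add[symmetric] exp_minus[symmetric])
      then show ?thesis by (simp add: power2_eq_square field_simps)
    qed
    finally have sy: "y\<^sup>2 \<le> (exp (2 * y) + exp (- 2 * y) - 2) / 4" .
    have "D\<^sup>2 / 4 \<le> x\<^sup>2 / 4 + y\<^sup>2" by (simp add: D2)
    also have "\<dots> \<le> (norm (sin z))\<^sup>2" unfolding sin2 cos_double_sin using sx sy by (simp add: algebra_simps)
    finally have "(D / 2)\<^sup>2 \<le> (norm (sin z))\<^sup>2" by (simp add: power_divide)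
    then have "D / 2 \<le> norm (sin z)" by (rule power2_le_imp_le) simp
    moreover have "exp y \<le> 4"
      using exp_le False by (smt (verit) exp_le_cancel_iff)
    then have "1 / 8 * exp y * min 1 D \<le> 1 / 8 * 4 * D" using \<open>D \<ge> 0\<close> by (intro mult_mono) auto
    ultimately have "1 / 8 * exp y * min 1 D \<le> norm (sin z)" by linarith
    then show ?thesis unfolding y_def D_def .
  qed
qed

section \<open>Rouche's theorem and the comparison function\<close>

text \<open>Although \<open>csqrt\<close> is discontinuous along the negative axis, both functions are entire: they are
  \<open>S'(1,\<lambda>)\<close> and \<open>S(1,\<lambda>)\<close> for \<open>q = 0\<close>.\<close>

lemma csqrt_trig_holomorphic:
  "(\<lambda>lam. cos (csqrt lam)) holomorphic_on UNIV" "(\<lambda>lam. csinc (csqrt lam)) holomorphic_on UNIV"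
proof -
  define q0 :: "real \<Rightarrow> complex" where "q0 = (\<lambda>x. 0)"
  have contq: "continuous_on {0..1} q0" by (simp add: q0_def)
  have eq: "csinc (csqrt lam) = sl_S q0 lam 1 \<and> cos (csqrt lam) = deriv01 (sl_S q0 lam) 1" for lam
  proof (cases "lam = 0")
    case True
    have "classical_solution q0 lam of_real (\<lambda>x. 1)"
      unfolding classical_solution_def q0_def True
      by (auto intro: has_vector_derivative_of_real[of "\<lambda>x. x" 1, simplified])
    from classical_solution_unique[OF contq this sl_S_classical_solution(1)[OF contq], of 1]
    show ?thesis using sl_S_classical_solution(2,3)[OF contq] by (simp add: True csinc_def)
  next
    case False
    define \<rho> where "\<rho> = csqrt lam"
    have \<rho>: "\<rho> \<noteq> 0" "\<rho>\<^sup>2 = lam" using False by (simp_all add: \<rho>_def)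
    have "classical_solution q0 lam (\<lambda>x. 1 / \<rho> * sin (\<rho> * of_real x)) (\<lambda>x. cos (\<rho> * of_real x))"
      unfolding classical_solution_def
    proof (intro ballI conjI)
      fix x :: real
      have "((\<lambda>x. 1 / \<rho> * sin (\<rho> * of_real x)) has_vector_derivative 1 / \<rho> * (\<rho> * cos (\<rho> * of_real x))) (at x within {0..1})"
        by (intro has_vector_derivative_mult_right has_vector_derivative_sin_mult)
      then show "((\<lambda>x. 1 / \<rho> * sin (\<rho> * of_real x)) has_vector_derivative cos (\<rho> * of_real x)) (at x within {0..1})"
        using \<rho> by simp
      have "- (\<rho> * sin (\<rho> * of_real x)) = (q0 x - lam) * (1 / \<rho> * sin (\<rho> * of_real x))"
        using \<rho> by (simp add: q0_def power2_eq_square flip: \<rho>(2))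
      then show "((\<lambda>x. cos (\<rho> * of_real x)) has_vector_derivative (q0 x - lam) * (1 / \<rho> * sin (\<rho> * of_real x))) (at x within {0..1})"
        using has_vector_derivative_cos_mult[of \<rho> x] by simp
    qed
    from classical_solution_unique[OF contq this sl_S_classical_solution(1)[OF contq], of 1]
    show ?thesis using sl_S_classical_solution(2,3)[OF contq] \<rho> by (simp add: csinc_def \<rho>_def)
  qed
  show "(\<lambda>lam. cos (csqrt lam)) holomorphic_on UNIV" "(\<lambda>lam. csinc (csqrt lam)) holomorphic_on UNIV"
    using sl_S_holomorphic[OF contq] eq by simp_all
qed

lemma char_fun_holomorphic:
  "continuous_on {0..1} q \<Longrightarrow> char_fun q holomorphic_on UNIV"
  unfolding char_fun_def[abs_def] by (intro holomorphic_intros sl_S_holomorphic csqrt_trig_holomorphic)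

text \<open>The entire function \<open>sin 2\<rho> / \<rho>\<close> of \<open>\<lambda> = \<rho>\<^sup>2\<close>, whose value at \<open>0\<close> is \<open>2\<close>.\<close>

definition sin2_csqrt :: "complex \<Rightarrow> complex" where
  "sin2_csqrt lam = 2 * cos (csqrt lam) * csinc (csqrt lam)"

lemma sin2_csqrt_holomorphic: "sin2_csqrt holomorphic_on UNIV"
  unfolding sin2_csqrt_def[abs_def] by (intro holomorphic_intros csqrt_trig_holomorphic)

lemma sin2_csqrt_eq: "lam \<noteq> 0 \<Longrightarrow> sin2_csqrt lam = sin (2 * csqrt lam) / csqrt lam"
  by (simp add: sin2_csqrt_def csinc_def sin_double)

lemma sin2_csqrt_eq_0_iff: "sin2_csqrt lam = 0 \<longleftrightarrow> (\<exists>m::nat\<ge>1. lam = of_real ((pi * real m / 2)\<^sup>2))"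
proof (cases "lam = 0")
  case True
  then show ?thesis by (auto simp: sin2_csqrt_def csinc_def)
next
  case False
  show ?thesis
  proof
    assume "sin2_csqrt lam = 0"
    then have "sin (2 * csqrt lam) = 0" using False by (simp add: sin2_csqrt_eq)
    then obtain n :: int where n: "2 * csqrt lam = of_real (n * pi)" unfolding sin_eq_0 by blast
    then have c: "csqrt lam = of_real (pi * real_of_int n / 2)" by (simp add: field_simps)
    have "lam = (csqrt lam)\<^sup>2" by simp
    also have "\<dots> = of_real ((pi * real (nat \<bar>n\<bar>) / 2)\<^sup>2)" unfolding c by (simp add: power_divide power_mult_distrib)
    finally have "lam = of_real ((pi * real (nat \<bar>n\<bar>) / 2)\<^sup>2)" .
    moreover from this False have "nat \<bar>n\<bar> \<ge> 1" by (cases "n = 0") auto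
    ultimately show "\<exists>m::nat\<ge>1. lam = of_real ((pi * real m / 2)\<^sup>2)" by blast
  next
    assume "\<exists>m::nat\<ge>1. lam = of_real ((pi * real m / 2)\<^sup>2)"
    then obtain m :: nat where m: "lam = of_real ((pi * real m / 2)\<^sup>2)" by blast
    have "csqrt lam = of_real (pi * real m / 2)"
      unfolding m of_real_power by (rule csqrt_square) (auto simp del: of_real_mult of_real_divide)
    then have "2 * csqrt lam = of_real (of_int (int m) * pi)" by (simp add: mult.commute)
    then have "sin (2 * csqrt lam) = 0" unfolding sin_eq_0 by blast
    then show "sin2_csqrt lam = 0" using False by (simp add: sin2_csqrt_eq)
  qed
qed

lemma zorder_sin2_csqrt:
  assumes "m \<ge> 1"
  shows "zorder sin2_csqrt (of_real ((pi * real m / 2)\<^sup>2)) = 1"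
proof -
  define lam where "lam = complex_of_real ((pi * real m / 2)\<^sup>2)"
  define \<rho> where "\<rho> = csqrt lam"
  have pos: "(pi * real m / 2)\<^sup>2 > 0" using assms by simp
  have nonpos: "lam \<notin> \<real>\<^sub>\<le>\<^sub>0" using pos by (auto simp: lam_def complex_nonpos_Reals_iff)
  have zero: "sin2_csqrt lam = 0" unfolding sin2_csqrt_eq_0_iff lam_def using assms by blast
  have "\<rho> \<noteq> 0" using pos by (auto simp: \<rho>_def lam_def)
  have "lam \<noteq> 0" using \<open>\<rho> \<noteq> 0\<close> by (auto simp: \<rho>_def)
  have sin0: "sin (2 * \<rho>) = 0" using zero \<open>\<rho> \<noteq> 0\<close> \<open>lam \<noteq> 0\<close> by (simp add: sin2_csqrt_eq \<rho>_def)
  have "(cos (2 * \<rho>))\<^sup>2 = 1" using sin_cos_squared_add[of "2 * \<rho>"] sin0 by simp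
  then have cos0: "cos (2 * \<rho>) \<noteq> 0" by auto
  have "((\<lambda>z. sin (2 * csqrt z) / csqrt z) has_field_derivative cos (2 * \<rho>) / \<rho>\<^sup>2) (at lam)"
  proof -
    have "((\<lambda>z. sin (2 * csqrt z) / csqrt z) has_field_derivative
       ((cos (2 * \<rho>) * (2 * (1 / (2 * \<rho>)))) * \<rho> - sin (2 * \<rho>) * (1 / (2 * \<rho>))) / (\<rho> * \<rho>)) (at lam)"
      unfolding \<rho>_def
      by (rule derivative_eq_intros refl nonpos | use \<open>\<rho> \<noteq> 0\<close> in \<open>simp add: \<rho>_def\<close>)+
    then show ?thesis using \<open>\<rho> \<noteq> 0\<close> by (simp add: sin0 power2_eq_square)
  qed
  then have "(sin2_csqrt has_field_derivative cos (2 * \<rho>) / \<rho>\<^sup>2) (at lam)"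
    by (rule has_field_derivative_transform_within_open[where S = "- {0}"])
      (use \<open>lam \<noteq> 0\<close> in \<open>auto simp: sin2_csqrt_eq\<close>)
  then have "deriv sin2_csqrt lam \<noteq> 0" using cos0 \<open>\<rho> \<noteq> 0\<close> by (simp add: DERIV_imp_deriv)
  then have "zorder sin2_csqrt lam = 1"
    using zero analytic_on_holomorphic sin2_csqrt_holomorphic
    by (intro zorder_zero_eqI') (auto simp: analytic_at intro!: exI[of _ UNIV])
  then show ?thesis by (simp add: lam_def)
qed

lemma rouche_circle:
  fixes f g :: "complex \<Rightarrow> complex"
  assumes f: "f holomorphic_on UNIV" and g: "g holomorphic_on UNIV" and "r > 0"
    and less: "\<And>z. norm z = r \<Longrightarrow> norm (f z - g z) < norm (g z)"
  shows "finite {p. f p = 0 \<and> norm p < r}"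
    and "(\<Sum>p\<in>{p. f p = 0 \<and> norm p < r}. zorder f p) = (\<Sum>p\<in>{p. g p = 0 \<and> norm p < r}. zorder g p)"
proof -
  define s where "s = ball (0::complex) (r + 1)"
  have fin: "finite {p \<in> s. h p = 0}" if h: "h holomorphic_on UNIV" and nz: "h (of_real r) \<noteq> 0" for h :: "complex \<Rightarrow> complex"
  proof (cases "h constant_on UNIV")
    case True
    then have "h p \<noteq> 0" for p using nz by (auto simp: constant_on_def)
    then show ?thesis by simp
  next
    case False
    have "finite {p \<in> cball 0 (r + 1). h p = 0}"
      by (rule holomorphic_compact_finite_zeros[OF h _ _ _ _ False]) auto
    then show ?thesis by (rule rev_finite_subset) (auto simp: s_def)
  qed
  have "norm (complex_of_real r) = r" using \<open>r > 0\<close> by simp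
  from less[OF this] have nz: "f (of_real r) \<noteq> 0" "g (of_real r) \<noteq> 0" by auto
  define \<gamma> where "\<gamma> = circlepath (0::complex) r"
  have img: "path_image \<gamma> = sphere 0 r" using \<open>r > 0\<close> by (simp add: \<gamma>_def)
  have out: "winding_number \<gamma> z = 0" if "norm z > r" for z
  proof (rule winding_number_zero_outside)
    show "path_image \<gamma> \<subseteq> cball 0 r" unfolding img by auto
  qed (use that in \<open>auto simp: \<gamma>_def\<close>)
  have inn: "winding_number \<gamma> z = 1" if "norm z < r" for z
    unfolding \<gamma>_def using that by (intro winding_number_circlepath) auto
  have cmp: "(\<Sum>p\<in>{p \<in> s. h p = 0}. winding_number \<gamma> p * zorder h p) = of_int (\<Sum>p\<in>{p. h p = 0 \<and> norm p < r}. zorder h p)"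
    if h: "h holomorphic_on UNIV" and nz: "\<And>p. norm p = r \<Longrightarrow> h p \<noteq> 0" "finite {p \<in> s. h p = 0}" for h
  proof -
    have "of_int (\<Sum>p\<in>{p. h p = 0 \<and> norm p < r}. zorder h p) = (\<Sum>p\<in>{p. h p = 0 \<and> norm p < r}. winding_number \<gamma> p * zorder h p)"
      by (simp add: inn)
    also have "\<dots> = (\<Sum>p\<in>{p \<in> s. h p = 0}. winding_number \<gamma> p * zorder h p)"
    proof (rule sum.mono_neutral_left)
      show "\<forall>p\<in>{p \<in> s. h p = 0} - {p. h p = 0 \<and> norm p < r}. winding_number \<gamma> p * zorder h p = 0"
      proof
        fix p assume "p \<in> {p \<in> s. h p = 0} - {p. h p = 0 \<and> norm p < r}"
        then have "norm p > r" using nz(1)[of p] by force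
        then show "winding_number \<gamma> p * zorder h p = 0" using out by simp
      qed
    qed (use nz in \<open>auto simp: s_def\<close>)
    finally show ?thesis by simp
  qed
  have nzf: "f p \<noteq> 0" "g p \<noteq> 0" if "norm p = r" for p using less[OF that] by auto
  note finf = fin[OF f nz(1)] and fing = fin[OF g nz(2)]
  show "finite {p. f p = 0 \<and> norm p < r}" using finf by (rule rev_finite_subset) (auto simp: s_def)
  have fg: "(\<lambda>p. g p + (f p - g p)) = f" by auto
  have "(\<Sum>p\<in>{p \<in> s. g p + (f p - g p) = 0}. winding_number \<gamma> p * zorder (\<lambda>p. g p + (f p - g p)) p)
      = (\<Sum>p\<in>{p \<in> s. g p = 0}. winding_number \<gamma> p * zorder g p)"
  proof (rule Rouche_theorem)
    show "\<forall>z\<in>path_image \<gamma>. cmod (f z - g z) < cmod (g z)" using less unfolding img by auto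
    show "\<forall>z. z \<notin> s \<longrightarrow> winding_number \<gamma> z = 0" using out by (auto simp: s_def)
    show "path_image \<gamma> \<subseteq> s" unfolding img by (auto simp: s_def)
  qed (use finf fing in \<open>auto simp: s_def \<gamma>_def intro!: holomorphic_intros holomorphic_on_subset[OF f] holomorphic_on_subset[OF g]\<close>)
  then have "(\<Sum>p\<in>{p \<in> s. f p = 0}. winding_number \<gamma> p * zorder f p) = (\<Sum>p\<in>{p \<in> s. g p = 0}. winding_number \<gamma> p * zorder g p)"
    unfolding fg by simp
  then have "of_int (\<Sum>p\<in>{p. f p = 0 \<and> norm p < r}. zorder f p)
      = (of_int (\<Sum>p\<in>{p. g p = 0 \<and> norm p < r}. zorder g p) :: complex)"
    using cmp[OF f nzf(1) finf] cmp[OF g nzf(2) fing] by simp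
  then show "(\<Sum>p\<in>{p. f p = 0 \<and> norm p < r}. zorder f p) = (\<Sum>p\<in>{p. g p = 0 \<and> norm p < r}. zorder g p)"
    by (simp only: of_int_eq_iff)
qed

text \<open>On the circle of this radius \<open>2|\<rho>| = \<pi>(N + 1/2)\<close>, so \<open>2\<rho>\<close> stays at distance at least \<open>\<pi>/2\<close> from the zeros of
  the sine.\<close>

definition circle_radius :: "nat \<Rightarrow> real" where
  "circle_radius N = (pi * (real N / 2 + 1 / 4))\<^sup>2"

lemma sum_zorder_sin2_csqrt:
  "(\<Sum>p\<in>{p. sin2_csqrt p = 0 \<and> norm p < circle_radius N}. zorder sin2_csqrt p) = int N"
proof -
  have lt: "(pi * real m / 2)\<^sup>2 < circle_radius N \<longleftrightarrow> m \<le> N" for m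
  proof -
    have "(pi * real m / 2)\<^sup>2 < circle_radius N \<longleftrightarrow> pi * real m / 2 < pi * (real N / 2 + 1 / 4)"
      unfolding circle_radius_def not_le[symmetric] by (subst power_mono_iff) auto
    also have "\<dots> \<longleftrightarrow> pi * (real m / 2) < pi * (real N / 2 + 1 / 4)" by simp
    also have "\<dots> \<longleftrightarrow> real m / 2 < real N / 2 + 1 / 4" by (rule mult_less_cancel_left_pos) simp
    also have "\<dots> \<longleftrightarrow> m \<le> N" by linarith
    finally show ?thesis .
  qed
  have set: "{p. sin2_csqrt p = 0 \<and> norm p < circle_radius N} = (\<lambda>m. of_real ((pi * real m / 2)\<^sup>2)) ` {1..N}"
    unfolding sin2_csqrt_eq_0_iff using lt by (auto simp del: of_real_power)
  have "inj_on (\<lambda>m. complex_of_real ((pi * real m / 2)\<^sup>2)) {1..N}"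
    by (rule inj_onI) (simp only: of_real_eq_iff, simp)
  then have "(\<Sum>p\<in>{p. sin2_csqrt p = 0 \<and> norm p < circle_radius N}. zorder sin2_csqrt p)
      = (\<Sum>m\<in>{1..N}. zorder sin2_csqrt (of_real ((pi * real m / 2)\<^sup>2)))"
    unfolding set by (simp only: sum.reindex o_def)
  also have "\<dots> = (\<Sum>m\<in>{1..N}. 1)" by (intro sum.cong refl zorder_sin2_csqrt) auto
  finally show ?thesis by simp
qed

lemma nearest_multiple_of_pi:
  assumes "x \<ge> 0"
  obtains m :: nat where "\<bar>x - pi * real m\<bar> \<le> pi / 2"
proof
  define n where "n = round (x / pi)"
  have "n \<ge> 0" unfolding n_def using assms by (simp add: round_def)
  have "\<bar>x / pi - of_int n\<bar> \<le> 1 / 2" using of_int_round_abs_le[of "x / pi"] by (simp add: n_def abs_minus_commute)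
  then have "pi * \<bar>x / pi - of_int n\<bar> \<le> pi * (1 / 2)" by (intro mult_left_mono) auto
  also have "pi * \<bar>x / pi - of_int n\<bar> = \<bar>pi * (x / pi - of_int n)\<bar>" by (simp add: abs_mult)
  also have "pi * (x / pi - of_int n) = x - pi * real (nat n)" using \<open>n \<ge> 0\<close> by (simp add: right_diff_distrib)
  finally show "\<bar>x - pi * real (nat n)\<bar> \<le> pi / 2" by simp
qed

section \<open>Enumeration of zeros by annuli\<close>

lemma eventually_nonzero_of_finite_zeros:
  fixes f :: "complex \<Rightarrow> complex"
  assumes fin: "finite {p. f p = 0 \<and> norm p < r}" and z: "norm z < r"
  shows "eventually (\<lambda>p. f p \<noteq> 0) (at z)"
proof -
  have "eventually (\<lambda>p. p \<notin> {p. f p = 0 \<and> norm p < r}) (at z)"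
    using islimpt_finite[OF fin, of z] unfolding islimpt_iff_eventually by blast
  moreover have "eventually (\<lambda>p. p \<in> ball 0 r) (at z)"
    using z by (intro eventually_at_in_open') auto
  ultimately show ?thesis by eventually_elim auto
qed

text \<open>Finitely many zeros in one disc already rule out \<open>f = 0\<close>, for which \<open>zorder\<close> has no meaning.\<close>

lemma zorder_pos_of_finite_zeros:
  assumes f: "f holomorphic_on UNIV" and fin: "finite {p. f p = 0 \<and> norm p < r}"
    and z: "f z = 0" "norm z < r"
  shows "zorder f z > 0"
proof -
  have "frequently (\<lambda>p. f p \<noteq> 0) (at z)"
    using eventually_nonzero_of_finite_zeros[OF fin z(2)] by (rule eventually_frequently[rotated]) simp
  then show ?thesis using zorder_pos_iff[OF f, of z] z by simp
qed

text \<open>Zeros are replaced by pairs \<open>(p, i)\<close> with \<open>i\<close> below the multiplicity of \<open>p\<close>, so that counting with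
  multiplicity becomes counting. The \<open>N0 - 1\<close> pairs in the disc of radius \<open>r N0\<close> are numbered from \<open>2\<close> to \<open>N0\<close>
  arbitrarily; each later disc contains exactly one new pair, which receives the index of
  that disc.\<close>

theorem enumerate_zeros_by_annuli:
  fixes f :: "complex \<Rightarrow> complex" and r :: "nat \<Rightarrow> real" and N0 :: nat
  assumes f: "f holomorphic_on UNIV" and mono: "mono r" and unbounded: "\<And>x. \<exists>N. x < r N"
    and "N0 \<ge> 1"
    and fin: "\<And>N. N \<ge> N0 \<Longrightarrow> finite {p. f p = 0 \<and> norm p < r N}"
    and count: "\<And>N. N \<ge> N0 \<Longrightarrow> (\<Sum>p\<in>{p. f p = 0 \<and> norm p < r N}. zorder f p) = int N - 1"
  obtains ev where "enumerates_zeros f {2..} ev" "\<And>k. k > N0 \<Longrightarrow> r (k - 1) \<le> norm (ev k) \<and> norm (ev k) < r k"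
proof -
  define mult where "mult p = nat (zorder f p)" for p
  define P where "P = {pi :: complex \<times> nat. f (fst pi) = 0 \<and> snd pi < mult (fst pi)}"
  define PN where "PN N = {pi \<in> P. norm (fst pi) < r N}" for N
  have far: "\<exists>N\<ge>N0. x < r N" for x
  proof -
    obtain N where "x < r N" using unbounded by blast
    then have "x < r (max N N0)" using monoD[OF mono, of N "max N N0"] by simp
    then show ?thesis by (intro exI[of _ "max N N0"]) simp
  qed
  have pos: "zorder f p > 0" if "f p = 0" for p
    using far[of "norm p"] zorder_pos_of_finite_zeros[OF f fin] that by blast
  have PN_Sigma: "PN N = Sigma {p. f p = 0 \<and> norm p < r N} (\<lambda>p. {..<mult p})" for N
    by (auto simp: PN_def P_def)
  have finPN: "finite (PN N)" if "N \<ge> N0" for N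
    unfolding PN_Sigma using fin[OF that] by (intro finite_SigmaI) auto
  have cardPN: "card (PN N) = N - 1" if "N \<ge> N0" for N
  proof -
    have "int (card (PN N)) = (\<Sum>p\<in>{p. f p = 0 \<and> norm p < r N}. int (mult p))"
      unfolding PN_Sigma using fin[OF that] by (subst card_SigmaI) auto
    also have "\<dots> = (\<Sum>p\<in>{p. f p = 0 \<and> norm p < r N}. zorder f p)"
      using pos by (intro sum.cong refl) (auto simp: mult_def less_imp_le)
    also have "\<dots> = int N - 1" by (rule count[OF that])
    finally show ?thesis by simp
  qed
  have PN_mono: "PN M \<subseteq> PN N" if "M \<le> N" for M N
    using monoD[OF mono that] by (auto simp: PN_def)
  have "\<exists>h. bij_betw h {2..N0} (PN N0)"
    using finPN[of N0] cardPN[of N0] by (intro finite_same_card_bij) auto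
  then obtain e0 where e0: "bij_betw e0 {2..N0} (PN N0)" by blast
  have "\<exists>d. PN (Suc N) - PN N = {d}" if "N \<ge> N0" for N
  proof -
    have "card (PN (Suc N) - PN N) = card (PN (Suc N)) - card (PN N)"
      using that by (intro card_Diff_subset finPN PN_mono) auto
    then have "card (PN (Suc N) - PN N) = 1"
      using that \<open>N0 \<ge> 1\<close> cardPN[of N] cardPN[of "Suc N"] by simp
    then show ?thesis by (simp add: card_1_singleton_iff)
  qed
  then obtain d where d: "\<And>N. N \<ge> N0 \<Longrightarrow> PN (Suc N) - PN N = {d N}" by metis
  define e where "e k = (if k \<le> N0 then e0 k else d (k - 1))" for k
  have bijN: "bij_betw e {2..N} (PN N)" if "N \<ge> N0" for N
    using that
  proof (induction N rule: dec_induct)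
    case base
    then show ?case using e0 by (subst bij_betw_cong[of _ e e0]) (auto simp: e_def)
  next
    case (step N)
    have eS: "e (Suc N) = d N" using step by (simp add: e_def)
    have "PN (Suc N) = PN N \<union> {e (Suc N)}" "e (Suc N) \<notin> PN N"
      using d[OF step(1)] PN_mono[of N "Suc N"] unfolding eS by auto
    moreover have "{2..Suc N} = {2..N} \<union> {Suc N}" using step \<open>N0 \<ge> 1\<close> by auto
    ultimately show ?case using notIn_Un_bij_betw[of "Suc N" "{2..N}" e "PN N"] step by simp
  qed
  have bij: "bij_betw e {2..} P"
  proof (rule bij_betw_imageI)
    show "inj_on e {2..}"
    proof (rule inj_onI)
      fix j k assume jk: "j \<in> {2..}" "k \<in> {2..}" "e j = e k"
      have "inj_on e {2..max N0 (max j k)}" using bijN[of "max N0 (max j k)"] by (simp add: bij_betw_def)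
      then show "j = k" using jk by (auto dest: inj_onD)
    qed
    show "e ` {2..} = P"
    proof (intro equalityI subsetI)
      fix x assume "x \<in> e ` {2..}"
      then obtain k where "k \<ge> 2" "x = e k" by auto
      then have "x \<in> e ` {2..max N0 k}" by auto
      then show "x \<in> P" using bijN[of "max N0 k"] by (auto simp: bij_betw_def PN_def)
    next
      fix x assume "x \<in> P"
      then obtain N where "N \<ge> N0" "x \<in> PN N" using far[of "norm (fst x)"] by (auto simp: PN_def)
      then have "x \<in> e ` {2..N}" using bijN[of N] by (simp add: bij_betw_def)
      then show "x \<in> e ` {2..}" by auto
    qed
  qed
  define ev where "ev k = fst (e k)" for k
  have "enumerates_zeros f {2..} ev"
    unfolding enumerates_zeros_def
  proof (intro conjI allI impI)
    have "ev ` {2..} = fst ` P" using bij by (simp add: bij_betw_def ev_def image_image[symmetric])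
    also have "\<dots> = {z. f z = 0}"
    proof (intro equalityI subsetI)
      fix z assume "z \<in> {z. f z = 0}"
      then have "(z, 0) \<in> P" using pos by (simp add: P_def mult_def)
      then show "z \<in> fst ` P" by force
    qed (auto simp: P_def)
    finally show "{z. f z = 0} = ev ` {2..}" by simp
    fix z assume z: "f z = 0"
    define Kz where "Kz = {k \<in> {2..}. ev k = z}"
    have "bij_betw e Kz ({z} \<times> {..<mult z})"
    proof (rule bij_betw_imageI)
      show "inj_on e Kz" using bij by (auto simp: bij_betw_def Kz_def intro: inj_on_subset)
      have "e ` Kz = {x \<in> e ` {2..}. fst x = z}" by (auto simp: Kz_def ev_def)
      also have "\<dots> = {x \<in> P. fst x = z}" using bij by (simp add: bij_betw_def)
      also have "\<dots> = {z} \<times> {..<mult z}" using z by (auto simp: P_def)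
      finally show "e ` Kz = {z} \<times> {..<mult z}" .
    qed
    then have "finite Kz" "card Kz = mult z"
      using bij_betw_finite bij_betw_same_card by fastforce+
    then show "finite {k \<in> {2..}. ev k = z}" "int (card {k \<in> {2..}. ev k = z}) = zorder f z"
      using pos[OF z] by (simp_all add: Kz_def mult_def)
  qed
  moreover have "r (k - 1) \<le> norm (ev k) \<and> norm (ev k) < r k" if "k > N0" for k
  proof -
    have "k - 1 \<ge> N0" "Suc (k - 1) = k" using that by auto
    then have "e k \<in> PN k - PN (k - 1)" using d[of "k - 1"] that by (simp add: e_def)
    then show ?thesis by (auto simp: PN_def ev_def)
  qed
  ultimately show ?thesis using that by blast
qed

section \<open>Location, number and asymptotics of the eigenvalues\<close>

context weak_deriv_L2
begin

text \<open>The two error terms of \<open>char_fun_asymptotics\<close> are each made at most \<open>\<eta>/2\<close> times the exponential.\<close>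

lemma char_fun_close_to_sin:
  assumes mean0: "integral {0..1} q = 0" and "\<eta> > 0"
  obtains R where "R \<ge> 1" "\<And>\<rho>. Re \<rho> \<ge> 0 \<Longrightarrow> norm \<rho> \<ge> R \<Longrightarrow>
    norm (4 * \<rho> ^ 3 * char_fun q (\<rho>\<^sup>2) - q 1 * sin (2 * \<rho>)) \<le> \<eta> * exp (2 * \<bar>Im \<rho>\<bar>)"
proof -
  obtain C R1 where C: "C \<ge> 0" "R1 \<ge> 1"
    "\<And>\<rho>. norm \<rho> \<ge> R1 \<Longrightarrow> norm (4 * \<rho> ^ 3 * char_fun q (\<rho>\<^sup>2) - q 1 * sin (2 * \<rho>))
        \<le> norm (deriv_sin_transform q (2 * \<rho>)) + C * exp (2 * \<bar>Im \<rho>\<bar>) / norm \<rho>"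
    using char_fun_asymptotics[OF mean0] by blast
  obtain R2 where R2: "\<And>z. Re z \<ge> 0 \<Longrightarrow> norm z \<ge> R2 \<Longrightarrow> norm (deriv_sin_transform q z) \<le> \<eta> / 2 * exp \<bar>Im z\<bar>"
    using deriv_sin_transform_riemann_lebesgue[of "\<eta> / 2"] \<open>\<eta> > 0\<close> by auto
  show ?thesis
  proof (rule that[of "max R1 (max R2 (2 * C / \<eta>))"])
    fix \<rho> :: complex assume \<rho>: "Re \<rho> \<ge> 0" "norm \<rho> \<ge> max R1 (max R2 (2 * C / \<eta>))"
    then have r: "norm \<rho> \<ge> R1" "norm \<rho> \<ge> R2" "norm \<rho> \<ge> 2 * C / \<eta>" "norm \<rho> > 0" using C by auto
    have "norm (2 * \<rho>) = 2 * norm \<rho>" by (simp add: norm_mult)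
    then have "norm (2 * \<rho>) \<ge> R2" using r(2,4) by linarith
    then have "norm (deriv_sin_transform q (2 * \<rho>)) \<le> \<eta> / 2 * exp (2 * \<bar>Im \<rho>\<bar>)"
      using R2[of "2 * \<rho>"] \<rho>(1) by (simp add: abs_mult)
    moreover have "C / norm \<rho> \<le> \<eta> / 2" using r \<open>\<eta> > 0\<close> by (simp add: field_simps)
    then have "C / norm \<rho> * exp (2 * \<bar>Im \<rho>\<bar>) \<le> \<eta> / 2 * exp (2 * \<bar>Im \<rho>\<bar>)" by (intro mult_right_mono) auto
    then have "C * exp (2 * \<bar>Im \<rho>\<bar>) / norm \<rho> \<le> \<eta> / 2 * exp (2 * \<bar>Im \<rho>\<bar>)" by simp
    moreover have "\<eta> * exp (2 * \<bar>Im \<rho>\<bar>) = \<eta> / 2 * exp (2 * \<bar>Im \<rho>\<bar>) + \<eta> / 2 * exp (2 * \<bar>Im \<rho>\<bar>)" by simp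
    ultimately show "norm (4 * \<rho> ^ 3 * char_fun q (\<rho>\<^sup>2) - q 1 * sin (2 * \<rho>)) \<le> \<eta> * exp (2 * \<bar>Im \<rho>\<bar>)"
      using C(3)[OF r(1)] by linarith
  qed (use C in auto)
qed

text \<open>The argument runs twice: the Riemann-Lebesgue bound first places \<open>2\<rho>\<close> within \<open>1/2\<close> of some
  \<open>\<pi>m\<close>, after which the sharper local bound becomes available there.\<close>

theorem zero_localisation:
  assumes mean0: "integral {0..1} q = 0" and q1: "q 1 \<noteq> 0"
  obtains C R where "C \<ge> 0" "R \<ge> 1" "\<And>\<rho>. Re \<rho> \<ge> 0 \<Longrightarrow> norm \<rho> \<ge> R \<Longrightarrow> char_fun q (\<rho>\<^sup>2) = 0 \<Longrightarrow>
    \<exists>m. norm (2 * \<rho> - of_real (pi * real m)) \<le> 1 / 2 \<and>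
        norm (2 * \<rho> - of_real (pi * real m)) \<le> C * (fourier_size m + 1 / norm \<rho>)"
proof -
  obtain C1 R1 where C1: "C1 \<ge> 0" "R1 \<ge> 1"
    "\<And>\<rho>. norm \<rho> \<ge> R1 \<Longrightarrow> norm (4 * \<rho> ^ 3 * char_fun q (\<rho>\<^sup>2) - q 1 * sin (2 * \<rho>))
        \<le> norm (deriv_sin_transform q (2 * \<rho>)) + C1 * exp (2 * \<bar>Im \<rho>\<bar>) / norm \<rho>"
    using char_fun_asymptotics[OF mean0] by blast
  define a where "a = norm (q 1)"
  have "a > 0" using q1 by (simp add: a_def)
  then obtain R2 where R2: "R2 \<ge> 1" "\<And>\<rho>. Re \<rho> \<ge> 0 \<Longrightarrow> norm \<rho> \<ge> R2 \<Longrightarrow>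
    norm (4 * \<rho> ^ 3 * char_fun q (\<rho>\<^sup>2) - q 1 * sin (2 * \<rho>)) \<le> a / 16 * exp (2 * \<bar>Im \<rho>\<bar>)"
    using char_fun_close_to_sin[OF mean0, of "a / 16"] by auto
  define C0 where "C0 = (1 + 1 / 2) * exp (1 / 2) + C1"
  define C where "C = 8 / a * C0"
  have "C0 \<ge> 0" using C1 by (auto simp: C0_def)
  then have "C \<ge> 0" using \<open>a > 0\<close> by (simp add: C_def)
  show ?thesis
  proof (rule that[OF \<open>C \<ge> 0\<close>, of "max R1 R2"])
    fix \<rho> :: complex assume \<rho>: "Re \<rho> \<ge> 0" "norm \<rho> \<ge> max R1 R2" "char_fun q (\<rho>\<^sup>2) = 0"
    define E where "E = exp (2 * \<bar>Im \<rho>\<bar>)"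
    have "E \<ge> 1" by (simp add: E_def)
    have "Re (2 * \<rho>) \<ge> 0" using \<rho>(1) by simp
    then obtain m where m: "\<bar>Re (2 * \<rho>) - pi * real m\<bar> \<le> pi / 2" using nearest_multiple_of_pi by blast
    define d where "d = norm (2 * \<rho> - of_real (pi * real m))"
    have low: "a * (1 / 8 * E * min 1 d) \<le> norm (q 1 * sin (2 * \<rho>))"
      using mult_left_mono[OF norm_sin_ge[OF m], of a] \<open>a > 0\<close>
      by (simp add: norm_mult E_def d_def a_def abs_mult)
    have "norm (q 1 * sin (2 * \<rho>)) \<le> a / 16 * E"
      using R2(2)[OF \<rho>(1)] \<rho>(2,3) by (simp add: E_def)
    with low have "(a * E) * (min 1 d) \<le> (a * E) * (1 / 2)" by simp
    then have "min 1 d \<le> 1 / 2"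
      using \<open>a > 0\<close> \<open>E \<ge> 1\<close> by (subst (asm) mult_le_cancel_left_pos) auto
    then have d: "d \<le> 1 / 2" "min 1 d = d" by (auto simp: min_def split: if_splits)
    have "norm (deriv_sin_transform q (2 * \<rho>)) \<le> (1 + 1 / 2) * exp (1 / 2) * fourier_size m"
      using d(1) unfolding d_def by (rule deriv_sin_transform_local_bound)
    also have "\<dots> \<le> (1 + 1 / 2) * exp (1 / 2) * fourier_size m * E"
      using mult_left_mono[OF \<open>E \<ge> 1\<close>, of "(1 + 1 / 2) * exp (1 / 2) * fourier_size m"]
        fourier_size_nonneg[of m] by simp
    finally have "norm (q 1 * sin (2 * \<rho>)) \<le> (1 + 1 / 2) * exp (1 / 2) * fourier_size m * E + C1 * E / norm \<rho>"
      using C1(3)[of \<rho>] \<rho>(2,3) by (simp add: E_def)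
    also have "\<dots> \<le> C0 * fourier_size m * E + C0 * E / norm \<rho>"
      using fourier_size_nonneg[of m] \<open>E \<ge> 1\<close> C1(1)
      by (intro add_mono mult_right_mono divide_right_mono) (auto simp: C0_def)
    also have "\<dots> = C0 * (fourier_size m + 1 / norm \<rho>) * E" by (simp add: algebra_simps)
    finally have upper: "a * (1 / 8 * E * d) \<le> C0 * (fourier_size m + 1 / norm \<rho>) * E"
      using low unfolding d(2) by linarith
    have "d \<le> C * (fourier_size m + 1 / norm \<rho>)"
    proof -
      from upper have "(a / 8 * d) * E \<le> (C0 * (fourier_size m + 1 / norm \<rho>)) * E" by (simp add: mult_ac)
      then have "a / 8 * d \<le> C0 * (fourier_size m + 1 / norm \<rho>)"
        using \<open>E \<ge> 1\<close> by (subst (asm) mult_le_cancel_right_pos) auto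
      then have "8 / a * (a / 8 * d) \<le> 8 / a * (C0 * (fourier_size m + 1 / norm \<rho>))"
        using \<open>a > 0\<close> by (intro mult_left_mono) auto
      then show ?thesis using \<open>a > 0\<close> by (simp add: C_def mult.assoc)
    qed
    then show "\<exists>m. norm (2 * \<rho> - of_real (pi * real m)) \<le> 1 / 2 \<and>
        norm (2 * \<rho> - of_real (pi * real m)) \<le> C * (fourier_size m + 1 / norm \<rho>)"
      using d(1) unfolding d_def by blast
  qed (use C1 in auto)
qed

text \<open>On the circles \<open>|sin 2\<rho>| \<ge> exp (2 |Im \<rho>|) / 8\<close>, whereas \<open>4\<rho>\<^sup>3 \<Delta> / q(1)\<close> differs from \<open>sin 2\<rho>\<close> by
  at most half of that; dividing by \<open>\<rho>\<close> gives the hypothesis of Rouche's theorem.\<close>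

theorem count_zeros:
  assumes mean0: "integral {0..1} q = 0" and q1: "q 1 \<noteq> 0"
  obtains N0 :: nat where "N0 \<ge> 1"
    "\<And>N. N \<ge> N0 \<Longrightarrow> finite {p. char_fun q p = 0 \<and> norm p < circle_radius N}"
    "\<And>N. N \<ge> N0 \<Longrightarrow> (\<Sum>p\<in>{p. char_fun q p = 0 \<and> norm p < circle_radius N}. zorder (char_fun q) p) = int N - 1"
proof -
  define a where "a = norm (q 1)"
  have "a > 0" using q1 by (simp add: a_def)
  then obtain R where R: "R \<ge> 1" "\<And>\<rho>. Re \<rho> \<ge> 0 \<Longrightarrow> norm \<rho> \<ge> R \<Longrightarrow>
    norm (4 * \<rho> ^ 3 * char_fun q (\<rho>\<^sup>2) - q 1 * sin (2 * \<rho>)) \<le> a / 16 * exp (2 * \<bar>Im \<rho>\<bar>)"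
    using char_fun_close_to_sin[OF mean0, of "a / 16"] by auto
  define N0 where "N0 = nat \<lceil>R\<rceil> + 1"
  define H where "H lam = 4 / q 1 * (lam * char_fun q lam)" for lam
  have D: "char_fun q holomorphic_on UNIV" by (rule char_fun_holomorphic[OF cont])
  have H: "H holomorphic_on UNIV" unfolding H_def by (intro holomorphic_intros D)
  have less: "norm (H z - sin2_csqrt z) < norm (sin2_csqrt z)" if N: "N \<ge> N0" and z: "norm z = circle_radius N" for N z
  proof -
    define \<rho> where "\<rho> = csqrt z"
    have \<rho>2: "\<rho>\<^sup>2 = z" by (simp add: \<rho>_def)
    have "(norm \<rho>)\<^sup>2 = (pi * (real N / 2 + 1 / 4))\<^sup>2"
      using z by (simp add: norm_power[symmetric] \<rho>2 circle_radius_def)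
    then have n\<rho>: "norm \<rho> = pi * (real N / 2 + 1 / 4)"
      by (subst (asm) power2_eq_iff_nonneg) auto
    have "R \<le> real N" using N by (simp add: N0_def) linarith
    also have "\<dots> = 2 * (real N / 2)" by simp
    also have "\<dots> \<le> pi * (real N / 2 + 1 / 4)" using pi_gt3 by (intro mult_mono) auto
    finally have big: "norm \<rho> \<ge> R" using n\<rho> by simp
    then have "\<rho> \<noteq> 0" using R(1) by auto
    then have "z \<noteq> 0" using \<rho>2 by auto
    define E where "E = exp (2 * \<bar>Im \<rho>\<bar>)"
    have "E > 0" by (simp add: E_def)
    have "Re \<rho> \<ge> 0" unfolding \<rho>_def using Re_csqrt by simp
    then have "Re (2 * \<rho>) \<ge> 0" by simp
    then obtain m where m: "\<bar>Re (2 * \<rho>) - pi * real m\<bar> \<le> pi / 2" using nearest_multiple_of_pi by blast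
    have "norm (2 * \<rho> - of_real (pi * real m)) \<ge> 1"
    proof -
      have "norm (2 * \<rho>) - norm (of_real (pi * real m) :: complex) = pi * (real N + 1 / 2 - real m)"
        unfolding norm_of_real by (simp add: n\<rho> norm_mult algebra_simps)
      then have "\<bar>norm (2 * \<rho>) - norm (of_real (pi * real m) :: complex)\<bar> = pi * \<bar>real N + 1 / 2 - real m\<bar>"
        by (simp only: abs_mult) simp
      moreover have "\<bar>norm (2 * \<rho>) - norm (of_real (pi * real m) :: complex)\<bar> \<le> norm (2 * \<rho> - of_real (pi * real m))"
        by (rule norm_triangle_ineq3)
      moreover have "1 / 2 \<le> \<bar>real N + 1 / 2 - real m\<bar>"
        by (cases "m \<le> N") (auto simp: not_le abs_if dest!: Suc_leI of_nat_mono[where 'a = real])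
      then have "pi * (1 / 2) \<le> pi * \<bar>real N + 1 / 2 - real m\<bar>" by (intro mult_left_mono) auto
      ultimately show ?thesis using pi_gt3 by linarith
    qed
    then have "1 / 8 * E \<le> norm (sin (2 * \<rho>))"
      using norm_sin_ge[OF m] by (simp add: E_def abs_mult)
    moreover have "norm (4 * \<rho> ^ 3 * char_fun q z / q 1 - sin (2 * \<rho>)) \<le> 1 / 16 * E"
    proof -
      have "4 * \<rho> ^ 3 * char_fun q z / q 1 - sin (2 * \<rho>) = (4 * \<rho> ^ 3 * char_fun q z - q 1 * sin (2 * \<rho>)) / q 1"
        using q1 by (simp add: field_simps)
      also have "norm \<dots> \<le> (a / 16 * E) / a"
        unfolding norm_divide a_def[symmetric] using R(2)[OF \<open>Re \<rho> \<ge> 0\<close> big] \<open>a > 0\<close>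
        by (intro divide_right_mono) (auto simp: \<rho>2 E_def)
      finally show ?thesis using \<open>a > 0\<close> by simp
    qed
    ultimately have "norm (4 * \<rho> ^ 3 * char_fun q z / q 1 - sin (2 * \<rho>)) < norm (sin (2 * \<rho>))"
      using \<open>E > 0\<close> by linarith
    then have "norm (4 * \<rho> ^ 3 * char_fun q z / q 1 - sin (2 * \<rho>)) / norm \<rho> < norm (sin (2 * \<rho>)) / norm \<rho>"
      using \<open>\<rho> \<noteq> 0\<close> by (intro divide_strict_right_mono) auto
    moreover have s2: "sin2_csqrt z = sin (2 * \<rho>) / \<rho>" by (simp add: sin2_csqrt_eq[OF \<open>z \<noteq> 0\<close>] \<rho>_def)
    moreover have "H z = (4 * \<rho> ^ 3 * char_fun q z / q 1) / \<rho>"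
      using \<open>\<rho> \<noteq> 0\<close> by (simp add: H_def \<rho>2[symmetric] power2_eq_square power3_eq_cube)
    then have "H z - sin2_csqrt z = (4 * \<rho> ^ 3 * char_fun q z / q 1 - sin (2 * \<rho>)) / \<rho>"
      unfolding s2 by (simp only: diff_divide_distrib)
    ultimately show ?thesis by (simp add: norm_divide)
  qed
  have rpos: "circle_radius N > 0" for N
  proof -
    have "real N / 2 + 1 / 4 > 0" by (rule add_nonneg_pos) auto
    then show ?thesis by (simp add: circle_radius_def)
  qed
  have res: "finite {p. char_fun q p = 0 \<and> norm p < circle_radius N} \<and>
    (\<Sum>p\<in>{p. char_fun q p = 0 \<and> norm p < circle_radius N}. zorder (char_fun q) p) = int N - 1"
    if N: "N \<ge> N0" for N
  proof -
    define ZH where "ZH = {p. H p = 0 \<and> norm p < circle_radius N}"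
    define ZD where "ZD = {p. char_fun q p = 0 \<and> norm p < circle_radius N}"
    note rouche = rouche_circle[OF H sin2_csqrt_holomorphic rpos less[OF N]]
    have finH: "finite ZH" unfolding ZH_def by (rule rouche(1))
    have sumH: "(\<Sum>p\<in>ZH. zorder H p) = int N"
      unfolding ZH_def using trans[OF rouche(2) sum_zorder_sin2_csqrt] by simp
    \<comment> \<open>the factor \<open>\<lambda>\<close> in \<open>H\<close> adds one zero, at the origin, to those of \<open>\<Delta>\<close>\<close>
    have ZH: "ZH = insert 0 ZD" using q1 rpos[of N] by (auto simp: ZH_def ZD_def H_def)
    have finD: "finite ZD" using finH unfolding ZH by simp
    have analytic: "char_fun q analytic_on {p}" for p
      using D by (auto simp: analytic_at intro!: exI[of _ UNIV])
    have nz: "eventually (\<lambda>p. char_fun q p \<noteq> 0) (at p)" if "norm p < circle_radius N" for p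
      using eventually_nonzero_of_finite_zeros[OF _ that] finD unfolding ZD_def by blast
    have zH: "zorder H p = zorder (\<lambda>w. 4 / q 1 * w) p + zorder (char_fun q) p" if p: "norm p < circle_radius N" for p
    proof -
      have "H = (\<lambda>w. (4 / q 1 * w) * char_fun q w)" by (simp add: H_def fun_eq_iff)
      moreover have "eventually (\<lambda>w. w \<noteq> 0) (at p)" by (rule eventually_neq_at_within)
      then have "eventually (\<lambda>w. (4 / q 1 * w) * char_fun q w \<noteq> 0) (at p)"
        using nz[OF p] by eventually_elim (use q1 in auto)
      then have "zorder (\<lambda>w. (4 / q 1 * w) * char_fun q w) p = zorder (\<lambda>w. 4 / q 1 * w) p + zorder (char_fun q) p"
        by (intro zorder_times_analytic analytic analytic_intros)
      ultimately show ?thesis by simp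
    qed
    have z0: "zorder (\<lambda>w. 4 / q 1 * w) p = (if p = 0 then 1 else 0)" for p :: complex
    proof (cases "p = 0")
      case True
      then show ?thesis using q1 simple_zeroI[of UNIV 0 "\<lambda>w. 4 / q 1" "\<lambda>w. 4 / q 1 * w"] by simp
    next
      case False
      then show ?thesis using q1 by (auto intro!: zorder_eq_0I analytic_intros)
    qed
    have "(\<Sum>p\<in>ZH. zorder H p) = (\<Sum>p\<in>ZH. (if p = 0 then 1 else 0)) + (\<Sum>p\<in>ZH. zorder (char_fun q) p)"
      unfolding sum.distrib[symmetric]
    proof (intro sum.cong refl)
      fix p assume "p \<in> ZH"
      then have "norm p < circle_radius N" by (simp add: ZH_def)
      then show "zorder H p = (if p = 0 then 1 else 0) + zorder (char_fun q) p" by (simp only: zH z0)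
    qed
    also have "(\<Sum>p\<in>ZH. (if p = 0 then 1 else 0)) = (1 :: int)" using finH by (simp add: ZH)
    also have "(\<Sum>p\<in>ZH. zorder (char_fun q) p) = (\<Sum>p\<in>ZD. zorder (char_fun q) p)"
    proof (rule sum.mono_neutral_right[OF finH])
      show "\<forall>p\<in>ZH - ZD. zorder (char_fun q) p = 0"
        by (auto simp: ZH_def ZD_def intro!: zorder_eq_0I analytic)
    qed (auto simp: ZH)
    finally show ?thesis using sumH finD by (simp add: ZD_def)
  qed
  show ?thesis by (rule that[of N0]) (use res in \<open>auto simp: N0_def\<close>)
qed

end

theorem theorem3:
  fixes q :: "real \<Rightarrow> complex"
  assumes "W21_01 q"
    and "q 1 \<noteq> 0"
    and "integral {0..1} q = 0"
  shows "\<exists>(ev :: nat \<Rightarrow> complex) (\<kappa> :: nat \<Rightarrow> complex).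
           enumerates_zeros (char_fun q) {2..} ev \<and>
           (\<forall>k\<ge>2. ev k = of_real ((pi * real k)\<^sup>2 / 4) + of_nat k * \<kappa> k) \<and>
           (\<lambda>k. (norm (\<kappa> k))\<^sup>2) summable_on {2..}"
proof -
  obtain B where "weak_deriv_L2 q B" using W21_01_imp_weak_deriv_L2[OF assms(1)] by blast
  then interpret weak_deriv_L2 q B .
  obtain N0 where N0: "N0 \<ge> 1"
    "\<And>N. N \<ge> N0 \<Longrightarrow> finite {p. char_fun q p = 0 \<and> norm p < circle_radius N}"
    "\<And>N. N \<ge> N0 \<Longrightarrow> (\<Sum>p\<in>{p. char_fun q p = 0 \<and> norm p < circle_radius N}. zorder (char_fun q) p) = int N - 1"
    using count_zeros[OF assms(3,2)] by blast
  have mono: "mono circle_radius"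
    unfolding circle_radius_def by (intro monoI power_mono mult_left_mono) auto
  have unbounded: "\<exists>N. x < circle_radius N" for x
  proof -
    obtain N :: nat where N: "max 1 x < real N" using reals_Archimedean2 by blast
    have "real N \<le> pi * (real N / 2 + 1 / 4)"
    proof -
      have "real N = 2 * (real N / 2)" by simp
      also have "\<dots> \<le> pi * (real N / 2 + 1 / 4)" using pi_gt3 by (intro mult_mono) auto
      finally show ?thesis .
    qed
    moreover have "real N \<le> (real N)\<^sup>2" using N by (simp add: power2_eq_square)
    moreover from calculation(1) have "(real N)\<^sup>2 \<le> circle_radius N"
      unfolding circle_radius_def by (intro power_mono) auto
    ultimately have "x < circle_radius N" using N by linarith
    then show ?thesis by blast
  qed
  obtain ev where ev: "enumerates_zeros (char_fun q) {2..} ev"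
    "\<And>k. k > N0 \<Longrightarrow> circle_radius (k - 1) \<le> norm (ev k) \<and> norm (ev k) < circle_radius k"
    using enumerate_zeros_by_annuli[OF char_fun_holomorphic[OF cont] mono unbounded N0] by blast
  define \<kappa> where "\<kappa> k = (ev k - of_real ((pi * real k)\<^sup>2 / 4)) / of_nat k" for k
  obtain C R where C: "C \<ge> 0" "R \<ge> 1" "\<And>\<rho>. Re \<rho> \<ge> 0 \<Longrightarrow> norm \<rho> \<ge> R \<Longrightarrow> char_fun q (\<rho>\<^sup>2) = 0 \<Longrightarrow>
    \<exists>m. norm (2 * \<rho> - of_real (pi * real m)) \<le> 1 / 2 \<and>
        norm (2 * \<rho> - of_real (pi * real m)) \<le> C * (fourier_size m + 1 / norm \<rho>)"
    using zero_localisation[OF assms(3,2)] by blast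
  define N1 where "N1 = max (N0 + 1) (nat \<lceil>2 * R\<rceil> + 2)"
  have bound: "(norm (\<kappa> k))\<^sup>2 \<le> 25 * C\<^sup>2 * (2 * ((fourier_size k)\<^sup>2 + 4 * (1 / (real k)\<^sup>2)))" if k: "k \<ge> N1" for k
  proof -
    have "k > N0" "k \<ge> 2" "nat \<lceil>2 * R\<rceil> \<le> k" using k unfolding N1_def by linarith+
    then have "2 * R \<le> real k" using real_nat_ceiling_ge[of "2 * R"] by linarith
    define \<rho> where "\<rho> = csqrt (ev k)"
    have \<rho>2: "\<rho>\<^sup>2 = ev k" by (simp add: \<rho>_def)
    have "norm (ev k) = (norm \<rho>)\<^sup>2" by (simp add: norm_power[symmetric] \<rho>2)
    then have sq: "(pi * (real (k - 1) / 2 + 1 / 4))\<^sup>2 \<le> (norm \<rho>)\<^sup>2" "(norm \<rho>)\<^sup>2 < (pi * (real k / 2 + 1 / 4))\<^sup>2"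
      using ev(2)[OF \<open>k > N0\<close>] by (auto simp: circle_radius_def)
    have "pi * (real (k - 1) / 2 + 1 / 4) \<le> norm \<rho>" using sq(1) by (rule power2_le_imp_le) simp
    then have lo: "pi * (real k - 1 / 2) \<le> 2 * norm \<rho>" using \<open>k \<ge> 2\<close> by (simp add: of_nat_diff field_simps)
    have "norm \<rho> < pi * (real k / 2 + 1 / 4)" using sq(2) by (rule power_less_imp_less_base) simp
    then have hi: "2 * norm \<rho> < pi * (real k + 1 / 2)" by (simp add: field_simps)
    have "real k \<le> 2 * norm \<rho>"
    proof -
      have "real k \<le> 3 * (real k - 1 / 2)" using \<open>k \<ge> 2\<close> by simp
      also have "\<dots> \<le> pi * (real k - 1 / 2)" using pi_gt3 \<open>k \<ge> 2\<close> by (intro mult_right_mono) auto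
      finally show ?thesis using lo by linarith
    qed
    then have "norm \<rho> \<ge> R" using \<open>2 * R \<le> real k\<close> by linarith
    then have "norm \<rho> > 0" using C(2) by linarith
    then have inv: "1 / norm \<rho> \<le> 2 / real k"
      using \<open>real k \<le> 2 * norm \<rho>\<close> \<open>k \<ge> 2\<close> by (simp add: divide_simps)
    have "char_fun q (ev k) = 0"
      using ev(1) \<open>k \<ge> 2\<close> unfolding enumerates_zeros_def by blast
    moreover have "Re \<rho> \<ge> 0" unfolding \<rho>_def using Re_csqrt by simp
    ultimately obtain m where m: "norm (2 * \<rho> - of_real (pi * real m)) \<le> 1 / 2"
        "norm (2 * \<rho> - of_real (pi * real m)) \<le> C * (fourier_size m + 1 / norm \<rho>)"
      using C(3)[of \<rho>] \<open>norm \<rho> \<ge> R\<close> \<rho>2 by auto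
    \<comment> \<open>the annulus confines \<open>2|\<rho>|\<close> to an interval of length \<open>\<pi>\<close> around \<open>\<pi>k\<close>, and \<open>2\<rho>\<close> is within \<open>1/2\<close> of \<open>\<pi>m\<close>\<close>
    have "m = k"
    proof -
      have "\<bar>norm (2 * \<rho>) - norm (of_real (pi * real m) :: complex)\<bar> \<le> 1 / 2"
        using m(1) norm_triangle_ineq3 order_trans by blast
      then have "\<bar>2 * norm \<rho> - pi * real m\<bar> \<le> 1 / 2" by (simp add: norm_mult)
      then have "pi * (real m - real k) < pi * 1" "pi * (real k - real m) < pi * 1"
        using lo hi pi_gt3 unfolding right_diff_distrib distrib_left by linarith+
      then have "real m - real k < 1" "real k - real m < 1"
        using pi_gt_zero by (simp_all only: mult_less_cancel_left_pos)
      then show ?thesis by linarith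
    qed
    define \<epsilon> where "\<epsilon> = 2 * \<rho> - of_real (pi * real k)"
    have \<epsilon>: "norm \<epsilon> \<le> C * (fourier_size k + 2 / real k)"
    proof -
      have "norm \<epsilon> \<le> C * (fourier_size k + 1 / norm \<rho>)" using m(2) \<open>m = k\<close> by (simp add: \<epsilon>_def)
      also have "\<dots> \<le> C * (fourier_size k + 2 / real k)" using inv C(1) by (intro mult_left_mono) auto
      finally show ?thesis .
    qed
    have diff: "ev k - of_real ((pi * real k)\<^sup>2 / 4) = \<epsilon> * (2 * \<rho> + of_real (pi * real k)) / 4"
      unfolding \<rho>2[symmetric] \<epsilon>_def by (simp add: field_simps power2_eq_square)
    have "norm (\<kappa> k) = norm \<epsilon> * norm (2 * \<rho> + of_real (pi * real k)) / 4 / real k"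
      unfolding \<kappa>_def diff by (simp add: norm_mult norm_divide)
    also have "\<dots> \<le> norm \<epsilon> * (20 * real k) / 4 / real k"
    proof (intro divide_right_mono mult_left_mono)
      have "norm (2 * \<rho> + of_real (pi * real k)) \<le> 2 * norm \<rho> + pi * real k"
        by (rule order_trans[OF norm_triangle_ineq]) (simp add: norm_mult)
      also have "\<dots> \<le> pi * (3 * real k)"
      proof -
        have "pi * (real k + 1 / 2) \<le> pi * (2 * real k)" using \<open>k \<ge> 2\<close> by (intro mult_left_mono) auto
        then have "2 * norm \<rho> + pi * real k \<le> pi * (2 * real k) + pi * real k" using hi by linarith
        then show ?thesis by simp
      qed
      also have "\<dots> \<le> 4 * (3 * real k)" using pi_less_4 by (intro mult_right_mono) auto
      finally show "norm (2 * \<rho> + of_real (pi * real k)) \<le> 20 * real k" by simp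
    qed auto
    also have "\<dots> = 5 * norm \<epsilon>" using \<open>k \<ge> 2\<close> by simp
    also have "\<dots> \<le> 5 * (C * (fourier_size k + 2 / real k))" using \<epsilon> by simp
    finally have "(norm (\<kappa> k))\<^sup>2 \<le> (5 * (C * (fourier_size k + 2 / real k)))\<^sup>2" by (intro power_mono) auto
    also have "\<dots> = 25 * C\<^sup>2 * (fourier_size k + 2 / real k)\<^sup>2" by (simp add: power_mult_distrib)
    also have "\<dots> \<le> 25 * C\<^sup>2 * (2 * ((fourier_size k)\<^sup>2 + 4 * (1 / (real k)\<^sup>2)))"
    proof (intro mult_left_mono)
      have "(x + y)\<^sup>2 \<le> 2 * (x\<^sup>2 + y\<^sup>2)" for x y :: real
        using zero_le_power2[of "x - y"] by (simp add: power2_sum power2_diff)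
      from this[of "fourier_size k" "2 / real k"]
      show "(fourier_size k + 2 / real k)\<^sup>2 \<le> 2 * ((fourier_size k)\<^sup>2 + 4 * (1 / (real k)\<^sup>2))"
        by (simp add: power_divide)
    qed auto
    finally show ?thesis .
  qed
  have "summable (\<lambda>k. 25 * C\<^sup>2 * (2 * ((fourier_size k)\<^sup>2 + 4 * (1 / (real k)\<^sup>2))))"
    using inverse_power_summable[of 2, where 'a = real]
    by (intro summable_mult summable_add fourier_size_summable) (simp add: inverse_eq_divide)
  then have "summable (\<lambda>k. (norm (\<kappa> k))\<^sup>2)"
    by (rule summable_comparison_test'[where N = N1]) (use bound in auto)
  then have "(\<lambda>k. (norm (\<kappa> k))\<^sup>2) summable_on UNIV"
    by (subst summable_on_UNIV_nonneg_real_iff) auto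
  then have "(\<lambda>k. (norm (\<kappa> k))\<^sup>2) summable_on {2..}"
    by (rule summable_on_subset_banach) auto
  moreover have "\<forall>k\<ge>2. ev k = of_real ((pi * real k)\<^sup>2 / 4) + of_nat k * \<kappa> k"
    by (simp add: \<kappa>_def)
  ultimately show ?thesis using ev(1) by blast
qed

end
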